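(* Let $\mathcal{M}=(M,g)$ be a connected pseudo-Riemannian manifold which is homothety homogeneous with non-trivial homothety character $\lambda$ and which is not VSI. Let $\mathcal{R}$ be a scalar Weyl invariant (of order $\ell$) which does not vanish on $M$. Then: (1) The level sets $M_c^{\mathcal{R}}=\{P\in M:\mu_{\mathcal{R}}(P)=c\}$ are smooth submanifolds of $M$ which have codimension $1$, which are independent of the particular $\mathcal{R}$ chosen, and on which $\mathcal{I}$ acts transitively. (2) If $\mathcal{M}$ is Riemannian, then there exists a constant $\kappa=\kappa(M)>0$ so that $\operatorname{dist}(M_c^{\mathcal{R}},M_d^{\mathcal{R}})=\kappa|c-d|$ for all $c,d>0$. Furthermore, $\mathcal{M}$ is incomplete.
   Context: Setting: $\mathcal{H}$ is a connected Lie subgroup of the group of homotheties of $\mathcal{M}$ (diffeomorphisms $\Phi$ of $M$ with $\Phi^*g=\lambda(\Phi)^2g$ for a constant $\lambda(\Phi)>0$) which acts transitively on $M$ (not necessarily the full group of homotheties). The homothety character is the smooth multiplicative character $\lambda:\mathcal{H}\to\mathbb{R}^+$, and $\mathcal{I}:=\ker(\lambda)$ is the subgroup of isometries contained in $\mathcal{H}$. "Non-trivial homothety character" means $\lambda\not\equiv1$, i.e. $\mathcal{I}\ne\mathcal{H}$. A scalar Weyl invariant of order $\ell$ is a scalar invariant constructed from the covariant derivatives of the curvature tensor by contracting indices in pairs (using $g$) and involving a total of $\ell$ derivatives of the metric tensor; e.g. the scalar curvature has order $2$, and $|R|^2$, $|\rho|^2$, $\Delta\tau$ have order $4$. $\mathcal{M}$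 is VSI (vanishing scalar invariants) if all scalar Weyl invariants vanish identically. Let $P_0$ be a fixed base point of $M$. For $\mathcal{R}$ a scalar Weyl invariant of order $\ell$ which does not vanish on $M$, set $\mu_{\mathcal{R}}(P):=\left|\mathcal{R}(P_0)/\mathcal{R}(P)\right|^{1/\ell}$. Here $c$ ranges over $\mathbb{R}^+$. *)

theory Defs
  imports "HOL-Analysis.Analysis" "HOL-Algebra.Group_Action" "HOL-Combinatorics.Permutations"
begin

section \<open>Smooth maps and smooth manifolds\<close>

text \<open>Only used on open sets, where it is the usual notion of a map of class \<open>C\<^sup>k\<close>.\<close>

primrec Ck_on ::
  "nat \<Rightarrow> 'e::euclidean_space set \<Rightarrow> ('e \<Rightarrow> 'f::real_normed_vector) \<Rightarrow> bool" where
  "Ck_on 0 S f \<longleftrightarrow> continuous_on S f"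
| "Ck_on (Suc k) S f \<longleftrightarrow>
     (\<forall>x\<in>S. f differentiable (at x)) \<and> (\<forall>v. Ck_on k S (\<lambda>x. frechet_derivative f (at x) v))"

definition smooth_on ::
  "'e::euclidean_space set \<Rightarrow> ('e \<Rightarrow> 'f::real_normed_vector) \<Rightarrow> bool" where
  "smooth_on S f \<longleftrightarrow> (\<forall>k. Ck_on k S f)"

type_synonym ('a, 'e) chart = "'a set \<times> ('a \<Rightarrow> 'e)"

definition is_chart :: "'a topology \<Rightarrow> ('a, 'e::euclidean_space) chart \<Rightarrow> bool" where
  "is_chart X c \<longleftrightarrow> (case c of (U, \<phi>) \<Rightarrow>
     openin X U \<and> open (\<phi> ` U) \<and>
     homeomorphic_map (subtopology X U) (top_of_set (\<phi> ` U)) \<phi>)"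

definition smoothly_compatible ::
  "('a, 'e::euclidean_space) chart \<Rightarrow> ('a, 'e) chart \<Rightarrow> bool" where
  "smoothly_compatible c d \<longleftrightarrow> (case (c, d) of ((U, \<phi>), (V, \<psi>)) \<Rightarrow>
     smooth_on (\<phi> ` (U \<inter> V)) (\<psi> \<circ> inv_into U \<phi>) \<and>
     smooth_on (\<psi> ` (U \<inter> V)) (\<phi> \<circ> inv_into V \<psi>))"

text \<open>The atlas is required to be maximal, i.e. it is the smooth structure itself.\<close>

definition smooth_manifold :: "'a topology \<Rightarrow> ('a, 'e::euclidean_space) chart set \<Rightarrow> bool" where
  "smooth_manifold X \<A> \<longleftrightarrow>
     Hausdorff_space X \<and> second_countable X \<and>
     (\<forall>c\<in>\<A>. is_chart X c) \<and> (\<Union>c\<in>\<A>. fst c) = topspace X \<and>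
     (\<forall>c\<in>\<A>. \<forall>d\<in>\<A>. smoothly_compatible c d) \<and>
     (\<forall>c. is_chart X c \<and> (\<forall>d\<in>\<A>. smoothly_compatible c d) \<longrightarrow> c \<in> \<A>)"

text \<open>For smoothness of maps any (not necessarily maximal) atlases may be given; in particular
  the atlas of product charts, or the identity chart of an open set of reals.\<close>

definition smooth_map ::
  "'a topology \<Rightarrow> ('a, 'e::euclidean_space) chart set \<Rightarrow>
   'b topology \<Rightarrow> ('b, 'f::euclidean_space) chart set \<Rightarrow> ('a \<Rightarrow> 'b) \<Rightarrow> bool" where
  "smooth_map X \<A> Y \<B> F \<longleftrightarrow>
     continuous_map X Y F \<and>
     (\<forall>(U, \<phi>)\<in>\<A>. \<forall>(V, \<psi>)\<in>\<B>.
        smooth_on (\<phi> ` {P\<in>U. F P \<in> V}) (\<psi> \<circ> F \<circ> inv_into U \<phi>))"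

definition prod_atlas ::
  "('a, 'e) chart set \<Rightarrow> ('b, 'f) chart set \<Rightarrow> ('a \<times> 'b, 'e \<times> 'f) chart set" where
  "prod_atlas \<A> \<B> = {(U \<times> V, map_prod \<phi> \<psi>) |U \<phi> V \<psi>. (U, \<phi>) \<in> \<A> \<and> (V, \<psi>) \<in> \<B>}"

text \<open>Embedded submanifold of codimension \<open>k\<close>, by slice charts.\<close>

definition smooth_submanifold_codim ::
  "('a, 'e::euclidean_space) chart set \<Rightarrow> nat \<Rightarrow> 'a set \<Rightarrow> bool" where
  "smooth_submanifold_codim \<A> k S \<longleftrightarrow>
     (\<forall>P\<in>S. \<exists>(U, \<phi>)\<in>\<A>. P \<in> U \<and>
        (\<exists>L. subspace L \<and> dim L + k = DIM('e) \<and> \<phi> ` (U \<inter> S) = \<phi> ` U \<inter> L))"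


section \<open>Pseudo-Riemannian metrics\<close>

text \<open>A metric is given by its component matrices \<open>g c P\<close> at \<open>P\<close> with respect to the
  coordinate frame of each chart \<open>c\<close> around \<open>P\<close>, subject to the tensor transformation law.
  \<open>jacobian c d F P\<close> is the matrix of the differential of \<open>F\<close> at \<open>P\<close>, with respect to the
  chart \<open>c\<close> around \<open>P\<close> and the chart \<open>d\<close> around \<open>F P\<close>.\<close>

type_synonym ('a, 'n) metric_components = "('a, real^'n) chart \<Rightarrow> 'a \<Rightarrow> real^'n^'n"

definition jacobian ::
  "('a, real^'n) chart \<Rightarrow> ('b, real^'n) chart \<Rightarrow> ('a \<Rightarrow> 'b) \<Rightarrow> 'a \<Rightarrow> real^'n^'n" where
  "jacobian c d F P =
     matrix (frechet_derivative (snd d \<circ> F \<circ> inv_into (fst c) (snd c)) (at (snd c P)))"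

definition pseudo_riemannian_metric ::
  "('a, real^'n) chart set \<Rightarrow> ('a, 'n) metric_components \<Rightarrow> bool" where
  "pseudo_riemannian_metric \<A> g \<longleftrightarrow>
     (\<forall>c\<in>\<A>. \<forall>P\<in>fst c. transpose (g c P) = g c P \<and> invertible (g c P)) \<and>
     (\<forall>c\<in>\<A>. smooth_on (snd c ` fst c) (g c \<circ> inv_into (fst c) (snd c))) \<and>
     (\<forall>c\<in>\<A>. \<forall>d\<in>\<A>. \<forall>P\<in>fst c \<inter> fst d.
        g c P = transpose (jacobian c d (\<lambda>x. x) P) ** g d P ** jacobian c d (\<lambda>x. x) P)"

definition riemannian ::
  "('a, real^'n) chart set \<Rightarrow> ('a, 'n) metric_components \<Rightarrow> bool" where
  "riemannian \<A> g \<longleftrightarrow> (\<forall>c\<in>\<A>. \<forall>P\<in>fst c. \<forall>v. v \<noteq> 0 \<longrightarrow> v \<bullet> (g c P *v v) > 0)"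


section \<open>Homotheties\<close>

text \<open>As in \<^const>\<open>BijGroup\<close>, self-maps of the manifold are extensional functions, so that
  equality of functions is equality of maps.\<close>

definition diffeomorphism :: "'a topology \<Rightarrow> ('a, 'e::euclidean_space) chart set \<Rightarrow> ('a \<Rightarrow> 'a) \<Rightarrow> bool"
  where
  "diffeomorphism X \<A> \<Phi> \<longleftrightarrow>
     \<Phi> \<in> Bij (topspace X) \<and> smooth_map X \<A> X \<A> \<Phi> \<and>
     smooth_map X \<A> X \<A> (inv_into (topspace X) \<Phi>)"

text \<open>\<open>\<Phi>\<^sup>* g = r\<^sup>2 g\<close> with \<open>r > 0\<close>.\<close>

definition homothety_with_factor ::
  "'a topology \<Rightarrow> ('a, real^'n) chart set \<Rightarrow> ('a, 'n) metric_components \<Rightarrow> ('a \<Rightarrow> 'a) \<Rightarrow> real \<Rightarrow> bool"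
  where
  "homothety_with_factor X \<A> g \<Phi> r \<longleftrightarrow>
     diffeomorphism X \<A> \<Phi> \<and> r > 0 \<and>
     (\<forall>c\<in>\<A>. \<forall>d\<in>\<A>. \<forall>P\<in>fst c. \<Phi> P \<in> fst d \<longrightarrow>
        transpose (jacobian c d \<Phi> P) ** g d (\<Phi> P) ** jacobian c d \<Phi> P = r\<^sup>2 *\<^sub>R g c P)"

definition homotheties ::
  "'a topology \<Rightarrow> ('a, real^'n) chart set \<Rightarrow> ('a, 'n) metric_components \<Rightarrow> ('a \<Rightarrow> 'a) set" where
  "homotheties X \<A> g = {\<Phi>. \<exists>r. homothety_with_factor X \<A> g \<Phi> r}"

definition homothety_character ::
  "'a topology \<Rightarrow> ('a, real^'n) chart set \<Rightarrow> ('a, 'n) metric_components \<Rightarrow> ('a \<Rightarrow> 'a) \<Rightarrow> real" where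
  "homothety_character X \<A> g \<Phi> = (THE r. homothety_with_factor X \<A> g \<Phi> r)"

text \<open>The group structure on a set \<open>H\<close> of homotheties is inherited from \<open>BijGroup\<close>. Its
  structure as a connected Lie group is given by a topology \<open>T\<close> and a smooth structure \<open>\<B>\<close> on
  \<open>H\<close>, which need not be those of an embedded subgroup (Lie subgroups are immersed subgroups).
  The inclusion into the Lie group of all homotheties is smooth if and only if the action
  \<open>H \<times> M \<rightarrow> M\<close> is.\<close>

definition connected_lie_group_of_homotheties ::
  "'a topology \<Rightarrow> ('a, real^'n) chart set \<Rightarrow> ('a, 'n) metric_components \<Rightarrow>
   ('a \<Rightarrow> 'a) set \<Rightarrow> ('a \<Rightarrow> 'a) topology \<Rightarrow> ('a \<Rightarrow> 'a, 'e::euclidean_space) chart set \<Rightarrow> bool" where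
  "connected_lie_group_of_homotheties X \<A> g H T \<B> \<longleftrightarrow>
     H \<subseteq> homotheties X \<A> g \<and> subgroup H (BijGroup (topspace X)) \<and>
     topspace T = H \<and> smooth_manifold T \<B> \<and> connected_space T \<and>
     smooth_map (prod_topology T T) (prod_atlas \<B> \<B>) T \<B>
       (\<lambda>(\<Phi>, \<Psi>). \<Phi> \<otimes>\<^bsub>BijGroup (topspace X)\<^esub> \<Psi>) \<and>
     smooth_map T \<B> T \<B> (\<lambda>\<Phi>. inv\<^bsub>BijGroup (topspace X)\<^esub> \<Phi>) \<and>
     smooth_map (prod_topology T X) (prod_atlas \<B> \<A>) X \<A> (\<lambda>(\<Phi>, P). \<Phi> P)"

text \<open>A group \<open>G\<close> of bijections of the space acts transitively on the subset \<open>S\<close>.\<close>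

definition acts_transitively :: "'a topology \<Rightarrow> ('a \<Rightarrow> 'a) set \<Rightarrow> 'a set \<Rightarrow> bool" where
  "acts_transitively X G S \<longleftrightarrow>
     transitive_action (BijGroup (topspace X)\<lparr>carrier := G\<rparr>) S (\<lambda>\<Phi>. restrict \<Phi> S)"

definition isometries_in ::
  "'a topology \<Rightarrow> ('a, real^'n) chart set \<Rightarrow> ('a, 'n) metric_components \<Rightarrow> ('a \<Rightarrow> 'a) set \<Rightarrow> ('a \<Rightarrow> 'a) set"
  where
  "isometries_in X \<A> g H = {\<Phi>\<in>H. homothety_character X \<A> g \<Phi> = 1}"


section \<open>Scalar Weyl invariants\<close>

text \<open>Coordinate expressions on an open subset of \<open>real^'n\<close>, with \<open>G\<close> the matrix of the metric.
  A covariant tensor field of rank \<open>r\<close> is given by its components, indexed by the lists of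
  length \<open>r\<close> over the coordinate indices.\<close>

definition partial :: "'n \<Rightarrow> (real^'n \<Rightarrow> real) \<Rightarrow> real^'n \<Rightarrow> real" where
  "partial i f x = frechet_derivative f (at x) (axis i 1)"

text \<open>\<open>christoffel G k i j\<close> is the symbol with upper index \<open>k\<close> and lower indices \<open>i\<close>, \<open>j\<close>.\<close>

definition christoffel :: "(real^'n \<Rightarrow> real^'n^'n) \<Rightarrow> 'n \<Rightarrow> 'n \<Rightarrow> 'n \<Rightarrow> real^'n \<Rightarrow> real" where
  "christoffel G k i j x =
     1 / 2 * (\<Sum>l\<in>UNIV. matrix_inv (G x) $ k $ l *
       (partial i (\<lambda>y. G y $ j $ l) x + partial j (\<lambda>y. G y $ i $ l) x
        - partial l (\<lambda>y. G y $ i $ j) x))"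

text \<open>\<open>R\<^sub>i\<^sub>j\<^sub>k\<^sub>l = g(R(e\<^sub>i, e\<^sub>j) e\<^sub>k, e\<^sub>l)\<close> where
  \<open>R(X, Y) = \<nabla>\<^sub>X \<nabla>\<^sub>Y - \<nabla>\<^sub>Y \<nabla>\<^sub>X - \<nabla>\<^bsub>[X, Y]\<^esub>\<close>.\<close>

definition curvature :: "(real^'n \<Rightarrow> real^'n^'n) \<Rightarrow> 'n list \<Rightarrow> real^'n \<Rightarrow> real" where
  "curvature G is x = (case is of
     [i, j, k, l] \<Rightarrow>
       (\<Sum>m\<in>UNIV. G x $ l $ m *
         (partial i (christoffel G m j k) x - partial j (christoffel G m i k) x
          + (\<Sum>p\<in>UNIV. christoffel G m i p x * christoffel G p j k x
                      - christoffel G m j p x * christoffel G p i k x)))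
   | _ \<Rightarrow> 0)"

text \<open>The new index of a covariant derivative is put in front.\<close>

definition cov_deriv ::
  "(real^'n \<Rightarrow> real^'n^'n) \<Rightarrow> ('n list \<Rightarrow> real^'n \<Rightarrow> real) \<Rightarrow> 'n list \<Rightarrow> real^'n \<Rightarrow> real" where
  "cov_deriv G A is x = (case is of
     [] \<Rightarrow> 0
   | i # js \<Rightarrow>
       partial i (A js) x
       - (\<Sum>a<length js. \<Sum>m\<in>UNIV. christoffel G m i (js ! a) x * A (js[a := m]) x))"

definition nabla_curvature ::
  "(real^'n \<Rightarrow> real^'n^'n) \<Rightarrow> nat \<Rightarrow> 'n list \<Rightarrow> real^'n \<Rightarrow> real" where
  "nabla_curvature G k = (cov_deriv G ^^ k) (curvature G)"

text \<open>The tensor product \<open>\<nabla>\<^bsup>k1\<^esup>R \<otimes> \<dots> \<otimes> \<nabla>\<^bsup>kr\<^esup>R\<close> and its rank.\<close>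

primrec curvature_product ::
  "(real^'n \<Rightarrow> real^'n^'n) \<Rightarrow> nat list \<Rightarrow> 'n list \<Rightarrow> real^'n \<Rightarrow> real" where
  "curvature_product G [] is x = 1"
| "curvature_product G (k # ks) is x =
     nabla_curvature G k (take (k + 4) is) x * curvature_product G ks (drop (k + 4) is) x"

definition total_rank :: "nat list \<Rightarrow> nat" where
  "total_rank ks = (\<Sum>k\<leftarrow>ks. k + 4)"

text \<open>Complete contraction. The permutation \<open>\<sigma>\<close> of the index slots encodes the pairing: the
  slots labelled by \<open>2a\<close> and \<open>2a + 1\<close> are contracted with each other using the inverse metric.\<close>

definition full_contraction ::
  "(real^'n::finite \<Rightarrow> real^'n^'n) \<Rightarrow> nat list \<Rightarrow> (nat \<Rightarrow> nat) \<Rightarrow> real^'n \<Rightarrow> real" where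
  "full_contraction G ks \<sigma> x =
     (\<Sum>is\<in>{is. length is = total_rank ks}.
        (\<Prod>a<total_rank ks div 2. matrix_inv (G x) $ (is ! (2 * a)) $ (is ! (2 * a + 1))) *
        curvature_product G ks (map (\<lambda>p. is ! \<sigma> p) [0..<total_rank ks]) x)"

text \<open>A formal Weyl invariant is a linear combination of terms (coefficient, numbers of covariant
  derivatives of the curvature factors, pairing). As \<open>\<nabla>\<^bsup>k\<^esup>R\<close> involves \<open>k + 2\<close> derivatives of
  the metric, all terms are required to have \<open>\<Sum>(k\<^sub>i + 2) = l\<close>, with at least one factor.\<close>

type_synonym weyl_expression = "(real \<times> nat list \<times> (nat \<Rightarrow> nat)) list"

definition weyl_expression_of_order :: "nat \<Rightarrow> weyl_expression \<Rightarrow> bool" where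
  "weyl_expression_of_order l W \<longleftrightarrow>
     (\<forall>(a, ks, \<sigma>)\<in>set W. ks \<noteq> [] \<and> (\<Sum>k\<leftarrow>ks. k + 2) = l \<and>
        even (total_rank ks) \<and> \<sigma> permutes {..<total_rank ks})"

definition eval_weyl :: "(real^'n::finite \<Rightarrow> real^'n^'n) \<Rightarrow> weyl_expression \<Rightarrow> real^'n \<Rightarrow> real" where
  "eval_weyl G W x = (\<Sum>(a, ks, \<sigma>)\<leftarrow>W. a * full_contraction G ks \<sigma> x)"

text \<open>Contractions of tensors do not depend on the coordinates, so every formal Weyl invariant
  determines a function on the manifold, computed by the same formula in every chart.\<close>

definition scalar_weyl_invariant ::
  "('a, real^'n::finite) chart set \<Rightarrow> ('a, 'n) metric_components \<Rightarrow> nat \<Rightarrow> ('a \<Rightarrow> real) \<Rightarrow> bool" where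
  "scalar_weyl_invariant \<A> g l R \<longleftrightarrow>
     (\<exists>W. weyl_expression_of_order l W \<and>
        (\<forall>c\<in>\<A>. \<forall>P\<in>fst c. R P = eval_weyl (g c \<circ> inv_into (fst c) (snd c)) W (snd c P)))"

definition VSI ::
  "'a topology \<Rightarrow> ('a, real^'n::finite) chart set \<Rightarrow> ('a, 'n) metric_components \<Rightarrow> bool" where
  "VSI X \<A> g \<longleftrightarrow> (\<forall>l R. scalar_weyl_invariant \<A> g l R \<longrightarrow> (\<forall>P\<in>topspace X. R P = 0))"

definition weyl_mu :: "'a \<Rightarrow> nat \<Rightarrow> ('a \<Rightarrow> real) \<Rightarrow> 'a \<Rightarrow> real" where
  "weyl_mu P0 l R P = \<bar>R P0 / R P\<bar> powr (1 / real l)"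

definition level_set :: "'a topology \<Rightarrow> 'a \<Rightarrow> nat \<Rightarrow> ('a \<Rightarrow> real) \<Rightarrow> real \<Rightarrow> 'a set" where
  "level_set X P0 l R c = {P\<in>topspace X. weyl_mu P0 l R P = c}"


section \<open>Riemannian distance\<close>

definition smooth_path_on ::
  "'a topology \<Rightarrow> ('a, 'e::euclidean_space) chart set \<Rightarrow> real set \<Rightarrow> (real \<Rightarrow> 'a) \<Rightarrow> bool" where
  "smooth_path_on X \<A> J \<gamma> \<longleftrightarrow> smooth_map (top_of_set J) {(J, \<lambda>t. t)} X \<A> \<gamma>"

text \<open>Smoothness on a closed subinterval means extendability to a smooth path on an open set.\<close>

definition piecewise_smooth_path ::
  "'a topology \<Rightarrow> ('a, 'e::euclidean_space) chart set \<Rightarrow> (real \<Rightarrow> 'a) \<Rightarrow> bool" where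
  "piecewise_smooth_path X \<A> \<gamma> \<longleftrightarrow>
     (\<exists>m. \<exists>t :: nat \<Rightarrow> real. t 0 = 0 \<and> t m = 1 \<and>
        (\<forall>i<m. t i < t (Suc i) \<and>
          (\<exists>J \<delta>. open J \<and> {t i..t (Suc i)} \<subseteq> J \<and> smooth_path_on X \<A> J \<delta> \<and>
             (\<forall>s\<in>{t i..t (Suc i)}. \<gamma> s = \<delta> s))))"

text \<open>The speed does not depend on the choice of the chart; its values at the finitely many
  break points are irrelevant for the length.\<close>

definition speed ::
  "('a, real^'n) chart set \<Rightarrow> ('a, 'n) metric_components \<Rightarrow> (real \<Rightarrow> 'a) \<Rightarrow> real \<Rightarrow> real" where
  "speed \<A> g \<gamma> t =
     (let c = (SOME c. c \<in> \<A> \<and> \<gamma> t \<in> fst c);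
          v = vector_derivative (snd c \<circ> \<gamma>) (at t)
      in sqrt (v \<bullet> (g c (\<gamma> t) *v v)))"

definition path_length ::
  "('a, real^'n) chart set \<Rightarrow> ('a, 'n) metric_components \<Rightarrow> (real \<Rightarrow> 'a) \<Rightarrow> real" where
  "path_length \<A> g \<gamma> = integral {0..1} (speed \<A> g \<gamma>)"

text \<open>For a connected Riemannian manifold. The value 0 off the space is needed to have a
  \<^locale>\<open>Metric_space\<close>.\<close>

definition riemannian_dist ::
  "'a topology \<Rightarrow> ('a, real^'n) chart set \<Rightarrow> ('a, 'n) metric_components \<Rightarrow> 'a \<Rightarrow> 'a \<Rightarrow> real" where
  "riemannian_dist X \<A> g P Q =
     (if P \<in> topspace X \<and> Q \<in> topspace X
      then Inf {path_length \<A> g \<gamma> |\<gamma>. piecewise_smooth_path X \<A> \<gamma> \<and> \<gamma> 0 = P \<and> \<gamma> 1 = Q}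
      else 0)"

definition riemannian_set_dist ::
  "'a topology \<Rightarrow> ('a, real^'n) chart set \<Rightarrow> ('a, 'n) metric_components \<Rightarrow> 'a set \<Rightarrow> 'a set \<Rightarrow> real" where
  "riemannian_set_dist X \<A> g A B = Inf {riemannian_dist X \<A> g P Q |P Q. P \<in> A \<and> Q \<in> B}"

definition riemannian_complete ::
  "'a topology \<Rightarrow> ('a, real^'n) chart set \<Rightarrow> ('a, 'n) metric_components \<Rightarrow> bool" where
  "riemannian_complete X \<A> g \<longleftrightarrow> Metric_space.mcomplete (topspace X) (riemannian_dist X \<A> g)"

end

theory Submission
  imports Defs
begin

text \<open>In the chart transported by a homothety \<open>\<Phi>\<close> the metric components are those of the original
  chart times \<open>\<lambda>(\<Phi>)\<^sup>2\<close>, so a Weyl invariant of order \<open>l\<close> satisfies \<open>R (\<Phi> P) = R P / \<lambda>(\<Phi>)\<^sup>l\<close>, i.e.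
  \<open>\<mu> \<circ> \<Phi> = \<lambda>(\<Phi>) \<mu>\<close>. Hence \<open>\<lambda>(\<Phi>) = \<mu> (\<Phi> P\<^sub>0)\<close>, so the values of \<open>\<lambda>\<close> form a connected
  non-trivial subgroup of the positive reals, that is, everything. By homogeneity \<open>R\<close> has a critical point
  only if it is constant, so all level sets are regular.
  In the Riemannian case no gradient flow is needed: the distance \<open>D a b\<close> of the level sets of
  \<open>a\<close> and \<open>b\<close> is homogeneous, and it is additive because a path from one level set to another crosses the
  intermediate ones and the isometries act transitively on each. These properties force
  \<open>D a b = D 1 2 * \<bar>a - b\<bar>\<close>. The orbit of a point under a contraction is a Cauchy sequence
  along which \<open>\<mu>\<close> tends to \<open>0\<close>; it has no limit, since \<open>\<mu>\<close> is positive and Lipschitz.\<close>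

section \<open>Maps of class \<open>C\<^sup>k\<close>\<close>

text \<open>The atlas is maximal, so a homothety \<open>\<Phi>\<close> carries each chart to another
  chart of the atlas, and between these two charts \<open>\<Phi>\<close> is the identity in
  coordinates. A Weyl invariant is computed by the same formula in all charts; its behaviour under
  \<open>\<Phi>\<close> is therefore that of the formula when the matrix of the metric is multiplied
  by a constant, and contractions never have to be compared under a change of coordinates. That
  \<open>R\<close> does not vanish also makes the factor of a homothety unique, so that the
  character is well defined. The codimension claim asks for slice charts in the maximal atlas, hence
  for a local inverse of class \<open>C^k\<close> for every \<open>k\<close>; this is one reason for
  the calculus of \<open>Ck_on\<close>. The constant of the second claim is \<open>D 1 2\<close>.
  Its positivity is the analytic core of the Riemannian part: a path that leaves a coordinate ball
  has length at least some positive number, and the same bound separates points in the Riemannian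
  distance.\<close>

lemma Ck_on_continuous: "Ck_on k S f \<Longrightarrow> continuous_on S f"
  by (cases k) (auto intro!: continuous_at_imp_continuous_on differentiable_imp_continuous_within)

text \<open>Any formula \<open>f'\<close> for the derivative may replace
  \<open>frechet_derivative\<close>. Most closure properties below are inductions through this
  rule.\<close>

lemma Ck_on_SucI:
  assumes "\<And>x. x \<in> S \<Longrightarrow> (f has_derivative f' x) (at x)" "\<And>v. Ck_on k S (\<lambda>x. f' x v)" "open S"
  shows "Ck_on (Suc k) S f"
proof -
  have eq: "frechet_derivative f (at x) v = f' x v" if "x \<in> S" for x v
    using frechet_derivative_at[OF assms(1)[OF that]] by simp
  \<comment> \<open>Congruence is proved on the spot, because \<open>Ck_on_cong\<close> itself rests
    on the present rule.\<close>
  have cong: "Ck_on k S h" if "Ck_on k S h'" "\<And>x. x \<in> S \<Longrightarrow> h' x = h x" for h h' :: "'a \<Rightarrow> 'b"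
    using that
  proof (induction k arbitrary: h h')
    case 0
    then show ?case using continuous_on_cong by fastforce
  next
    case (Suc k)
    show ?case
    proof (simp, intro conjI ballI allI)
      fix x assume x: "x \<in> S"
      then obtain D where "(h' has_derivative D) (at x)"
        using Suc.prems(1) by (auto simp: differentiable_def)
      then have "(h has_derivative D) (at x)"
        by (rule has_derivative_transform_within_open[OF _ \<open>open S\<close> x]) (use Suc.prems(2) in auto)
      then show "h differentiable at x" by (auto simp: differentiable_def)
    next
      fix v
      show "Ck_on k S (\<lambda>x. frechet_derivative h (at x) v)"
      proof (rule Suc.IH[of "\<lambda>x. frechet_derivative h' (at x) v"])
        show "Ck_on k S (\<lambda>x. frechet_derivative h' (at x) v)" using Suc.prems by simp
        show "frechet_derivative h' (at x) v = frechet_derivative h (at x) v" if "x \<in> S" for x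
          using frechet_derivative_transform_within_open[OF _ \<open>open S\<close> that, of h' h] Suc.prems that
          by auto
      qed
    qed
  qed
  show ?thesis
    using assms(1) eq
    by (auto simp: differentiable_def intro!: cong[OF assms(2)])
qed

lemma Ck_on_has_derivative:
  "Ck_on (Suc k) S f \<Longrightarrow> x \<in> S \<Longrightarrow> (f has_derivative frechet_derivative f (at x)) (at x)"
  by (simp add: frechet_derivative_works)

lemma Ck_on_cong:
  assumes "Ck_on k S f" "\<And>x. x \<in> S \<Longrightarrow> f x = g x" "open S"
  shows "Ck_on k S g"
proof (cases k)
  case 0
  then show ?thesis using assms continuous_on_cong by fastforce
next
  case (Suc m)
  show ?thesis unfolding Suc
  proof (rule Ck_on_SucI[OF _ _ \<open>open S\<close>])
    show "(g has_derivative frechet_derivative f (at x)) (at x)" if "x \<in> S" for x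
      using has_derivative_transform_within_open[OF Ck_on_has_derivative[of m S f x] \<open>open S\<close> that]
        assms Suc that by auto
  qed (use assms Suc in auto)
qed

lemma Ck_on_SucD: "Ck_on (Suc k) S f \<Longrightarrow> Ck_on k S f"
proof (induction k arbitrary: f)
  case 0
  then show ?case using Ck_on_continuous by fastforce
qed auto

text \<open>The derivatives in \<open>Ck_on\<close> are taken \<open>at x\<close> and not within the
  set, so restriction does not affect them.\<close>

lemma Ck_on_subset: "Ck_on k S f \<Longrightarrow> T \<subseteq> S \<Longrightarrow> Ck_on k T f"
  by (induction k arbitrary: f) (auto intro: continuous_on_subset)

lemma Ck_on_const [simp]: "Ck_on k S (\<lambda>x. c)"
  by (induction k arbitrary: c) (auto simp: frechet_derivative_const)

lemma Ck_on_bounded_linear: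
  assumes "bounded_linear L" "Ck_on k S f" "open S"
  shows "Ck_on k S (\<lambda>x. L (f x))"
  using assms(2)
proof (induction k arbitrary: f)
  case 0
  then show ?case using bounded_linear.continuous_on[OF assms(1)] by auto
next
  case (Suc k)
  show ?case
  proof (rule Ck_on_SucI[OF _ _ \<open>open S\<close>])
    show "((\<lambda>x. L (f x)) has_derivative (\<lambda>v. L (frechet_derivative f (at x) v))) (at x)"
      if "x \<in> S" for x
      using bounded_linear.has_derivative[OF assms(1) Ck_on_has_derivative[OF Suc.prems that]] .
  qed (use Suc in auto)
qed

lemma Ck_on_id: "open S \<Longrightarrow> Ck_on k S (\<lambda>x. x)"
  by (cases k) (auto intro!: Ck_on_SucI[where f' = "\<lambda>x v. v"] has_derivative_ident)

lemma Ck_on_add: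
  assumes "Ck_on k S f" "Ck_on k S g" "open S"
  shows "Ck_on k S (\<lambda>x. f x + g x)"
  using assms(1,2)
proof (induction k arbitrary: f g)
  case 0
  then show ?case by (auto intro: continuous_on_add)
next
  case (Suc k)
  show ?case
  proof (rule Ck_on_SucI[OF _ _ \<open>open S\<close>])
    show "((\<lambda>x. f x + g x) has_derivative
        (\<lambda>v. frechet_derivative f (at x) v + frechet_derivative g (at x) v)) (at x)"
      if "x \<in> S" for x
      using has_derivative_add[OF Ck_on_has_derivative[OF Suc.prems(1) that]
          Ck_on_has_derivative[OF Suc.prems(2) that]] .
  qed (use Suc in auto)
qed

lemma Ck_on_bounded_bilinear:
  assumes "bounded_bilinear p" "Ck_on k S f" "Ck_on k S g" "open S"
  shows "Ck_on k S (\<lambda>x. p (f x) (g x))"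
  using assms(2,3)
proof (induction k arbitrary: f g)
  case 0
  then show ?case using bounded_bilinear.continuous_on[OF assms(1)] by auto
next
  case (Suc k)
  show ?case
  proof (rule Ck_on_SucI[OF _ _ \<open>open S\<close>])
    show "((\<lambda>x. p (f x) (g x)) has_derivative
        (\<lambda>v. p (f x) (frechet_derivative g (at x) v) + p (frechet_derivative f (at x) v) (g x))) (at x)"
      if "x \<in> S" for x
      using bounded_bilinear.FDERIV[OF assms(1) Ck_on_has_derivative[OF Suc.prems(1) that]
          Ck_on_has_derivative[OF Suc.prems(2) that]] .
  next
    show "Ck_on k S (\<lambda>x. p (f x) (frechet_derivative g (at x) v) + p (frechet_derivative f (at x) v) (g x))" for v
      using Suc.prems Ck_on_SucD[OF Suc.prems(1)] Ck_on_SucD[OF Suc.prems(2)]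
      by (intro Ck_on_add Suc.IH \<open>open S\<close>) auto
  qed
qed

lemma Ck_on_sum:
  assumes "\<And>i. i \<in> I \<Longrightarrow> Ck_on k S (f i)" "open S"
  shows "Ck_on k S (\<lambda>x. \<Sum>i\<in>I. f i x)"
  using assms(1)
  by (induction I rule: infinite_finite_induct) (auto intro: Ck_on_add \<open>open S\<close>)

text \<open>In the chain rule both the linear map and the vector it acts on vary with
  \<open>x\<close>. Expanding the vector in \<open>Basis\<close> leaves products of a function of
  class \<open>C^k\<close> with a composition whose outer map is a partial derivative of
  \<open>h\<close>, and the induction hypothesis covers the latter.\<close>

lemma Ck_on_compose:
  fixes f :: "'e::euclidean_space \<Rightarrow> 'f::euclidean_space"
    and h :: "'f \<Rightarrow> 'g::real_normed_vector"
  assumes "Ck_on k S f" "Ck_on k T h" "f ` S \<subseteq> T" "open S" "open T"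
  shows "Ck_on k S (\<lambda>x. h (f x))"
  using assms(1,2)
proof (induction k arbitrary: h)
  case 0
  then show ?case using assms(3) continuous_on_compose2 by (metis Ck_on.simps(1))
next
  case (Suc k)
  let ?D = "\<lambda>x v. \<Sum>b\<in>Basis. (frechet_derivative f (at x) v \<bullet> b) *\<^sub>R frechet_derivative h (at (f x)) b"
  show ?case
  proof (rule Ck_on_SucI[OF _ _ \<open>open S\<close>])
    fix x assume x: "x \<in> S"
    then have fx: "f x \<in> T" using assms(3) by auto
    note df = Ck_on_has_derivative[OF Suc.prems(1) x]
    note dh = Ck_on_has_derivative[OF Suc.prems(2) fx]
    have "((h \<circ> f) has_derivative (frechet_derivative h (at (f x)) \<circ> frechet_derivative f (at x))) (at x)"
      by (rule diff_chain_at[OF df dh])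
    moreover have "frechet_derivative h (at (f x)) \<circ> frechet_derivative f (at x) = ?D x"
    proof
      fix v
      have lin: "linear (frechet_derivative h (at (f x)))"
        using dh by (rule has_derivative_linear)
      have "frechet_derivative h (at (f x)) (\<Sum>b\<in>Basis. (frechet_derivative f (at x) v \<bullet> b) *\<^sub>R b) = ?D x v"
        by (simp only: linear_sum[OF lin] linear_cmul[OF lin])
      then show "(frechet_derivative h (at (f x)) \<circ> frechet_derivative f (at x)) v = ?D x v"
        by (simp add: euclidean_representation)
    qed
    ultimately show "((\<lambda>x. h (f x)) has_derivative ?D x) (at x)"
      by (simp add: o_def)
  next
    fix v
    show "Ck_on k S (\<lambda>x. ?D x v)"
    proof (rule Ck_on_sum[OF _ \<open>open S\<close>])
      fix b :: 'f assume "b \<in> Basis"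
      have 1: "Ck_on k S (\<lambda>x. frechet_derivative f (at x) v \<bullet> b)"
        using Suc.prems by (intro Ck_on_bounded_linear[OF bounded_linear_inner_left] \<open>open S\<close>) auto
      have 2: "Ck_on k S (\<lambda>x. frechet_derivative h (at (f x)) b)"
        using Suc.IH[OF Ck_on_SucD[OF Suc.prems(1)], of "\<lambda>y. frechet_derivative h (at y) b"] Suc.prems(2)
        by simp
      show "Ck_on k S (\<lambda>x. (frechet_derivative f (at x) v \<bullet> b) *\<^sub>R frechet_derivative h (at (f x)) b)"
        by (rule Ck_on_bounded_bilinear[OF bounded_bilinear_scaleR 1 2 \<open>open S\<close>])
    qed
  qed
qed

text \<open>The derivative of \<open>1 / f\<close> contains \<open>1 / f\<close> again, but only its
  class \<open>C^k\<close> is required there.\<close>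

lemma Ck_on_inverse:
  fixes f :: "'e::euclidean_space \<Rightarrow> real"
  assumes "Ck_on k S f" "\<And>x. x \<in> S \<Longrightarrow> f x \<noteq> 0" "open S"
  shows "Ck_on k S (\<lambda>x. inverse (f x))"
  using assms(1)
proof (induction k)
  case 0
  then show ?case using assms(2) by (auto intro: continuous_on_inverse)
next
  case (Suc k)
  show ?case
  proof (rule Ck_on_SucI[OF _ _ \<open>open S\<close>])
    fix x assume x: "x \<in> S"
    show "((\<lambda>x. inverse (f x)) has_derivative
        (\<lambda>v. - (inverse (f x) * frechet_derivative f (at x) v * inverse (f x)))) (at x)"
      using Deriv.has_derivative_inverse[OF assms(2)[OF x] Ck_on_has_derivative[OF Suc.prems x]] .
  next
    fix v
    have "Ck_on k S (\<lambda>x. inverse (f x))" by (rule Suc.IH[OF Ck_on_SucD[OF Suc.prems]])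
    then show "Ck_on k S (\<lambda>x. - (inverse (f x) * frechet_derivative f (at x) v * inverse (f x)))"
      using Suc.prems
      by (intro Ck_on_bounded_linear[OF bounded_linear_minus[OF bounded_linear_ident]]
          Ck_on_bounded_bilinear[OF bounded_bilinear_mult] \<open>open S\<close>) auto
  qed
qed

section \<open>Smooth maps on open sets\<close>

lemma smooth_on_continuous: "smooth_on S f \<Longrightarrow> continuous_on S f"
  using Ck_on_continuous unfolding smooth_on_def by blast

lemma smooth_on_has_derivative:
  "smooth_on S f \<Longrightarrow> x \<in> S \<Longrightarrow> (f has_derivative frechet_derivative f (at x)) (at x)"
  using Ck_on_has_derivative unfolding smooth_on_def by blast

lemma smooth_on_differentiable: "smooth_on S f \<Longrightarrow> x \<in> S \<Longrightarrow> f differentiable (at x)"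
  using smooth_on_has_derivative by (metis differentiable_def)

lemma smooth_on_frechet_derivative:
  "smooth_on S f \<Longrightarrow> smooth_on S (\<lambda>x. frechet_derivative f (at x) v)"
  unfolding smooth_on_def by (metis Ck_on.simps(2))

lemma smooth_on_subset: "smooth_on S f \<Longrightarrow> T \<subseteq> S \<Longrightarrow> smooth_on T f"
  unfolding smooth_on_def using Ck_on_subset by blast

lemma smooth_on_cong:
  "smooth_on S f \<Longrightarrow> (\<And>x. x \<in> S \<Longrightarrow> f x = g x) \<Longrightarrow> open S \<Longrightarrow> smooth_on S g"
  unfolding smooth_on_def using Ck_on_cong by blast

lemma smooth_on_const [simp]: "smooth_on S (\<lambda>x. c)"
  by (simp add: smooth_on_def)

lemma smooth_on_ident: "open S \<Longrightarrow> smooth_on S (\<lambda>x. x)"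
  by (simp add: smooth_on_def Ck_on_id)

lemma smooth_on_bounded_linear:
  "bounded_linear L \<Longrightarrow> smooth_on S f \<Longrightarrow> open S \<Longrightarrow> smooth_on S (\<lambda>x. L (f x))"
  by (simp add: smooth_on_def Ck_on_bounded_linear)

lemma smooth_on_add:
  "smooth_on S f \<Longrightarrow> smooth_on S g \<Longrightarrow> open S \<Longrightarrow> smooth_on S (\<lambda>x. f x + g x)"
  by (simp add: smooth_on_def Ck_on_add)

lemma smooth_on_uminus: "smooth_on S f \<Longrightarrow> open S \<Longrightarrow> smooth_on S (\<lambda>x. - f x)"
  by (rule smooth_on_bounded_linear[OF bounded_linear_minus[OF bounded_linear_ident]])

lemma smooth_on_diff:
  "smooth_on S f \<Longrightarrow> smooth_on S g \<Longrightarrow> open S \<Longrightarrow> smooth_on S (\<lambda>x. f x - g x)"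
  using smooth_on_add[of S f "\<lambda>x. - g x"] smooth_on_uminus[of S g] by simp

lemma smooth_on_scaleR:
  "smooth_on S f \<Longrightarrow> smooth_on S g \<Longrightarrow> open S \<Longrightarrow> smooth_on S (\<lambda>x. f x *\<^sub>R g x)"
  by (simp add: smooth_on_def Ck_on_bounded_bilinear[OF bounded_bilinear_scaleR])

lemma smooth_on_mult:
  fixes f g :: "'e::euclidean_space \<Rightarrow> real"
  shows "smooth_on S f \<Longrightarrow> smooth_on S g \<Longrightarrow> open S \<Longrightarrow> smooth_on S (\<lambda>x. f x * g x)"
  by (simp add: smooth_on_def Ck_on_bounded_bilinear[OF bounded_bilinear_mult])

lemma smooth_on_divide:
  fixes f g :: "'e::euclidean_space \<Rightarrow> real"
  shows "smooth_on S f \<Longrightarrow> smooth_on S g \<Longrightarrow> (\<And>x. x \<in> S \<Longrightarrow> g x \<noteq> 0) \<Longrightarrow> open S \<Longrightarrow>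
    smooth_on S (\<lambda>x. f x / g x)"
  unfolding divide_inverse
  by (intro smooth_on_mult) (auto simp: smooth_on_def Ck_on_inverse)

lemma smooth_on_sum:
  "(\<And>i. i \<in> I \<Longrightarrow> smooth_on S (f i)) \<Longrightarrow> open S \<Longrightarrow> smooth_on S (\<lambda>x. \<Sum>i\<in>I. f i x)"
  by (simp add: smooth_on_def Ck_on_sum)

lemma smooth_on_prod:
  fixes f :: "'i \<Rightarrow> 'e::euclidean_space \<Rightarrow> real"
  assumes "\<And>i. i \<in> I \<Longrightarrow> smooth_on S (f i)" "open S"
  shows "smooth_on S (\<lambda>x. \<Prod>i\<in>I. f i x)"
  using assms(1)
  by (induction I rule: infinite_finite_induct) (auto intro: smooth_on_mult \<open>open S\<close>)

lemma smooth_on_compose: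
  fixes f :: "'e::euclidean_space \<Rightarrow> 'f::euclidean_space"
    and h :: "'f \<Rightarrow> 'g::real_normed_vector"
  shows "smooth_on S f \<Longrightarrow> smooth_on T h \<Longrightarrow> f ` S \<subseteq> T \<Longrightarrow> open S \<Longrightarrow> open T \<Longrightarrow>
    smooth_on S (\<lambda>x. h (f x))"
  unfolding smooth_on_def using Ck_on_compose by blast

lemma smooth_on_vec_nth:
  fixes f :: "'e::euclidean_space \<Rightarrow> 'f::euclidean_space^'n"
  shows "smooth_on S f \<Longrightarrow> open S \<Longrightarrow> smooth_on S (\<lambda>x. f x $ i)"
  by (rule smooth_on_bounded_linear[OF bounded_linear_vec_nth])

text \<open>Smoothness can be checked near each point. For curves this matters because every time
  may need a chart of its own.\<close>

lemma smooth_on_local: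
  assumes "\<And>x. x \<in> S \<Longrightarrow> \<exists>T. open T \<and> x \<in> T \<and> smooth_on T f"
  shows "smooth_on S f"
proof -
  have "Ck_on k S f" if "\<And>x. x \<in> S \<Longrightarrow> \<exists>T. open T \<and> x \<in> T \<and> Ck_on k T f" for k f
    using that
  proof (induction k arbitrary: f)
    case 0
    then show ?case
      by (metis Ck_on.simps(1) continuous_at_imp_continuous_on continuous_on_eq_continuous_at)
  next
    case (Suc k)
    have "Ck_on k S (\<lambda>x. frechet_derivative f (at x) v)" for v
      by (rule Suc.IH) (use Suc.prems in \<open>fastforce\<close>)
    moreover have "f differentiable (at x)" if "x \<in> S" for x
      using Suc.prems[OF that] by auto
    ultimately show ?case by simp
  qed
  then show ?thesis using assms unfolding smooth_on_def by meson
qed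

section \<open>Coordinate expressions of Weyl invariants\<close>

lemma smooth_on_partial: "smooth_on S f \<Longrightarrow> smooth_on S (partial i f)"
  using smooth_on_frechet_derivative[of S f "axis i 1"] by (simp add: partial_def[abs_def])

lemma partial_scale:
  assumes "smooth_on S f" "\<And>y. y \<in> S \<Longrightarrow> h y = s * f y" "open S" "x \<in> S"
  shows "partial i h x = s * partial i f x"
proof -
  have "((\<lambda>y. s * f y) has_derivative (\<lambda>v. s * frechet_derivative f (at x) v)) (at x)"
    using has_derivative_mult_right[OF smooth_on_has_derivative[OF assms(1,4)]] .
  then have "(h has_derivative (\<lambda>v. s * frechet_derivative f (at x) v)) (at x)"
    by (rule has_derivative_transform_within_open[OF _ assms(3,4)]) (simp add: assms(2))
  from frechet_derivative_at[OF this] show ?thesis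
    unfolding partial_def by (metis (mono_tags))
qed

section \<open>Entries of the inverse matrix\<close>

lemma smooth_on_det:
  fixes A :: "'e::euclidean_space \<Rightarrow> real^'n^'n"
  assumes "\<And>i j. smooth_on S (\<lambda>x. A x $ i $ j)" "open S"
  shows "smooth_on S (\<lambda>x. det (A x))"
  unfolding det_def by (intro smooth_on_sum smooth_on_mult smooth_on_prod assms smooth_on_const)

lemma matrix_inv:
  fixes A :: "'b::semiring_1^'n^'m"
  assumes "invertible A"
  shows matrix_inv_right: "A ** matrix_inv A = mat 1"
    and matrix_inv_left: "matrix_inv A ** A = mat 1"
  using someI_ex[OF assms[unfolded invertible_def]] by (simp_all add: matrix_inv_def)

text \<open>Cramer's rule for the \<open>l\<close>-th column of the inverse. A quotient of
  determinants is visibly smooth in the entries of \<open>A\<close>.\<close>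

lemma matrix_inv_component:
  fixes A :: "real^'n^'n"
  assumes "invertible A"
  shows "matrix_inv A $ k $ l = det (\<chi> i j. if j = k then axis l 1 $ i else A $ i $ j) / det A"
proof -
  have "A *v (matrix_inv A *v axis l 1) = axis l 1"
    by (simp add: matrix_vector_mul_assoc matrix_inv_right[OF assms])
  moreover have "det A \<noteq> 0" using assms by (simp add: invertible_det_nz)
  ultimately have "matrix_inv A *v axis l 1 =
      (\<chi> k. det (\<chi> i j. if j = k then axis l 1 $ i else A $ i $ j) / det A)"
    using cramer by blast
  then have "(matrix_inv A *v axis l 1) $ k = det (\<chi> i j. if j = k then axis l 1 $ i else A $ i $ j) / det A"
    by simp
  then show ?thesis by (simp add: matrix_vector_mult_basis column_def)
qed

lemma matrix_inv_scaleR_component: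
  fixes A :: "real^'n^'n"
  assumes "invertible A" "s \<noteq> 0"
  shows "matrix_inv (s *\<^sub>R A) $ k $ l = matrix_inv A $ k $ l / s"
proof -
  define B C where "B = s *\<^sub>R A" and "C = inverse s *\<^sub>R matrix_inv A"
  have BC: "B ** C = mat 1"
    unfolding B_def C_def matrix_scalar_ac scalar_matrix_assoc[symmetric] matrix_inv_right[OF assms(1)]
    using assms(2) by simp
  have CB: "C ** B = mat 1"
    unfolding B_def C_def matrix_scalar_ac scalar_matrix_assoc[symmetric] matrix_inv_left[OF assms(1)]
    using assms(2) by simp
  have "invertible B" using BC CB by (auto simp: invertible_def)
  then have "matrix_inv B = C"
    by (metis BC matrix_inv_left matrix_mul_assoc matrix_mul_lid matrix_mul_rid)
  then show ?thesis by (simp add: B_def C_def divide_inverse)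
qed

text \<open>To be interpreted with \<open>S\<close> the image of a chart, so that the formulas for
  Weyl invariants are studied on an open subset of \<open>real^'n\<close>.\<close>

locale metric_coordinates =
  fixes S :: "(real^'n::finite) set" and G :: "real^'n \<Rightarrow> real^'n^'n"
  assumes open_S: "open S" and smooth_G: "smooth_on S G"
    and invertible_G: "\<And>x. x \<in> S \<Longrightarrow> invertible (G x)"
begin

lemma smooth_G_component: "smooth_on S (\<lambda>x. G x $ i $ j)"
  by (intro smooth_on_vec_nth smooth_G open_S)

lemma smooth_matrix_inv: "smooth_on S (\<lambda>x. matrix_inv (G x) $ k $ l)"
proof (rule smooth_on_cong[OF _ _ open_S])
  show "smooth_on S (\<lambda>x. det (\<chi> i j. if j = k then axis l 1 $ i else G x $ i $ j) / det (G x))"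
  proof (intro smooth_on_divide smooth_on_det open_S)
    show "smooth_on S (\<lambda>x. (\<chi> i j. if j = k then axis l 1 $ i else G x $ i $ j) $ i $ j)" for i j
      by (cases "j = k") (simp_all add: smooth_G_component)
    show "det (G x) \<noteq> 0" if "x \<in> S" for x
      using invertible_G[OF that] by (simp add: invertible_det_nz)
  qed (rule smooth_G_component)
qed (simp add: matrix_inv_component[OF invertible_G])

lemmas smooth_intros = smooth_on_sum smooth_on_add smooth_on_diff smooth_on_mult smooth_on_const
  smooth_on_prod smooth_on_partial open_S smooth_matrix_inv smooth_G_component

lemma smooth_christoffel: "smooth_on S (christoffel G k i j)"
  unfolding christoffel_def[abs_def] by (intro smooth_intros)

lemma smooth_curvature: "smooth_on S (curvature G is)"
proof -
  show ?thesis
  proof (cases "\<exists>i j k l. is = [i, j, k, l]")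
    case True
    then show ?thesis
      by (auto simp: curvature_def[abs_def] intro!: smooth_intros smooth_christoffel)
  next
    case False
    then have "curvature G is = (\<lambda>x. 0)"
      by (auto simp: fun_eq_iff curvature_def split: list.split)
    then show ?thesis by simp
  qed
qed

lemma smooth_cov_deriv:
  assumes "\<And>js. smooth_on S (A js)"
  shows "smooth_on S (cov_deriv G A is)"
  by (cases "is"; simp add: cov_deriv_def[abs_def]) (intro smooth_intros smooth_christoffel assms)

lemma smooth_nabla_curvature: "smooth_on S (nabla_curvature G k is)"
  unfolding nabla_curvature_def
  by (induction k arbitrary: "is") (simp_all add: smooth_curvature smooth_cov_deriv)

lemma smooth_curvature_product: "smooth_on S (curvature_product G ks is)"
proof (induction ks arbitrary: "is")
  case Nil
  have "curvature_product G [] is = (\<lambda>x. 1)" by auto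
  then show ?case by simp
next
  case (Cons k ks)
  have "curvature_product G (k # ks) is =
      (\<lambda>x. nabla_curvature G k (take (k + 4) is) x * curvature_product G ks (drop (k + 4) is) x)"
    by auto
  then show ?case using Cons by (simp add: smooth_on_mult smooth_nabla_curvature open_S)
qed

lemma smooth_full_contraction: "smooth_on S (full_contraction G ks \<sigma>)"
  unfolding full_contraction_def[abs_def] by (intro smooth_intros smooth_curvature_product)

lemma smooth_eval_weyl: "smooth_on S (eval_weyl G W)"
proof (induction W)
  case Nil
  have "eval_weyl G [] = (\<lambda>x. 0)" by (auto simp: eval_weyl_def)
  then show ?case by simp
next
  case (Cons w W)
  obtain a ks \<sigma> where w: "w = (a, ks, \<sigma>)" by (cases w)
  have "eval_weyl G (w # W) = (\<lambda>x. a * full_contraction G ks \<sigma> x + eval_weyl G W x)"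
    by (auto simp: eval_weyl_def w)
  then show ?case using Cons by (simp add: smooth_on_add smooth_on_mult smooth_full_contraction open_S)
qed

end

text \<open>\<open>s\<close> will be the square of a homothety factor. Since \<open>S\<close> is
  open, agreement on \<open>S\<close> determines all derivatives at its points.\<close>

locale scaled_metric_coordinates = metric_coordinates S G
  for S :: "(real^'n::finite) set" and G +
  fixes G' :: "real^'n \<Rightarrow> real^'n^'n" and s :: real
  assumes s: "s \<noteq> 0" and G': "\<And>x. x \<in> S \<Longrightarrow> G' x = s *\<^sub>R G x"
begin

text \<open>The derivatives of the metric contribute \<open>s\<close>, the inverse metric
  \<open>1 / s\<close>.\<close>

lemma scale_christoffel:
  assumes "x \<in> S"
  shows "christoffel G' k i j x = christoffel G k i j x"
proof -
  have "partial i (\<lambda>y. G' y $ j $ l) x = s * partial i (\<lambda>y. G y $ j $ l) x" for i j l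
    by (rule partial_scale[OF smooth_G_component _ open_S assms]) (simp add: G')
  then show ?thesis
    unfolding christoffel_def
    by (simp add: G'[OF assms] matrix_inv_scaleR_component[OF invertible_G[OF assms] s] s
      flip: right_diff_distrib distrib_left)
qed

text \<open>With one index up, the curvature depends on the Christoffel symbols alone and is
  unchanged; lowering that index brings in \<open>s\<close>.\<close>

lemma scale_curvature:
  assumes "x \<in> S"
  shows "curvature G' is x = s * curvature G is x"
proof -
  have *: "partial i (christoffel G' m j k) x = partial i (christoffel G m j k) x" for i j k m
    using partial_scale[OF smooth_christoffel[of m j k], of "christoffel G' m j k" 1 x i]
    by (simp add: scale_christoffel open_S assms)
  have 4: "curvature G' [i, j, k, l] x = s * curvature G [i, j, k, l] x" for i j k l
    unfolding curvature_def
    by (simp only: list.case sum_distrib_left scale_christoffel[OF assms] G'[OF assms] *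
        vector_scaleR_component real_scaleR_def mult.assoc)
  show ?thesis
  proof (cases "\<exists>i j k l. is = [i, j, k, l]")
    case False
    then have "curvature G is x = 0" "curvature G' is x = 0"
      by (auto simp: curvature_def split: list.split)
    then show ?thesis by simp
  qed (use 4 in auto)
qed

text \<open>Both metrics have the same connection, and constants pass through covariant
  differentiation.\<close>

lemma scale_cov_deriv:
  assumes "x \<in> S" "\<And>js. smooth_on S (A js)" "\<And>js y. y \<in> S \<Longrightarrow> A' js y = s * A js y"
  shows "cov_deriv G' A' is x = s * cov_deriv G A is x"
proof (cases "is")
  case (Cons i js)
  have "partial i (A' js) x = s * partial i (A js) x"
    by (rule partial_scale[OF assms(2,3) open_S assms(1)])
  then show ?thesis
    by (simp add: cov_deriv_def scale_christoffel[OF assms(1)] assms(3)[OF assms(1)] Cons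
        sum_distrib_left right_diff_distrib mult.left_commute)
qed (simp add: cov_deriv_def)

lemma scale_nabla_curvature:
  "x \<in> S \<Longrightarrow> nabla_curvature G' k is x = s * nabla_curvature G k is x"
proof (induction k arbitrary: "is" x)
  case 0
  then show ?case by (simp add: nabla_curvature_def scale_curvature)
next
  case (Suc k)
  have "cov_deriv G' (nabla_curvature G' k) is x = s * cov_deriv G (nabla_curvature G k) is x"
    by (rule scale_cov_deriv[OF Suc.prems smooth_nabla_curvature Suc.IH])
  then show ?case by (simp add: nabla_curvature_def)
qed

lemma scale_curvature_product:
  "x \<in> S \<Longrightarrow> curvature_product G' ks is x = s ^ length ks * curvature_product G ks is x"
  by (induction ks arbitrary: "is") (simp_all add: scale_nabla_curvature)

text \<open>Each curvature factor contributes \<open>s\<close> and each contracted pair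
  \<open>1 / s\<close>.\<close>

lemma scale_full_contraction:
  assumes "x \<in> S"
  shows "full_contraction G' ks \<sigma> x =
    s ^ length ks / s ^ (total_rank ks div 2) * full_contraction G ks \<sigma> x"
  unfolding full_contraction_def
  by (simp add: G'[OF assms] matrix_inv_scaleR_component[OF invertible_G[OF assms] s]
      scale_curvature_product[OF assms] sum_distrib_left prod_dividef mult_ac)

end

text \<open>Each factor has rank \<open>k + 4\<close> but counts \<open>k + 2\<close> derivatives of
  the metric. The surplus of two indices, i.e. one contracted pair, cancels the scaling of that
  factor.\<close>

lemma total_rank_eq: "total_rank ks = (\<Sum>k\<leftarrow>ks. k + 2) + 2 * length ks"
  by (induction ks) (auto simp: total_rank_def)

text \<open>By \<open>total_rank_eq\<close> the number of contracted pairs exceeds the number of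
  curvature factors by \<open>l / 2\<close>, so every term is divided by the power
  \<open>l / 2\<close> of \<open>r\<^sup>2\<close>. All terms have the same order, hence so does the
  sum.\<close>

lemma (in metric_coordinates) eval_weyl_homothety:
  assumes "weyl_expression_of_order l W" "r > 0"
    and "\<And>x. x \<in> S \<Longrightarrow> G' x = r\<^sup>2 *\<^sub>R G x" "x \<in> S"
  shows "eval_weyl G' W x = eval_weyl G W x / r ^ l"
proof -
  interpret scaled_metric_coordinates S G G' "r\<^sup>2"
    by unfold_locales (use assms in auto)
  have *: "full_contraction G' ks \<sigma> x = full_contraction G ks \<sigma> x / r ^ l"
    if "(a, ks, \<sigma>) \<in> set W" for a ks \<sigma>
  proof -
    have l: "(\<Sum>k\<leftarrow>ks. k + 2) = l" and "even (total_rank ks)"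
      using assms(1) that by (auto simp: weyl_expression_of_order_def)
    then have "2 * (total_rank ks div 2) = l + 2 * length ks"
      using total_rank_eq[of ks] by simp
    then have "(r\<^sup>2) ^ (total_rank ks div 2) = r ^ l * (r\<^sup>2) ^ length ks"
      by (simp add: power_mult[symmetric] power_add)
    then show ?thesis
      using scale_full_contraction[OF assms(4), of ks \<sigma>] assms(2) by simp
  qed
  \<comment> \<open>The inclusion in \<open>set W\<close> keeps the scaling of the single terms
    available while the induction runs over shorter lists.\<close>
  have "(\<Sum>(a, ks, \<sigma>)\<leftarrow>W'. a * full_contraction G' ks \<sigma> x)
      = (\<Sum>(a, ks, \<sigma>)\<leftarrow>W'. a * full_contraction G ks \<sigma> x) / r ^ l"
    if "set W' \<subseteq> set W" for W'
    using that
  proof (induction W')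
    case (Cons w W')
    then show ?case using * by (cases w) (auto simp: add_divide_distrib)
  qed simp
  then show ?thesis by (simp add: eval_weyl_def)
qed

text \<open>Every factor involves at least two derivatives, so order \<open>0\<close> leaves only
  the empty expression. A positive order is needed because \<open>weyl_mu\<close> takes an
  \<open>l\<close>-th root.\<close>

lemma weyl_expression_of_order_pos:
  assumes "weyl_expression_of_order l W" "eval_weyl G W x \<noteq> 0"
  shows "l > 0"
proof (rule ccontr)
  assume "\<not> l > 0"
  have "W = []"
  proof (rule ccontr)
    assume "W \<noteq> []"
    then obtain a ks \<sigma> where "(a, ks, \<sigma>) \<in> set W" by (cases W) auto
    then have "ks \<noteq> []" "(\<Sum>k\<leftarrow>ks. k + 2) = l"
      using assms(1) by (auto simp: weyl_expression_of_order_def)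
    then show False using \<open>\<not> l > 0\<close> by (cases ks) auto
  qed
  then show False using assms(2) by (simp add: eval_weyl_def)
qed

section \<open>Charts of a smooth manifold\<close>

text \<open>Rephrases the homeomorphism through open sets of \<open>X\<close> and of the model
  space, so that no subspace topologies appear when new charts are verified.\<close>

lemma is_chart_iff:
  "is_chart X (U, \<phi>) \<longleftrightarrow> openin X U \<and> inj_on \<phi> U \<and>
     (\<forall>V. open V \<longrightarrow> openin X {P\<in>U. \<phi> P \<in> V}) \<and> (\<forall>W. openin X W \<longrightarrow> W \<subseteq> U \<longrightarrow> open (\<phi> ` W))"
  (is "?L \<longleftrightarrow> ?R")
proof
  assume ?L
  then have U: "openin X U" and op: "open (\<phi> ` U)"
    and hom: "homeomorphic_map (subtopology X U) (top_of_set (\<phi> ` U)) \<phi>"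
    by (auto simp: is_chart_def)
  have ts: "topspace (subtopology X U) = U"
    using openin_subset[OF U] by auto
  have "openin X {P\<in>U. \<phi> P \<in> V}" if "open V" for V
  proof -
    have "openin (top_of_set (\<phi> ` U)) (\<phi> ` U \<inter> V)" using that by auto
    then have "openin (subtopology X U) {P\<in>U. \<phi> P \<in> \<phi> ` U \<inter> V}"
      using homeomorphic_imp_continuous_map[OF hom] ts
      unfolding continuous_map_def by metis
    moreover have "{P\<in>U. \<phi> P \<in> \<phi> ` U \<inter> V} = {P\<in>U. \<phi> P \<in> V}" by auto
    ultimately show ?thesis by (simp add: openin_open_subtopology[OF U])
  qed
  moreover have "open (\<phi> ` W)" if "openin X W" "W \<subseteq> U" for W
  proof -
    have "openin (subtopology X U) W" using that by (simp add: openin_open_subtopology[OF U])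
    then have "openin (top_of_set (\<phi> ` U)) (\<phi> ` W)"
      using homeomorphic_imp_open_map[OF hom] by (simp add: open_map_def)
    then show ?thesis using op by (simp add: openin_open_eq)
  qed
  moreover have "inj_on \<phi> U"
    using homeomorphic_imp_injective_map[OF hom] ts by simp
  ultimately show ?R using U by blast
next
  assume R: ?R
  then have U: "openin X U" and op: "open (\<phi> ` U)" by auto
  have ts: "topspace (subtopology X U) = U"
    using openin_subset[OF U] by auto
  have "homeomorphic_map (subtopology X U) (top_of_set (\<phi> ` U)) \<phi>"
  proof (rule bijective_open_imp_homeomorphic_map)
    have "openin (subtopology X U) {x\<in>U. \<phi> x \<in> V}" if "openin (top_of_set (\<phi> ` U)) V" for V
      using that op R by (auto simp: openin_open_eq openin_open_subtopology[OF U])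
    then show "continuous_map (subtopology X U) (top_of_set (\<phi> ` U)) \<phi>"
      unfolding continuous_map_def using ts by auto
    show "open_map (subtopology X U) (top_of_set (\<phi> ` U)) \<phi>"
      using R op by (auto simp: open_map_def openin_open_eq openin_open_subtopology[OF U])
  qed (use R ts in auto)
  then show ?L using U op by (simp add: is_chart_def)
qed

abbreviation chart_inv :: "('a, 'e) chart \<Rightarrow> 'e \<Rightarrow> 'a" where
  "chart_inv c \<equiv> inv_into (fst c) (snd c)"

locale smooth_mfd =
  fixes X :: "'a topology" and \<A> :: "('a, 'e::euclidean_space) chart set"
  assumes mfd: "smooth_manifold X \<A>"
begin

lemma chart: "c \<in> \<A> \<Longrightarrow> is_chart X (fst c, snd c)"
  using mfd by (simp add: smooth_manifold_def)

lemma chart_openin: "c \<in> \<A> \<Longrightarrow> openin X (fst c)"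
  and chart_inj: "c \<in> \<A> \<Longrightarrow> inj_on (snd c) (fst c)"
  and chart_vimage: "c \<in> \<A> \<Longrightarrow> open V \<Longrightarrow> openin X {P\<in>fst c. snd c P \<in> V}"
  and chart_image: "c \<in> \<A> \<Longrightarrow> openin X W \<Longrightarrow> W \<subseteq> fst c \<Longrightarrow> open (snd c ` W)"
  using chart[of c] unfolding is_chart_iff by blast+

lemma chart_open: "c \<in> \<A> \<Longrightarrow> open (snd c ` fst c)"
  using chart_image chart_openin by blast

lemma chart_subset: "c \<in> \<A> \<Longrightarrow> P \<in> fst c \<Longrightarrow> P \<in> topspace X"
  using chart_openin openin_subset by blast

lemma chart_at:
  assumes "P \<in> topspace X"
  obtains c where "c \<in> \<A>" "P \<in> fst c"
  using mfd assms unfolding smooth_manifold_def by blast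

lemma chart_inv_left [simp]: "c \<in> \<A> \<Longrightarrow> P \<in> fst c \<Longrightarrow> chart_inv c (snd c P) = P"
  using chart_inj by (simp add: inv_into_f_f)

lemma compatible:
  "c \<in> \<A> \<Longrightarrow> d \<in> \<A> \<Longrightarrow> smooth_on (snd c ` (fst c \<inter> fst d)) (snd d \<circ> chart_inv c)"
  using mfd unfolding smooth_manifold_def smoothly_compatible_def
  by (smt (verit) case_prod_unfold fst_conv snd_conv)

text \<open>This is where maximality of the atlas enters.\<close>

lemma new_chart:
  assumes "is_chart X (U, \<phi>)"
    and "\<And>d. d \<in> \<A> \<Longrightarrow> smooth_on (\<phi> ` (U \<inter> fst d)) (snd d \<circ> inv_into U \<phi>)"
    and "\<And>d. d \<in> \<A> \<Longrightarrow> smooth_on (snd d ` (U \<inter> fst d)) (\<phi> \<circ> chart_inv d)"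
  shows "(U, \<phi>) \<in> \<A>"
proof -
  have "smoothly_compatible (U, \<phi>) d" if "d \<in> \<A>" for d
    using assms(2,3)[OF that] by (auto simp: smoothly_compatible_def split: prod.split)
  then show ?thesis using mfd assms(1) unfolding smooth_manifold_def by blast
qed

text \<open>The transition maps between the transported chart and a chart \<open>d\<close> are
  coordinate expressions of \<open>\<Phi>\<close> and of its inverse, both smooth for a
  diffeomorphism.\<close>

lemma push_chart:
  assumes "diffeomorphism X \<A> \<Phi>" "c \<in> \<A>"
  shows "(\<Phi> ` fst c, snd c \<circ> inv_into (topspace X) \<Phi>) \<in> \<A>"
proof (rule new_chart)
  let ?M = "topspace X" and ?U = "fst c" and ?\<phi> = "snd c"
  let ?\<Psi> = "inv_into ?M \<Phi>"
  have bij: "bij_betw \<Phi> ?M ?M" and contF: "continuous_map X X \<Phi>" and contG: "continuous_map X X ?\<Psi>"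
    and smF: "\<And>c d. c \<in> \<A> \<Longrightarrow> d \<in> \<A> \<Longrightarrow>
      smooth_on (snd c ` {P\<in>fst c. \<Phi> P \<in> fst d}) (snd d \<circ> \<Phi> \<circ> chart_inv c)"
    and smG: "\<And>c d. c \<in> \<A> \<Longrightarrow> d \<in> \<A> \<Longrightarrow>
      smooth_on (snd c ` {P\<in>fst c. ?\<Psi> P \<in> fst d}) (snd d \<circ> ?\<Psi> \<circ> chart_inv c)"
    using assms(1) by (auto simp: diffeomorphism_def Bij_def smooth_map_def split: prod.splits)
  have UM: "?U \<subseteq> ?M" using chart_subset assms(2) by blast
  have GF: "?\<Psi> (\<Phi> P) = P" if "P \<in> ?M" for P
    using bij that by (simp add: bij_betw_def)
  have FG: "\<Phi> (?\<Psi> P) = P" if "P \<in> ?M" for P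
    using bij that by (simp add: bij_betw_def f_inv_into_f)
  have Fin: "\<Phi> P \<in> ?M" if "P \<in> ?M" for P using bij that bij_betwE by blast
  have Gin: "?\<Psi> P \<in> ?M" if "P \<in> ?M" for P using bij that by (metis bij_betw_imp_surj_on inv_into_into)
  have inj: "inj_on (?\<phi> \<circ> ?\<Psi>) (\<Phi> ` ?U)"
    using chart_inj[OF assms(2)] GF UM by (auto simp: inj_on_def subset_iff)
  have openF: "openin X (\<Phi> ` W)" if "openin X W" for W
  proof -
    have WM: "W \<subseteq> ?M" using that openin_subset by blast
    have "\<Phi> ` W = {P\<in>?M. ?\<Psi> P \<in> W}"
      using WM GF FG Fin by (auto simp: subset_iff image_iff) (metis FG)
    then show ?thesis using contG that by (simp add: continuous_map_def)
  qed
  show "is_chart X (\<Phi> ` ?U, ?\<phi> \<circ> ?\<Psi>)"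
    unfolding is_chart_iff
  proof (intro conjI allI impI inj openF chart_openin assms(2))
    fix V :: "'e set" assume "open V"
    have "{P \<in> \<Phi> ` ?U. (?\<phi> \<circ> ?\<Psi>) P \<in> V} = \<Phi> ` {P\<in>?U. ?\<phi> P \<in> V}"
      using UM GF by (auto simp: subset_iff)
    then show "openin X {P \<in> \<Phi> ` ?U. (?\<phi> \<circ> ?\<Psi>) P \<in> V}"
      using openF chart_vimage[OF assms(2) \<open>open V\<close>] by simp
  next
    fix W assume W: "openin X W" "W \<subseteq> \<Phi> ` ?U"
    have "(?\<phi> \<circ> ?\<Psi>) ` W = ?\<phi> ` {P\<in>?M. \<Phi> P \<in> W}"
      using W UM GF FG Gin openin_subset[OF W(1)]
      by (auto simp: subset_iff image_iff) (metis FG Gin)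
    moreover have "openin X {P\<in>?M. \<Phi> P \<in> W}"
      using contF W by (simp add: continuous_map_def)
    moreover have "{P\<in>?M. \<Phi> P \<in> W} \<subseteq> ?U"
    proof
      fix P assume "P \<in> {P\<in>?M. \<Phi> P \<in> W}"
      then obtain Q where "P \<in> ?M" "Q \<in> ?U" "\<Phi> P = \<Phi> Q" using W(2) by auto
      then show "P \<in> ?U" using GF UM by (metis subsetD)
    qed
    ultimately show "open ((?\<phi> \<circ> ?\<Psi>) ` W)"
      using chart_image[OF assms(2)] by simp
  qed
  \<comment> \<open>The inverse of the transported chart is the inverse of \<open>c\<close> followed
    by \<open>\<Phi>\<close>, which identifies one of the two transition maps.\<close>
  have inv: "inv_into (\<Phi> ` ?U) (?\<phi> \<circ> ?\<Psi>) x = \<Phi> (chart_inv c x)" if "x \<in> ?\<phi> ` ?U" for x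
  proof -
    obtain P where P: "P \<in> ?U" "x = ?\<phi> P" using \<open>x \<in> ?\<phi> ` ?U\<close> by auto
    then have "(?\<phi> \<circ> ?\<Psi>) (\<Phi> P) = x" using GF UM by auto
    then have "inv_into (\<Phi> ` ?U) (?\<phi> \<circ> ?\<Psi>) x = \<Phi> P"
      using inv_into_f_f[OF inj, of "\<Phi> P"] P by auto
    then show ?thesis using P assms(2) by simp
  qed
  fix d assume d: "d \<in> \<A>"
  have op: "openin X {P\<in>?U. \<Phi> P \<in> fst d}"
  proof -
    have "{P\<in>?U. \<Phi> P \<in> fst d} = ?U \<inter> {P\<in>?M. \<Phi> P \<in> fst d}" using UM by auto
    moreover have "openin X {P\<in>?M. \<Phi> P \<in> fst d}"
      using contF chart_openin[OF d] by (simp add: continuous_map_def)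
    ultimately show ?thesis using chart_openin[OF assms(2)] by (simp add: openin_Int)
  qed
  have eq: "(?\<phi> \<circ> ?\<Psi>) ` (\<Phi> ` ?U \<inter> fst d) = ?\<phi> ` {P\<in>?U. \<Phi> P \<in> fst d}"
  proof -
    have "\<Phi> ` ?U \<inter> fst d = \<Phi> ` {P\<in>?U. \<Phi> P \<in> fst d}" by auto
    moreover have "(?\<phi> \<circ> ?\<Psi>) ` \<Phi> ` Z = ?\<phi> ` Z" if "Z \<subseteq> ?U" for Z
    proof -
      have "(?\<phi> \<circ> ?\<Psi>) (\<Phi> P) = ?\<phi> P" if "P \<in> Z" for P
        using GF that \<open>Z \<subseteq> ?U\<close> UM by auto
      then show ?thesis unfolding image_image by (rule image_cong[OF refl])
    qed
    ultimately show ?thesis by simp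
  qed
  have "smooth_on (?\<phi> ` {P\<in>?U. \<Phi> P \<in> fst d}) (snd d \<circ> inv_into (\<Phi> ` ?U) (?\<phi> \<circ> ?\<Psi>))"
  proof (rule smooth_on_cong[OF smF[OF assms(2) d]])
    show "open (?\<phi> ` {P\<in>?U. \<Phi> P \<in> fst d})"
      by (rule chart_image[OF assms(2) op]) auto
  qed (use inv in auto)
  then show "smooth_on ((?\<phi> \<circ> ?\<Psi>) ` (\<Phi> ` ?U \<inter> fst d)) (snd d \<circ> inv_into (\<Phi> ` ?U) (?\<phi> \<circ> ?\<Psi>))"
    unfolding eq .
  have "\<Phi> ` ?U \<inter> fst d = {P\<in>fst d. ?\<Psi> P \<in> ?U}"
    using GF FG UM chart_subset[OF d] by (auto simp: subset_iff image_iff) (metis FG)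
  then show "smooth_on (snd d ` (\<Phi> ` ?U \<inter> fst d)) (?\<phi> \<circ> ?\<Psi> \<circ> chart_inv d)"
    using smG[OF d assms(2)] by simp
qed

text \<open>Charts may be followed by diffeomorphisms between open sets; together with
  \<open>straightening\<close> this yields slice charts.\<close>

lemma modify_chart:
  assumes "c \<in> \<A>" "W \<subseteq> snd c ` fst c" "open W" "open V" "homeomorphism W V \<theta> \<eta>"
    "smooth_on W \<theta>" "smooth_on V \<eta>"
  shows "({P\<in>fst c. snd c P \<in> W}, \<theta> \<circ> snd c) \<in> \<A>"
proof (rule new_chart)
  let ?U = "{P\<in>fst c. snd c P \<in> W}" and ?\<phi> = "snd c"
  have \<eta>: "\<eta> (\<theta> x) = x" "\<theta> x \<in> V" if "x \<in> W" for x
    using assms(5) that by (auto simp: homeomorphism_def)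
  have \<theta>: "\<theta> (\<eta> y) = y" "\<eta> y \<in> W" if "y \<in> V" for y
    using assms(5) that by (auto simp: homeomorphism_def)
  have cont: "continuous_on W \<theta>" "continuous_on V \<eta>"
    using assms(5) by (auto simp: homeomorphism_def)
  have inj: "inj_on (\<theta> \<circ> ?\<phi>) ?U"
    using chart_inj[OF assms(1)] \<eta> by (auto simp: inj_on_def) metis
  have U: "openin X ?U" by (rule chart_vimage[OF assms(1,3)])
  show "is_chart X (?U, \<theta> \<circ> ?\<phi>)"
    unfolding is_chart_iff
  proof (intro conjI allI impI inj U)
    fix Z :: "'e set" assume "open Z"
    then have "open (W \<inter> \<theta> -` Z)"
      using cont(1) assms(3) by (simp add: continuous_on_open_vimage Int_commute)
    moreover have "{P \<in> ?U. (\<theta> \<circ> ?\<phi>) P \<in> Z} = {P\<in>fst c. ?\<phi> P \<in> W \<inter> \<theta> -` Z}" by auto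
    ultimately show "openin X {P \<in> ?U. (\<theta> \<circ> ?\<phi>) P \<in> Z}"
      using chart_vimage[OF assms(1), of "W \<inter> \<theta> -` Z"] by simp
  next
    fix Z assume Z: "openin X Z" "Z \<subseteq> ?U"
    have "(\<theta> \<circ> ?\<phi>) ` Z = V \<inter> \<eta> -` (?\<phi> ` Z)"
    proof (intro subset_antisym subsetI)
      fix y assume "y \<in> V \<inter> \<eta> -` (?\<phi> ` Z)"
      then obtain P where "P \<in> Z" "\<eta> y = ?\<phi> P" "y \<in> V" by auto
      then show "y \<in> (\<theta> \<circ> ?\<phi>) ` Z" using \<theta>(1)[of y] by (intro image_eqI[of _ _ P]) auto
    qed (use Z(2) \<eta> in auto)
    moreover have "open (?\<phi> ` Z)" using Z by (intro chart_image[OF assms(1)]) auto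
    ultimately show "open ((\<theta> \<circ> ?\<phi>) ` Z)"
      using cont(2) assms(4) by (simp add: continuous_on_open_vimage Int_commute)
  qed
  have inv: "inv_into ?U (\<theta> \<circ> ?\<phi>) y = chart_inv c (\<eta> y)" if "y \<in> V" for y
  proof -
    obtain P where P: "P \<in> fst c" "?\<phi> P = \<eta> y"
      using \<theta>(2)[OF \<open>y \<in> V\<close>] assms(2) by (metis imageE subsetD)
    then have "inv_into ?U (\<theta> \<circ> ?\<phi>) ((\<theta> \<circ> ?\<phi>) P) = P"
      using \<theta>[OF that] by (intro inv_into_f_f[OF inj]) auto
    then have "inv_into ?U (\<theta> \<circ> ?\<phi>) y = P" using P \<theta>[OF that] by simp
    moreover have "chart_inv c (\<eta> y) = P" using P assms(1) by (simp flip: P(2))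
    ultimately show ?thesis by simp
  qed
  fix d assume d: "d \<in> \<A>"
  let ?Z = "?\<phi> ` (?U \<inter> fst d)" and ?Y = "(\<theta> \<circ> ?\<phi>) ` (?U \<inter> fst d)"
  have opZ: "open ?Z"
    using U chart_openin[OF d] by (intro chart_image[OF assms(1)]) auto
  have Y: "?Y = V \<inter> \<eta> -` ?Z"
  proof (intro subset_antisym subsetI)
    fix y assume "y \<in> V \<inter> \<eta> -` ?Z"
    then obtain P where "P \<in> ?U \<inter> fst d" "\<eta> y = ?\<phi> P" "y \<in> V" by auto
    then show "y \<in> ?Y" using \<theta>(1)[of y] by (intro image_eqI[of _ _ P]) auto
  qed (use \<eta> in auto)
  have opY: "open ?Y"
    unfolding Y using cont(2) assms(4) opZ by (simp add: continuous_on_open_vimage Int_commute)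
  show "smooth_on ?Y (snd d \<circ> inv_into ?U (\<theta> \<circ> ?\<phi>))"
  proof (rule smooth_on_cong)
    show "smooth_on ?Y (\<lambda>y. (snd d \<circ> chart_inv c) (\<eta> y))"
    proof (rule smooth_on_compose[where f = \<eta> and h = "snd d \<circ> chart_inv c", OF _ _ _ opY opZ])
      show "smooth_on ?Y \<eta>" by (rule smooth_on_subset[OF assms(7)]) (use Y in auto)
      show "smooth_on ?Z (snd d \<circ> chart_inv c)"
        by (rule smooth_on_subset[OF compatible[OF assms(1) d]]) auto
    qed (use Y in auto)
  qed (use inv Y opY in auto)
  have opD: "open (snd d ` (?U \<inter> fst d))"
    using U chart_openin[OF d] by (intro chart_image[OF d]) auto
  have "smooth_on (snd d ` (?U \<inter> fst d)) (\<lambda>x. \<theta> ((?\<phi> \<circ> chart_inv d) x))"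
  proof (rule smooth_on_compose[OF _ assms(6) _ opD assms(3)])
    show "smooth_on (snd d ` (?U \<inter> fst d)) (?\<phi> \<circ> chart_inv d)"
      by (rule smooth_on_subset[OF compatible[OF d assms(1)]]) auto
  qed (use d in auto)
  then show "smooth_on (snd d ` (?U \<inter> fst d)) (\<theta> \<circ> ?\<phi> \<circ> chart_inv d)"
    by (simp add: o_def)
qed

text \<open>Avoids charts on the target. Unlike in \<open>smooth_map\<close>, continuity is not
  demanded but derived.\<close>

definition smooth_fun :: "('a \<Rightarrow> real) \<Rightarrow> bool" where
  "smooth_fun f \<longleftrightarrow> (\<forall>c\<in>\<A>. smooth_on (snd c ` fst c) (f \<circ> chart_inv c))"

lemma smooth_fun_continuous:
  assumes "smooth_fun f"
  shows "continuous_map X euclideanreal f"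
  unfolding continuous_map_def
proof (intro conjI allI impI)
  fix V :: "real set" assume "openin euclidean V"
  then have V: "open V" by simp
  show "openin X {P \<in> topspace X. f P \<in> V}"
    unfolding openin_subopen[of X "{P \<in> topspace X. f P \<in> V}"]
  proof
    fix P assume "P \<in> {P \<in> topspace X. f P \<in> V}"
    then have P: "P \<in> topspace X" "f P \<in> V" by auto
    then obtain c where c: "c \<in> \<A>" "P \<in> fst c" using chart_at by blast
    let ?Z = "snd c ` fst c \<inter> (f \<circ> chart_inv c) -` V"
    have "smooth_on (snd c ` fst c) (f \<circ> chart_inv c)" using assms c by (simp add: smooth_fun_def)
    then have "open ?Z"
      using V continuous_on_open_vimage[OF chart_open[OF c(1)], of "f \<circ> chart_inv c"]
        smooth_on_continuous
      by (metis Int_commute)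
    then have "openin X {P\<in>fst c. snd c P \<in> ?Z}" by (rule chart_vimage[OF c(1)])
    moreover have "{P\<in>fst c. snd c P \<in> ?Z} = {P\<in>fst c. f P \<in> V}"
      using c(1) by (intro Collect_cong conj_cong refl) simp
    ultimately have "openin X {P\<in>fst c. f P \<in> V}" by simp
    then show "\<exists>T. openin X T \<and> P \<in> T \<and> T \<subseteq> {P \<in> topspace X. f P \<in> V}"
      using P c chart_subset[OF c(1)] by (intro exI[of _ "{P\<in>fst c. f P \<in> V}"]) auto
  qed
qed auto

end

section \<open>Regular level sets\<close>

text \<open>The coordinate change replaces the \<open>i\<close>-th coordinate by the value of \<open>F\<close>.\<close>

lemma straightening:
  fixes F :: "real^'n::finite \<Rightarrow> real"
  assumes "smooth_on S F" "open S" "x0 \<in> S" "frechet_derivative F (at x0) v \<noteq> 0"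
  obtains W V i and \<theta> \<eta> :: "real^'n \<Rightarrow> real^'n" where "open W" "W \<subseteq> S" "x0 \<in> W" "open V" "homeomorphism W V \<theta> \<eta>"
    "smooth_on W \<theta>" "smooth_on V \<eta>" "\<And>x. \<theta> x $ i = F x"
proof -
  define D where "D x = frechet_derivative F (at x)" for x
  have D: "(F has_derivative D x) (at x)" if "x \<in> S" for x
    unfolding D_def using smooth_on_has_derivative[OF assms(1) that] .
  have linD: "linear (D x)" if "x \<in> S" for x
    using D[OF that] has_derivative_linear by blast
  \<comment> \<open>\<open>v\<close> is a combination of the axes, so some partial derivative at
    \<open>x0\<close> is nonzero as well.\<close>
  obtain i where i: "D x0 (axis i 1) \<noteq> 0"
  proof (rule ccontr)
    assume "\<not> thesis"
    then have 0: "D x0 (axis i 1) = 0" for i using that by blast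
    have "D x0 v = D x0 (\<Sum>i\<in>UNIV. (v $ i) *\<^sub>R axis i 1)"
      using basis_expansion[of v] by (simp add: scalar_mult_eq_scaleR)
    also have "\<dots> = 0"
      using linD[OF assms(3)] 0 by (simp add: linear_sum linear_cmul)
    finally show False using assms(4) by (simp add: D_def)
  qed
  define e :: "real^'n" where "e = axis i 1"
  have ei [simp]: "e $ i = 1" by (simp add: e_def)
  have e_other: "e $ j = 0" if "j \<noteq> i" for j using that by (simp add: e_def axis_def)
  define \<theta> where "\<theta> x = x + (F x - x $ i) *\<^sub>R e" for x
  define \<theta>' where "\<theta>' x = (\<lambda>u. u + (D x u - u $ i) *\<^sub>R e)" for x
  have d\<theta>: "(\<theta> has_derivative \<theta>' x) (at x)" if "x \<in> S" for x
    unfolding \<theta>_def \<theta>'_def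
    by (intro has_derivative_add has_derivative_ident has_derivative_scaleR_left has_derivative_diff
        D[OF that] bounded_linear_imp_has_derivative bounded_linear_vec_nth)
  then have bl: "bounded_linear (\<theta>' x)" if "x \<in> S" for x
    using that has_derivative_bounded_linear by blast
  have smooth_D: "smooth_on S (\<lambda>x. D x u)" for u
    unfolding D_def by (rule smooth_on_frechet_derivative[OF assms(1)])
  have "continuous_on S (\<lambda>x. Blinfun (\<theta>' x))"
  proof (rule continuous_on_blinfun_componentwise)
    fix u :: "real^'n"
    have "continuous_on S (\<lambda>x. \<theta>' x u)"
      unfolding \<theta>'_def by (intro continuous_intros smooth_on_continuous[OF smooth_D])
    then show "continuous_on S (\<lambda>x. blinfun_apply (Blinfun (\<theta>' x)) u)"
      by (rule continuous_on_eq) (simp add: bounded_linear_Blinfun_apply bl)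
  qed
  moreover have "(\<theta> has_derivative blinfun_apply (Blinfun (\<theta>' x))) (at x)" if "x \<in> S" for x
    using d\<theta>[OF that] by (simp add: bounded_linear_Blinfun_apply bl that)
  moreover
  \<comment> \<open>The inverse of \<open>\<theta>' x\<close> wherever \<open>D x e\<close> is
    nonzero: the multiple of \<open>e\<close> is the one that makes \<open>D x (q x u)\<close> equal
    to \<open>u $ i\<close>.\<close>
  define q where "q x u = u + ((u $ i - D x u) / D x e) *\<^sub>R e" for x u
  have Dq: "D x (q x u) = u $ i" if "x \<in> S" "D x e \<noteq> 0" for x u
    using linD[OF that(1)] that(2) by (simp add: q_def linear_add linear_cmul)
  have qi: "q x u $ i = u $ i + (u $ i - D x u) / D x e" for x u
    by (simp add: q_def)
  have \<theta>'q: "\<theta>' x (q x u) = u" if "x \<in> S" "D x e \<noteq> 0" for x u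
    using Dq[OF that] unfolding \<theta>'_def qi by (simp add: q_def)
  have q\<theta>': "q x (\<theta>' x u) = u" if "x \<in> S" "D x e \<noteq> 0" for x u
  proof -
    have "D x (\<theta>' x u) = D x u + (D x u - u $ i) * D x e"
      using linD[OF that(1)] by (simp add: \<theta>'_def linear_add linear_cmul)
    moreover have "\<theta>' x u $ i = D x u" by (simp add: \<theta>'_def)
    ultimately have "(\<theta>' x u $ i - D x (\<theta>' x u)) / D x e = u $ i - D x u"
      using that(2) by (simp add: field_simps)
    then have "q x (\<theta>' x u) = \<theta>' x u + (u $ i - D x u) *\<^sub>R e"
      by (simp only: q_def)
    then show ?thesis by (simp add: \<theta>'_def algebra_simps)
  qed
  have blq: "bounded_linear (q x0)"
  proof -
    have "bounded_linear (D x0)" using D[OF assms(3)] has_derivative_bounded_linear by blast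
    then show ?thesis
      unfolding q_def
      by (intro bounded_linear_add bounded_linear_ident bounded_linear_vec_nth bounded_linear_sub
          bounded_linear_compose[OF bounded_linear_scaleR_left]
          bounded_linear_compose[OF bounded_linear_divide])
  qed
  have "Blinfun (q x0) o\<^sub>L Blinfun (\<theta>' x0) = id_blinfun"
    using q\<theta>'[OF assms(3)] i
    by (intro blinfun_eqI) (simp add: bounded_linear_Blinfun_apply blq bl assms(3) e_def)
  ultimately obtain W V \<eta> \<eta>' where W: "open W" "W \<subseteq> S" "x0 \<in> W" "open V" "\<theta> x0 \<in> V"
    and hom: "homeomorphism W V \<theta> \<eta>"
    and d\<eta>: "\<And>y. y \<in> V \<Longrightarrow> (\<eta> has_derivative \<eta>' y) (at y)"
    and \<eta>': "\<And>y. y \<in> V \<Longrightarrow> \<eta>' y = inv_into UNIV (blinfun_apply (Blinfun (\<theta>' (\<eta> y))))"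
    and bij: "\<And>y. y \<in> V \<Longrightarrow> bij (blinfun_apply (Blinfun (\<theta>' (\<eta> y))))"
    using inverse_function_theorem[of S \<theta> "\<lambda>x. Blinfun (\<theta>' x)" x0 "Blinfun (q x0)"] assms(2,3)
    by (metis (no_types, lifting))
  have \<eta>W: "\<eta> y \<in> W" if "y \<in> V" for y using hom that by (auto simp: homeomorphism_def)
  have app: "blinfun_apply (Blinfun (\<theta>' (\<eta> y))) = \<theta>' (\<eta> y)" if "y \<in> V" for y
    using \<eta>W[OF that] W(2) by (auto simp: bounded_linear_Blinfun_apply bl)
  \<comment> \<open>\<open>\<theta>' (\<eta> y)\<close> multiplies \<open>e\<close> by
    \<open>D (\<eta> y) e\<close>, so its bijectivity keeps this derivative nonzero on all of
    \<open>V\<close>, not just at the image of \<open>x0\<close>.\<close>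
  have nz: "D (\<eta> y) e \<noteq> 0" if "y \<in> V" for y
  proof
    assume "D (\<eta> y) e = 0"
    then have "\<theta>' (\<eta> y) e = 0" by (simp add: \<theta>'_def)
    moreover have "\<theta>' (\<eta> y) 0 = 0"
      using linD[of "\<eta> y"] \<eta>W[OF that] W(2) by (auto simp: \<theta>'_def linear_0)
    moreover have "inj (\<theta>' (\<eta> y))" using bij[OF that] app[OF that] by (simp add: bij_def)
    ultimately have "e = 0" by (metis injD)
    then show False using ei by (metis zero_index zero_neq_one)
  qed
  have \<eta>'q: "\<eta>' y u = q (\<eta> y) u" if "y \<in> V" for y u
    unfolding \<eta>'[OF that] app[OF that]
    using bij[OF that] app[OF that] \<theta>'q[of "\<eta> y" u] nz[OF that] \<eta>W[OF that] W(2)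
    by (intro inv_f_eq) (auto simp: bij_def)
  \<comment> \<open>Bootstrapping: the derivative of \<open>\<eta>\<close> is a rational expression
    in directional derivatives of \<open>F\<close> at \<open>\<eta> y\<close>, hence of class
    \<open>C^k\<close> as soon as \<open>\<eta>\<close> is.\<close>
  have "Ck_on k V \<eta>" for k
  proof (induction k)
    case 0
    then show ?case using hom by (simp add: homeomorphism_def)
  next
    case (Suc k)
    show ?case
    proof (rule Ck_on_SucI[OF d\<eta> _ W(4)])
      fix u
      have DD: "Ck_on k V (\<lambda>y. D (\<eta> y) w)" for w
        using smooth_D[of w] \<eta>W W(2) by (intro Ck_on_compose[OF Suc _ _ W(4) assms(2)]) 
          (auto simp: smooth_on_def)
      have "Ck_on k V (\<lambda>y. u + ((u $ i - D (\<eta> y) u) * inverse (D (\<eta> y) e)) *\<^sub>R e)"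
        using nz
        by (intro Ck_on_add Ck_on_const Ck_on_bounded_linear[OF bounded_linear_scaleR_left]
            Ck_on_bounded_bilinear[OF bounded_bilinear_mult]
            Ck_on_bounded_linear[OF bounded_linear_minus[OF bounded_linear_ident], of _ _ "\<lambda>y. D (\<eta> y) u" for y, THEN Ck_on_add[OF Ck_on_const], simplified]
            Ck_on_inverse DD W(4)) auto
      then show "Ck_on k V (\<lambda>y. \<eta>' y u)"
        by (rule Ck_on_cong[OF _ _ W(4)]) (simp add: \<eta>'q q_def divide_inverse)
    qed
  qed
  then have sm\<eta>: "smooth_on V \<eta>" by (simp add: smooth_on_def)
  have sm\<theta>: "smooth_on W \<theta>"
  proof (rule smooth_on_subset[OF _ W(2)])
    show "smooth_on S \<theta>"
      unfolding \<theta>_def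
      by (intro smooth_on_add smooth_on_ident smooth_on_scaleR smooth_on_diff assms smooth_on_const
          smooth_on_bounded_linear[OF bounded_linear_vec_nth])
  qed
  have "\<theta> x $ i = F x" for x by (simp add: \<theta>_def)
  then show thesis by (rule that[OF W(1-4) hom sm\<theta> sm\<eta>])
qed

text \<open>\<open>straightening\<close> provides a chart with \<open>f - \<rho>\<close> as one of
  its coordinates; in it the level set is cut out by a coordinate hyperplane.\<close>

lemma regular_level_set:
  fixes \<A> :: "('a, real^'n::finite) chart set"
  assumes "smooth_manifold X \<A>" "smooth_mfd.smooth_fun \<A> f"
    and "\<And>P. P \<in> topspace X \<Longrightarrow> f P = \<rho> \<Longrightarrow>
      \<exists>c\<in>\<A>. P \<in> fst c \<and> (\<exists>v. frechet_derivative (f \<circ> chart_inv c) (at (snd c P)) v \<noteq> 0)"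
  shows "smooth_submanifold_codim \<A> 1 {P\<in>topspace X. f P = \<rho>}"
  unfolding smooth_submanifold_codim_def
proof
  interpret smooth_mfd X \<A> by (unfold_locales) (rule assms)
  let ?S = "{P\<in>topspace X. f P = \<rho>}"
  fix P assume "P \<in> ?S"
  then obtain c v where c: "c \<in> \<A>" "P \<in> fst c"
    and v: "frechet_derivative (f \<circ> chart_inv c) (at (snd c P)) v \<noteq> 0"
    using assms(3) by blast
  have "smooth_on (snd c ` fst c) (f \<circ> chart_inv c)"
    using assms(2) c smooth_fun_def by blast
  from smooth_on_diff[OF this smooth_on_const chart_open[OF c(1)]]
  have sm: "smooth_on (snd c ` fst c) (\<lambda>x. (f \<circ> chart_inv c) x - \<rho>)" .
  have "(f \<circ> chart_inv c) differentiable (at (snd c P))"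
    using assms(2) c smooth_fun_def smooth_on_differentiable by blast
  then have "frechet_derivative (\<lambda>x. (f \<circ> chart_inv c) x - \<rho>) (at (snd c P)) =
      frechet_derivative (f \<circ> chart_inv c) (at (snd c P))"
    using has_derivative_diff[OF iffD1[OF frechet_derivative_works] has_derivative_const, of "f \<circ> chart_inv c" _ \<rho>]
    by (intro frechet_derivative_at[symmetric]) simp
  with v have v': "frechet_derivative (\<lambda>x. (f \<circ> chart_inv c) x - \<rho>) (at (snd c P)) v \<noteq> 0"
    by simp
  obtain W V i and \<theta> \<eta> :: "real^'n \<Rightarrow> real^'n" where W: "open W" "W \<subseteq> snd c ` fst c" "snd c P \<in> W" "open V"
    and hom: "homeomorphism W V \<theta> \<eta>" and sm': "smooth_on W \<theta>" "smooth_on V \<eta>"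
    and \<theta>i: "\<And>x. \<theta> x $ i = (f \<circ> chart_inv c) x - \<rho>"
    using straightening[OF sm chart_open[OF c(1)] _ v'] c by (metis imageI)
  let ?U = "{P\<in>fst c. snd c P \<in> W}"
  have "(?U, \<theta> \<circ> snd c) \<in> \<A>"
    by (rule modify_chart[OF c(1) W(2,1,4) hom sm'])
  moreover have "P \<in> ?U" using c W by simp
  moreover have "subspace {y::real^'n. axis i 1 \<bullet> y = 0}" by (rule subspace_hyperplane)
  moreover have "dim {y::real^'n. axis i 1 \<bullet> y = 0} + 1 = DIM(real^'n)"
    using dim_hyperplane[of "axis i (1::real)"] DIM_positive[where 'a = "real^'n"]
    by (simp add: axis_eq_0_iff)
  moreover have "(\<theta> \<circ> snd c) ` (?U \<inter> ?S) = (\<theta> \<circ> snd c) ` ?U \<inter> {y. axis i 1 \<bullet> y = 0}"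
  proof -
    have "axis i 1 \<bullet> \<theta> (snd c Q) = f Q - \<rho>" if "Q \<in> fst c" for Q
      using \<theta>i[of "snd c Q"] c(1) that by (simp add: inner_axis')
    then show ?thesis using chart_subset[OF c(1)] by auto
  qed
  ultimately show "\<exists>(U, \<phi>)\<in>\<A>. P \<in> U \<and>
      (\<exists>L. subspace L \<and> dim L + 1 = DIM(real^'n) \<and> \<phi> ` (U \<inter> ?S) = \<phi> ` U \<inter> L)"
    by (intro bexI[of _ "(?U, \<theta> \<circ> snd c)"]) (auto intro!: exI[of _ "{y::real^'n. axis i 1 \<bullet> y = 0}"])
qed

lemma matrix_congruence_inner:
  fixes J :: "real^'n^'n"
  shows "v \<bullet> ((transpose J ** A ** J) *v v) = (J *v v) \<bullet> (A *v (J *v v))"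
proof -
  have "v \<bullet> ((transpose J ** A ** J) *v v) = v \<bullet> (transpose J *v (A *v (J *v v)))"
    by (simp add: matrix_vector_mul_assoc matrix_mul_assoc)
  also have "\<dots> = (A *v (J *v v)) \<bullet> (J *v v)"
    by (simp add: transpose_matrix_vector inner_commute[of v] dot_lmul_matrix)
  finally show ?thesis by (simp add: inner_commute)
qed

locale metric_mfd = smooth_mfd X \<A>
  for X :: "'a topology" and \<A> :: "('a, real^'n::finite) chart set" +
  fixes g :: "('a, 'n) metric_components"
  assumes metric: "pseudo_riemannian_metric \<A> g"
begin

section \<open>Homotheties\<close>

text \<open>Between \<open>c\<close> and the transported chart the coordinate expression of
  \<open>\<Phi>\<close> is the identity and its Jacobian is \<open>mat 1\<close>, so the homothety
  condition becomes proportionality of two matrices. All effects of homotheties on invariants,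
  derivatives and speeds are read off from this pair of charts.\<close>

lemma homothety_chart:
  assumes "homothety_with_factor X \<A> g \<Phi> r" "c \<in> \<A>"
  obtains d where "d \<in> \<A>" "fst d = \<Phi> ` fst c" "\<And>Q. Q \<in> fst c \<Longrightarrow> snd d (\<Phi> Q) = snd c Q"
    "\<And>Q. Q \<in> fst c \<Longrightarrow> g d (\<Phi> Q) = r\<^sup>2 *\<^sub>R g c Q"
proof -
  define d where "d = (\<Phi> ` fst c, snd c \<circ> inv_into (topspace X) \<Phi>)"
  have diff: "diffeomorphism X \<A> \<Phi>" using assms(1) by (simp add: homothety_with_factor_def)
  then have inj: "inj_on \<Phi> (topspace X)"
    by (auto simp: diffeomorphism_def Bij_def bij_betw_def)
  have d: "d \<in> \<A>" unfolding d_def by (rule push_chart[OF diff assms(2)])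
  have sd: "snd d (\<Phi> Q) = snd c Q" if "Q \<in> fst c" for Q
    using inj chart_subset[OF assms(2) that] by (simp add: d_def)
  have "g d (\<Phi> Q) = r\<^sup>2 *\<^sub>R g c Q" if Q: "Q \<in> fst c" for Q
  proof -
    have "((snd d \<circ> \<Phi> \<circ> chart_inv c) has_derivative (\<lambda>v. v)) (at (snd c Q))"
      by (rule has_derivative_transform_within_open[OF has_derivative_ident chart_open[OF assms(2)]])
        (use Q sd assms(2) in auto)
    note frechet_derivative_at[OF this, symmetric]
    then have "jacobian c d \<Phi> Q = mat 1"
      using matrix_id_mat_1 by (simp add: jacobian_def id_def)
    moreover have "transpose (jacobian c d \<Phi> Q) ** g d (\<Phi> Q) ** jacobian c d \<Phi> Q = r\<^sup>2 *\<^sub>R g c Q"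
      using assms d Q by (auto simp: homothety_with_factor_def d_def)
    ultimately show ?thesis by (simp add: transpose_mat)
  qed
  then show thesis using that[OF d _ sd] by (simp add: d_def)
qed

section \<open>Weyl invariants as functions on the manifold\<close>

lemma metric_coordinates_chart:
  assumes "c \<in> \<A>"
  shows "metric_coordinates (snd c ` fst c) (g c \<circ> chart_inv c)"
proof
  show "open (snd c ` fst c)" by (rule chart_open[OF assms])
  show "smooth_on (snd c ` fst c) (g c \<circ> chart_inv c)"
    using metric assms unfolding pseudo_riemannian_metric_def by blast
  show "invertible ((g c \<circ> chart_inv c) x)" if x: "x \<in> snd c ` fst c" for x
  proof -
    obtain P where "P \<in> fst c" "x = snd c P" using x by auto
    moreover from this have "invertible (g c P)"
      using metric assms unfolding pseudo_riemannian_metric_def by blast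
    ultimately show ?thesis using assms by simp
  qed
qed

lemma weyl_invariant_smooth:
  assumes "scalar_weyl_invariant \<A> g l R"
  shows "smooth_fun R"
  unfolding smooth_fun_def
proof
  fix c assume c: "c \<in> \<A>"
  obtain W where W: "\<forall>c\<in>\<A>. \<forall>P\<in>fst c. R P = eval_weyl (g c \<circ> chart_inv c) W (snd c P)"
    using assms by (auto simp: scalar_weyl_invariant_def)
  interpret metric_coordinates "snd c ` fst c" "g c \<circ> chart_inv c"
    by (rule metric_coordinates_chart[OF c])
  show "smooth_on (snd c ` fst c) (R \<circ> chart_inv c)"
    by (rule smooth_on_cong[OF smooth_eval_weyl[of W] _ open_S]) (use W c in auto)
qed

text \<open>The same expression \<open>W\<close> computes \<open>R (\<Phi> P)\<close> in the
  transported chart and \<open>R P\<close> in \<open>c\<close>, at the same coordinates but with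
  matrices differing by \<open>r\<^sup>2\<close>.\<close>

lemma weyl_invariant_homothety:
  assumes "scalar_weyl_invariant \<A> g l R" "homothety_with_factor X \<A> g \<Phi> r" "P \<in> topspace X"
  shows "R (\<Phi> P) = R P / r ^ l"
proof -
  obtain W where l: "weyl_expression_of_order l W"
    and W: "\<And>c P. c \<in> \<A> \<Longrightarrow> P \<in> fst c \<Longrightarrow> R P = eval_weyl (g c \<circ> chart_inv c) W (snd c P)"
    using assms(1) by (auto simp: scalar_weyl_invariant_def)
  obtain c where c: "c \<in> \<A>" "P \<in> fst c" using chart_at[OF assms(3)] .
  obtain d where d: "d \<in> \<A>" "fst d = \<Phi> ` fst c" "\<And>Q. Q \<in> fst c \<Longrightarrow> snd d (\<Phi> Q) = snd c Q"
    "\<And>Q. Q \<in> fst c \<Longrightarrow> g d (\<Phi> Q) = r\<^sup>2 *\<^sub>R g c Q"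
    using homothety_chart[OF assms(2) c(1)] by blast
  interpret metric_coordinates "snd c ` fst c" "g c \<circ> chart_inv c"
    by (rule metric_coordinates_chart[OF c(1)])
  have inv: "chart_inv d (snd c Q) = \<Phi> Q" if "Q \<in> fst c" for Q
    using chart_inv_left[OF d(1), of "\<Phi> Q"] d(2,3) that by auto
  have "R (\<Phi> P) = eval_weyl (g d \<circ> chart_inv d) W (snd c P)"
    using W[OF d(1), of "\<Phi> P"] d(2,3) c(2) by auto
  also have "\<dots> = eval_weyl (g c \<circ> chart_inv c) W (snd c P) / r ^ l"
  proof (rule eval_weyl_homothety[OF l])
    show "r > 0" using assms(2) by (simp add: homothety_with_factor_def)
    show "(g d \<circ> chart_inv d) x = r\<^sup>2 *\<^sub>R (g c \<circ> chart_inv c) x" if "x \<in> snd c ` fst c" for x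
      using that inv d(4) c(1) by auto
  qed (use c in auto)
  finally show ?thesis using W[OF c] by simp
qed

lemma weyl_invariant_order_pos:
  assumes "scalar_weyl_invariant \<A> g l R" "P \<in> topspace X" "R P \<noteq> 0"
  shows "l > 0"
proof -
  obtain c where "c \<in> \<A>" "P \<in> fst c" using chart_at[OF assms(2)] .
  then show ?thesis
    using assms(1,3) weyl_expression_of_order_pos unfolding scalar_weyl_invariant_def by metis
qed

text \<open>In the transported chart \<open>f\<close> is \<open>k\<close> times what it is in
  \<open>c\<close>. Used to move a critical point to any other point of its orbit.\<close>

lemma homothety_frechet_derivative:
  assumes "homothety_with_factor X \<A> g \<Phi> r" "c \<in> \<A>" "P \<in> fst c" "smooth_fun f"
    and f: "\<And>Q. Q \<in> topspace X \<Longrightarrow> f (\<Phi> Q) = k * f Q"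
  obtains d where "d \<in> \<A>" "\<Phi> P \<in> fst d"
    "frechet_derivative (f \<circ> chart_inv d) (at (snd d (\<Phi> P))) v =
      k * frechet_derivative (f \<circ> chart_inv c) (at (snd c P)) v"
proof -
  obtain d where d: "d \<in> \<A>" "fst d = \<Phi> ` fst c" "\<And>Q. Q \<in> fst c \<Longrightarrow> snd d (\<Phi> Q) = snd c Q"
    using homothety_chart[OF assms(1,2)] by metis
  have inv: "chart_inv d (snd c Q) = \<Phi> Q" if "Q \<in> fst c" for Q
    using chart_inv_left[OF d(1), of "\<Phi> Q"] d(2,3) that by auto
  have "smooth_on (snd c ` fst c) (f \<circ> chart_inv c)"
    using assms(2,4) by (simp add: smooth_fun_def)
  from has_derivative_mult_right[OF smooth_on_has_derivative[OF this, of "snd c P"], of k]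
  have "((\<lambda>x. k * (f \<circ> chart_inv c) x) has_derivative
      (\<lambda>v. k * frechet_derivative (f \<circ> chart_inv c) (at (snd c P)) v)) (at (snd c P))"
    using assms(3) by simp
  then have "((f \<circ> chart_inv d) has_derivative
      (\<lambda>v. k * frechet_derivative (f \<circ> chart_inv c) (at (snd c P)) v)) (at (snd c P))"
  proof (rule has_derivative_transform_within_open[OF _ chart_open[OF assms(2)]])
    show "k * (f \<circ> chart_inv c) x = (f \<circ> chart_inv d) x" if x: "x \<in> snd c ` fst c" for x
      using x assms(2) inv f chart_subset[OF assms(2)] by auto
  qed (use assms(3) in auto)
  from frechet_derivative_at[OF this, symmetric] show thesis
    using that[OF d(1)] d(2,3) assms(3) by (metis (no_types, lifting) imageI)
qed

text \<open>The set where \<open>f\<close> equals \<open>f P\<close> is closed by continuity and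
  open because \<open>f\<close> is constant on coordinate balls, which are convex.\<close>

lemma smooth_fun_constant:
  assumes "connected_space X" "smooth_fun f"
    and zero: "\<And>c P v. c \<in> \<A> \<Longrightarrow> P \<in> fst c \<Longrightarrow> frechet_derivative (f \<circ> chart_inv c) (at (snd c P)) v = 0"
    and "P \<in> topspace X" "Q \<in> topspace X"
  shows "f Q = f P"
proof -
  let ?Z = "{Q\<in>topspace X. f Q = f P}"
  have "closedin X {Q\<in>topspace X. f Q \<in> {f P}}"
    by (rule closedin_continuous_map_preimage[OF smooth_fun_continuous[OF assms(2)]]) simp
  then have "closedin X ?Z" by simp
  moreover have "openin X ?Z"
    unfolding openin_subopen[of X ?Z]
  proof
    fix Q assume Q: "Q \<in> ?Z"
    then obtain c where c: "c \<in> \<A>" "Q \<in> fst c" using chart_at by blast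
    then obtain e where e: "e > 0" "ball (snd c Q) e \<subseteq> snd c ` fst c"
      using chart_open[OF c(1)] open_contains_ball by blast
    have sm: "smooth_on (snd c ` fst c) (f \<circ> chart_inv c)"
      using assms(2) c(1) by (simp add: smooth_fun_def)
    have "(f \<circ> chart_inv c) x = (f \<circ> chart_inv c) (snd c Q)" if "x \<in> ball (snd c Q) e" for x
    proof (rule has_derivative_zero_unique[OF convex_ball _ that])
      fix y assume y: "y \<in> ball (snd c Q) e"
      then have "y \<in> snd c ` fst c" using e by blast
      then have "frechet_derivative (f \<circ> chart_inv c) (at y) = (\<lambda>v. 0)"
        using zero[OF c(1)] by auto
      then show "((f \<circ> chart_inv c) has_derivative (\<lambda>h. 0)) (at y within ball (snd c Q) e)"
        using smooth_on_has_derivative[OF sm \<open>y \<in> snd c ` fst c\<close>] has_derivative_at_withinI by metis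
    qed (use e in auto)
    then have const: "f S = f Q" if "S \<in> fst c" "snd c S \<in> ball (snd c Q) e" for S
      using that c by fastforce
    show "\<exists>T. openin X T \<and> Q \<in> T \<and> T \<subseteq> ?Z"
    proof (intro exI conjI)
      show "openin X {S\<in>fst c. snd c S \<in> ball (snd c Q) e}"
        by (rule chart_vimage[OF c(1)]) simp
      show "{S\<in>fst c. snd c S \<in> ball (snd c Q) e} \<subseteq> ?Z"
        using const Q chart_subset[OF c(1)] by auto
    qed (use c e in auto)
  qed
  ultimately have "?Z = {} \<or> ?Z = topspace X"
    using assms(1) unfolding connected_space_clopen_in by blast
  then show ?thesis using assms(4,5) by blast
qed

section \<open>Smooth curves and their speed\<close>

text \<open>It suffices to know the curve near each time in one convenient chart. Continuity into
  \<open>X\<close> is recovered from that of the coordinate curves.\<close>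

lemma smooth_path_on_iff:
  assumes "open J"
  shows "smooth_path_on X \<A> J \<gamma> \<longleftrightarrow>
    (\<forall>t\<in>J. \<exists>c\<in>\<A>. \<exists>I. open I \<and> t \<in> I \<and> I \<subseteq> J \<and> \<gamma> ` I \<subseteq> fst c \<and> smooth_on I (snd c \<circ> \<gamma>))"
    (is "?L \<longleftrightarrow> ?R")
proof
  assume ?L
  then have cont: "continuous_map (top_of_set J) X \<gamma>"
    and sm: "\<And>c. c \<in> \<A> \<Longrightarrow> smooth_on {t\<in>J. \<gamma> t \<in> fst c} (snd c \<circ> \<gamma> \<circ> inv_into J (\<lambda>t. t))"
    by (auto simp: smooth_path_on_def smooth_map_def)
  have op: "open {t\<in>J. \<gamma> t \<in> fst c}" if "c \<in> \<A>" for c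
  proof -
    have "openin (top_of_set J) {t\<in>topspace (top_of_set J). \<gamma> t \<in> fst c}"
      using cont chart_openin[OF that] unfolding continuous_map_def by blast
    then show ?thesis using assms by (simp add: openin_open_eq)
  qed
  show ?R
  proof
    fix t assume t: "t \<in> J"
    then have "\<gamma> t \<in> topspace X" using cont by (auto simp: continuous_map_def)
    then obtain c where c: "c \<in> \<A>" "\<gamma> t \<in> fst c" using chart_at by blast
    have inv: "inv_into J (\<lambda>t. t) s = s" if "s \<in> J" for s
      using inv_into_f_f[of "\<lambda>t. t" J s] that by (simp add: inj_on_def)
    have "smooth_on {t\<in>J. \<gamma> t \<in> fst c} (snd c \<circ> \<gamma>)"
      by (rule smooth_on_cong[OF sm[OF c(1)] _ op[OF c(1)]]) (simp add: inv)
    then show "\<exists>c\<in>\<A>. \<exists>I. open I \<and> t \<in> I \<and> I \<subseteq> J \<and> \<gamma> ` I \<subseteq> fst c \<and> smooth_on I (snd c \<circ> \<gamma>)"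
      using op[OF c(1)] c t by (intro bexI[of _ c] exI[of _ "{t\<in>J. \<gamma> t \<in> fst c}"]) auto
  qed
next
  assume R: ?R
  \<comment> \<open>Shrinks the interval until the curve stays in a prescribed open set
    \<open>V\<close>; injectivity of the chart carries membership back from coordinates. Arbitrary
    \<open>V\<close> gives continuity, and the domain of a second chart gives smoothness in that
    chart.\<close>
  have local: "\<exists>I c. c \<in> \<A> \<and> open I \<and> t \<in> I \<and> I \<subseteq> J \<and> (\<forall>s\<in>I. \<gamma> s \<in> V) \<and> \<gamma> ` I \<subseteq> fst c \<and> smooth_on I (snd c \<circ> \<gamma>)"
    if "t \<in> J" "openin X V" "\<gamma> t \<in> V" for t V
  proof -
    obtain c I where c: "c \<in> \<A>" "open I" "t \<in> I" "I \<subseteq> J" "\<gamma> ` I \<subseteq> fst c" "smooth_on I (snd c \<circ> \<gamma>)"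
      using R \<open>t \<in> J\<close> by blast
    let ?Z = "snd c ` (V \<inter> fst c)" and ?I = "I \<inter> (snd c \<circ> \<gamma>) -` (snd c ` (V \<inter> fst c))"
    have "open ?Z" using that chart_openin[OF c(1)] by (intro chart_image[OF c(1)]) auto
    then have "open ?I"
      using continuous_on_open_vimage[OF c(2)] smooth_on_continuous[OF c(6)] by (metis Int_commute)
    moreover have "\<gamma> s \<in> V" if "s \<in> ?I" for s
    proof -
      have "\<gamma> s \<in> fst c" using that c(5) by auto
      moreover obtain Q where "Q \<in> V \<inter> fst c" "snd c (\<gamma> s) = snd c Q" using \<open>s \<in> ?I\<close> by auto
      ultimately show ?thesis using chart_inj[OF c(1)] by (auto dest: inj_onD)
    qed
    moreover have "smooth_on ?I (snd c \<circ> \<gamma>)" by (rule smooth_on_subset[OF c(6)]) auto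
    ultimately show ?thesis using c that by (intro exI[of _ ?I] exI[of _ c]) auto
  qed
  have "continuous_map (top_of_set J) X \<gamma>"
    unfolding continuous_map_def
  proof (intro conjI allI impI)
    show "\<gamma> \<in> topspace (top_of_set J) \<rightarrow> topspace X"
      using R chart_subset by fastforce
    fix V assume "openin X V"
    then have "open {t\<in>J. \<gamma> t \<in> V}"
      unfolding open_subopen[of "{t\<in>J. \<gamma> t \<in> V}"]
    proof (intro ballI)
      fix t assume "t \<in> {t\<in>J. \<gamma> t \<in> V}"
      then obtain I where "open I" "t \<in> I" "I \<subseteq> J" "\<forall>s\<in>I. \<gamma> s \<in> V"
        using local[OF _ \<open>openin X V\<close>, of t] by auto
      then show "\<exists>T. open T \<and> t \<in> T \<and> T \<subseteq> {t\<in>J. \<gamma> t \<in> V}" by (intro exI[of _ I]) auto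
    qed
    then show "openin (top_of_set J) {t\<in>topspace (top_of_set J). \<gamma> t \<in> V}"
      using assms by (simp add: openin_open_eq)
  qed
  moreover have "smooth_on ((\<lambda>t. t) ` {t\<in>J. \<gamma> t \<in> fst d}) (snd d \<circ> \<gamma> \<circ> inv_into J (\<lambda>t. t))"
    if d: "d \<in> \<A>" for d
  proof (rule smooth_on_local)
    fix t assume "t \<in> (\<lambda>t. t) ` {t\<in>J. \<gamma> t \<in> fst d}"
    then obtain I c where c: "c \<in> \<A>" "open I" "t \<in> I" "I \<subseteq> J" "\<And>s. s \<in> I \<Longrightarrow> \<gamma> s \<in> fst d"
      "\<gamma> ` I \<subseteq> fst c" "smooth_on I (snd c \<circ> \<gamma>)"
      using local[OF _ chart_openin[OF d], of t] by auto
    have inv: "inv_into J (\<lambda>t. t) s = s" if "s \<in> J" for s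
      using inv_into_f_f[of "\<lambda>t. t" J s] that by (simp add: inj_on_def)
    have "smooth_on I (\<lambda>s. (snd d \<circ> chart_inv c) ((snd c \<circ> \<gamma>) s))"
    proof (rule smooth_on_compose[OF c(7) compatible[OF c(1) d] _ c(2)])
      show "open (snd c ` (fst c \<inter> fst d))"
        using openin_Int[OF chart_openin[OF c(1)] chart_openin[OF d]]
        by (intro chart_image[OF c(1)]) auto
    qed (use c in auto)
    then have "smooth_on I (snd d \<circ> \<gamma> \<circ> inv_into J (\<lambda>t. t))"
    proof (rule smooth_on_cong[OF _ _ c(2)])
      fix s assume s: "s \<in> I"
      then have "\<gamma> s \<in> fst c" "s \<in> J" using c(4,6) by auto
      then show "(snd d \<circ> chart_inv c) ((snd c \<circ> \<gamma>) s) = (snd d \<circ> \<gamma> \<circ> inv_into J (\<lambda>t. t)) s"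
        using c(1) inv by simp
    qed
    then show "\<exists>T. open T \<and> t \<in> T \<and> smooth_on T (snd d \<circ> \<gamma> \<circ> inv_into J (\<lambda>t. t))"
      using c by blast
  qed
  ultimately show ?L
    by (auto simp: smooth_path_on_def smooth_map_def)
qed

text \<open>The curve has to stay in the chart near \<open>t\<close>, because \<open>snd c\<close>
  is arbitrary outside \<open>fst c\<close>.\<close>

definition has_velocity :: "(real \<Rightarrow> 'a) \<Rightarrow> real \<Rightarrow> ('a, real^'n) chart \<Rightarrow> real^'n \<Rightarrow> bool" where
  "has_velocity \<gamma> t c v \<longleftrightarrow> c \<in> \<A> \<and> (\<exists>I. open I \<and> t \<in> I \<and> \<gamma> ` I \<subseteq> fst c) \<and>
     (snd c \<circ> \<gamma> has_vector_derivative v) (at t)"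

lemma has_velocity_in_chart: "has_velocity \<gamma> t c v \<Longrightarrow> \<gamma> t \<in> fst c"
  by (auto simp: has_velocity_def)

lemma has_velocity_cong:
  assumes "has_velocity \<gamma> t c v" "open I" "t \<in> I" "\<And>s. s \<in> I \<Longrightarrow> \<gamma> s = \<delta> s"
  shows "has_velocity \<delta> t c v"
proof -
  obtain K where K: "open K" "t \<in> K" "\<gamma> ` K \<subseteq> fst c" using assms(1) by (auto simp: has_velocity_def)
  have "\<delta> s \<in> fst c" if "s \<in> I \<inter> K" for s
    using assms(4)[of s] K(3) that by auto
  then have "open (I \<inter> K)" "t \<in> I \<inter> K" "\<delta> ` (I \<inter> K) \<subseteq> fst c"
    using assms(2,3) K by auto
  moreover have "(snd c \<circ> \<delta> has_vector_derivative v) (at t)"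
  proof (rule has_vector_derivative_transform_within_open[OF _ assms(2,3)])
    show "(snd c \<circ> \<gamma> has_vector_derivative v) (at t)"
      using assms(1) by (simp add: has_velocity_def)
  qed (simp add: assms(4))
  ultimately show ?thesis using assms(1) unfolding has_velocity_def by blast
qed

text \<open>The chain rule for the transition map. Only \<open>\<gamma> t \<in> fst d\<close> is
  given; that the curve remains in \<open>fst d\<close> near \<open>t\<close> follows from
  continuity of \<open>snd c \<circ> \<gamma>\<close> at \<open>t\<close>.\<close>

lemma has_velocity_change_chart:
  assumes "has_velocity \<gamma> t c v" "d \<in> \<A>" "\<gamma> t \<in> fst d"
  shows "has_velocity \<gamma> t d (jacobian c d (\<lambda>x. x) (\<gamma> t) *v v)"
proof -
  obtain I where c: "c \<in> \<A>" and I: "open I" "t \<in> I" "\<gamma> ` I \<subseteq> fst c"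
    and deriv: "(snd c \<circ> \<gamma> has_vector_derivative v) (at t)"
    using assms(1) by (auto simp: has_velocity_def)
  let ?Z = "snd c ` (fst c \<inter> fst d)"
  have Z: "open ?Z"
    using openin_Int[OF chart_openin[OF c] chart_openin[OF assms(2)]] by (intro chart_image[OF c]) auto
  have tZ: "(snd c \<circ> \<gamma>) t \<in> ?Z" using assms(3) I by auto
  have "isCont (snd c \<circ> \<gamma>) t"
    using deriv has_vector_derivative_continuous by blast
  then have "\<exists>K. open K \<and> t \<in> K \<and> (\<forall>s\<in>K. (snd c \<circ> \<gamma>) s \<in> ?Z)"
    unfolding continuous_at_open using Z tZ by (elim allE[of _ ?Z]) simp
  then obtain K where K: "open K" "t \<in> K" "\<And>s. s \<in> K \<Longrightarrow> (snd c \<circ> \<gamma>) s \<in> ?Z"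
    by metis
  have \<gamma>d: "\<gamma> s \<in> fst d" if "s \<in> I \<inter> K" for s
  proof -
    have "\<gamma> s \<in> fst c" using that I by auto
    moreover obtain Q where "Q \<in> fst c \<inter> fst d" "snd c (\<gamma> s) = snd c Q" using K(3)[of s] \<open>s \<in> I \<inter> K\<close> by auto
    ultimately show ?thesis using chart_inj[OF c] by (auto dest: inj_onD)
  qed
  let ?T = "snd d \<circ> (\<lambda>x. x) \<circ> chart_inv c"
  have "smooth_on ?Z ?T"
    using compatible[OF c assms(2)] by (simp add: o_def)
  from smooth_on_has_derivative[OF this tZ]
  have T: "(?T has_derivative frechet_derivative ?T (at ((snd c \<circ> \<gamma>) t))) (at ((snd c \<circ> \<gamma>) t))" .
  have "(?T \<circ> (snd c \<circ> \<gamma>) has_derivative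
      frechet_derivative ?T (at ((snd c \<circ> \<gamma>) t)) \<circ> (\<lambda>h. h *\<^sub>R v)) (at t)"
    using diff_chain_at[OF deriv[unfolded has_vector_derivative_def] T] .
  moreover have "frechet_derivative ?T (at ((snd c \<circ> \<gamma>) t)) \<circ> (\<lambda>h. h *\<^sub>R v) =
      (\<lambda>h. h *\<^sub>R (jacobian c d (\<lambda>x. x) (\<gamma> t) *v v))"
    using has_derivative_linear[OF T]
    by (auto simp: jacobian_def matrix_works linear_cmul fun_eq_iff)
  ultimately have "(?T \<circ> (snd c \<circ> \<gamma>) has_vector_derivative jacobian c d (\<lambda>x. x) (\<gamma> t) *v v) (at t)"
    by (simp add: has_vector_derivative_def)
  then have "(snd d \<circ> \<gamma> has_vector_derivative jacobian c d (\<lambda>x. x) (\<gamma> t) *v v) (at t)"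
  proof (rule has_vector_derivative_transform_within_open[OF _ I(1,2)])
    show "(?T \<circ> (snd c \<circ> \<gamma>)) s = (snd d \<circ> \<gamma>) s" if "s \<in> I" for s
    proof -
      have "\<gamma> s \<in> fst c" using that I by auto
      then show ?thesis using c by simp
    qed
  qed
  moreover have "open (I \<inter> K)" "t \<in> I \<inter> K" "\<gamma> ` (I \<inter> K) \<subseteq> fst d"
    using I K \<gamma>d by auto
  ultimately show ?thesis using assms(2) unfolding has_velocity_def by blast
qed

text \<open>\<open>speed\<close> uses a chart picked by \<open>SOME\<close>. The Jacobian in the law
  for velocities matches the one in the law for the metric, so every chart gives the same
  value.\<close>

lemma speed_eq:
  assumes "has_velocity \<gamma> t c v"
  shows "speed \<A> g \<gamma> t = sqrt (v \<bullet> (g c (\<gamma> t) *v v))"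
proof -
  define d where "d = (SOME c. c \<in> \<A> \<and> \<gamma> t \<in> fst c)"
  have c: "c \<in> \<A> \<and> \<gamma> t \<in> fst c" using assms has_velocity_in_chart by (auto simp: has_velocity_def)
  then have d: "d \<in> \<A> \<and> \<gamma> t \<in> fst d" unfolding d_def by (rule someI)
  let ?J = "jacobian c d (\<lambda>x. x) (\<gamma> t)"
  have "vector_derivative (snd d \<circ> \<gamma>) (at t) = ?J *v v"
    using has_velocity_change_chart[OF assms, of d] d by (simp add: has_velocity_def vector_derivative_at)
  then have "speed \<A> g \<gamma> t = sqrt ((?J *v v) \<bullet> (g d (\<gamma> t) *v (?J *v v)))"
    by (simp add: speed_def Let_def flip: d_def)
  also have "\<dots> = sqrt (v \<bullet> (g c (\<gamma> t) *v v))"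
    using metric c d unfolding pseudo_riemannian_metric_def
    by (metis IntI matrix_congruence_inner)
  finally show ?thesis .
qed

text \<open>In the transported chart the coordinate curve is literally the same; only the metric
  changes.\<close>

lemma homothety_velocity:
  assumes "homothety_with_factor X \<A> g \<Phi> r" "has_velocity \<gamma> t c v"
  obtains d where "has_velocity (\<Phi> \<circ> \<gamma>) t d v" "g d (\<Phi> (\<gamma> t)) = r\<^sup>2 *\<^sub>R g c (\<gamma> t)"
proof -
  obtain I where c: "c \<in> \<A>" and I: "open I" "t \<in> I" "\<gamma> ` I \<subseteq> fst c"
    and deriv: "(snd c \<circ> \<gamma> has_vector_derivative v) (at t)"
    using assms(2) by (auto simp: has_velocity_def)
  obtain d where d: "d \<in> \<A>" "fst d = \<Phi> ` fst c" "\<And>Q. Q \<in> fst c \<Longrightarrow> snd d (\<Phi> Q) = snd c Q"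
    "\<And>Q. Q \<in> fst c \<Longrightarrow> g d (\<Phi> Q) = r\<^sup>2 *\<^sub>R g c Q"
    using homothety_chart[OF assms(1) c] by blast
  have "(snd d \<circ> (\<Phi> \<circ> \<gamma>) has_vector_derivative v) (at t)"
    by (rule has_vector_derivative_transform_within_open[OF deriv I(1,2)]) (use d(3) I in auto)
  moreover have "(\<Phi> \<circ> \<gamma>) ` I \<subseteq> fst d" using d(2) I by auto
  ultimately have "has_velocity (\<Phi> \<circ> \<gamma>) t d v"
    using I d(1) unfolding has_velocity_def by blast
  then show thesis by (rule that) (use d(4) I in auto)
qed

lemma homothety_speed:
  assumes "homothety_with_factor X \<A> g \<Phi> r" "has_velocity \<gamma> t c v"
  shows "speed \<A> g (\<Phi> \<circ> \<gamma>) t = r * speed \<A> g \<gamma> t"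
proof -
  obtain d where d: "has_velocity (\<Phi> \<circ> \<gamma>) t d v" "g d (\<Phi> (\<gamma> t)) = r\<^sup>2 *\<^sub>R g c (\<gamma> t)"
    using homothety_velocity[OF assms] .
  have "r > 0" using assms(1) by (simp add: homothety_with_factor_def)
  then show ?thesis
    by (simp add: speed_eq[OF d(1)] speed_eq[OF assms(2)] d(2) real_sqrt_mult
        flip: scaleR_matrix_vector_assoc)
qed

section \<open>Transport, reparametrisation and existence of smooth paths\<close>

lemma homothety_smooth_path:
  assumes "homothety_with_factor X \<A> g \<Phi> r" "open J" "smooth_path_on X \<A> J \<gamma>"
  shows "smooth_path_on X \<A> J (\<Phi> \<circ> \<gamma>)"
  unfolding smooth_path_on_iff[OF assms(2)]
proof
  fix t assume "t \<in> J"
  then obtain c I where c: "c \<in> \<A>" "open I" "t \<in> I" "I \<subseteq> J" "\<gamma> ` I \<subseteq> fst c" "smooth_on I (snd c \<circ> \<gamma>)"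
    using assms(3) smooth_path_on_iff[OF assms(2)] by blast
  obtain d where d: "d \<in> \<A>" "fst d = \<Phi> ` fst c" "\<And>Q. Q \<in> fst c \<Longrightarrow> snd d (\<Phi> Q) = snd c Q"
    using homothety_chart[OF assms(1) c(1)] by metis
  have "smooth_on I (snd d \<circ> (\<Phi> \<circ> \<gamma>))"
    by (rule smooth_on_cong[OF c(6) _ c(2)]) (use d(3) c(5) in auto)
  then show "\<exists>c\<in>\<A>. \<exists>I. open I \<and> t \<in> I \<and> I \<subseteq> J \<and> (\<Phi> \<circ> \<gamma>) ` I \<subseteq> fst c \<and>
      smooth_on I (snd c \<circ> (\<Phi> \<circ> \<gamma>))"
    using c d by (intro bexI[of _ d] exI[of _ I]) auto
qed

lemma smooth_path_velocity:
  assumes "open J" "smooth_path_on X \<A> J \<gamma>" "t \<in> J"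
  obtains c v where "has_velocity \<gamma> t c v"
proof -
  obtain c I where c: "c \<in> \<A>" "open I" "t \<in> I" "I \<subseteq> J" "\<gamma> ` I \<subseteq> fst c" "smooth_on I (snd c \<circ> \<gamma>)"
    using assms smooth_path_on_iff[OF assms(1)] by blast
  have "(snd c \<circ> \<gamma> has_vector_derivative vector_derivative (snd c \<circ> \<gamma>) (at t)) (at t)"
    using smooth_on_differentiable[OF c(6,3)] by (simp add: vector_derivative_works)
  then show thesis using that c unfolding has_velocity_def by blast
qed

lemma smooth_path_speed_continuous:
  assumes "open J" "smooth_path_on X \<A> J \<gamma>"
  shows "continuous_on J (speed \<A> g \<gamma>)"
proof (rule continuous_at_imp_continuous_on, rule)
  fix t assume "t \<in> J"
  then obtain c I where c: "c \<in> \<A>" "open I" "t \<in> I" "I \<subseteq> J" "\<gamma> ` I \<subseteq> fst c" "smooth_on I (snd c \<circ> \<gamma>)"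
    using assms smooth_path_on_iff[OF assms(1)] by blast
  \<comment> \<open>The velocity is written with \<open>frechet_derivative\<close> because its
    continuity in \<open>s\<close> is then part of the smoothness of the coordinate curve.\<close>
  define w where "w s = frechet_derivative (snd c \<circ> \<gamma>) (at s) 1" for s
  have vel: "has_velocity \<gamma> s c (w s)" if s: "s \<in> I" for s
  proof -
    have D: "(snd c \<circ> \<gamma> has_derivative frechet_derivative (snd c \<circ> \<gamma>) (at s)) (at s)"
      by (rule smooth_on_has_derivative[OF c(6) s])
    moreover have "frechet_derivative (snd c \<circ> \<gamma>) (at s) h = h *\<^sub>R w s" for h
      using linear_cmul[OF has_derivative_linear[OF D], of h 1] by (simp add: w_def)
    then have "frechet_derivative (snd c \<circ> \<gamma>) (at s) = (\<lambda>h. h *\<^sub>R w s)" by (rule ext)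
    ultimately have "(snd c \<circ> \<gamma> has_vector_derivative w s) (at s)"
      unfolding has_vector_derivative_def by metis
    then show ?thesis using c s unfolding has_velocity_def by blast
  qed
  interpret metric_coordinates "snd c ` fst c" "g c \<circ> chart_inv c"
    by (rule metric_coordinates_chart[OF c(1)])
  have cw: "continuous_on I w"
    unfolding w_def by (rule smooth_on_continuous[OF smooth_on_frechet_derivative[OF c(6)]])
  have "continuous_on I (\<lambda>s. (g c \<circ> chart_inv c) ((snd c \<circ> \<gamma>) s))"
    by (rule continuous_on_compose2[OF smooth_on_continuous[OF smooth_G] smooth_on_continuous[OF c(6)]])
      (use c(5) in auto)
  then have "continuous_on I (\<lambda>s. sqrt (w s \<bullet> ((g c \<circ> chart_inv c) ((snd c \<circ> \<gamma>) s) *v w s)))"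
    unfolding matrix_vector_mult_def by (intro continuous_intros cw continuous_on_vec_lambda)
  moreover have "sqrt (w s \<bullet> ((g c \<circ> chart_inv c) ((snd c \<circ> \<gamma>) s) *v w s)) = speed \<A> g \<gamma> s" if "s \<in> I" for s
  proof -
    have "\<gamma> s \<in> fst c" using that c(5) by auto
    then show ?thesis using speed_eq[OF vel[OF that]] c(1) by simp
  qed
  ultimately have "continuous_on I (speed \<A> g \<gamma>)"
    by (rule continuous_on_eq)
  then show "isCont (speed \<A> g \<gamma>) t"
    using c(2,3) continuous_on_eq_continuous_at by blast
qed

lemma smooth_path_affine:
  assumes "open J" "smooth_path_on X \<A> J \<gamma>"
  shows "smooth_path_on X \<A> ((\<lambda>s. \<alpha> * s + \<beta>) -` J) (\<lambda>s. \<gamma> (\<alpha> * s + \<beta>))"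
proof -
  let ?f = "\<lambda>s::real. \<alpha> * s + \<beta>"
  have cont: "continuous_on UNIV ?f" by (intro continuous_intros)
  have op: "open (?f -` K)" if "open K" for K
    using continuous_on_open_vimage[of UNIV ?f] cont that by simp
  show ?thesis
    unfolding smooth_path_on_iff[OF op[OF assms(1)]]
  proof
    fix t assume "t \<in> ?f -` J"
    then obtain c I where c: "c \<in> \<A>" "open I" "?f t \<in> I" "I \<subseteq> J" "\<gamma> ` I \<subseteq> fst c" "smooth_on I (snd c \<circ> \<gamma>)"
      using assms smooth_path_on_iff[OF assms(1)] by blast
    have "smooth_on (?f -` I) (\<lambda>s. (snd c \<circ> \<gamma>) (?f s))"
      by (rule smooth_on_compose[OF _ c(6)])
        (auto intro!: smooth_on_add smooth_on_mult smooth_on_ident op c)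
    then have "smooth_on (?f -` I) (snd c \<circ> (\<lambda>s. \<gamma> (?f s)))" by (simp add: o_def)
    then show "\<exists>c\<in>\<A>. \<exists>I. open I \<and> t \<in> I \<and> I \<subseteq> ?f -` J \<and> (\<lambda>s. \<gamma> (?f s)) ` I \<subseteq> fst c \<and>
        smooth_on I (snd c \<circ> (\<lambda>s. \<gamma> (?f s)))"
      using c op[OF c(2)] by (intro bexI[of _ c] exI[of _ "?f -` I"]) auto
  qed
qed

text \<open>The absolute value admits \<open>\<alpha> = -1\<close>, the reversal of a path.\<close>

lemma affine_speed:
  assumes "has_velocity \<gamma> (\<alpha> * t + \<beta>) c v"
  shows "speed \<A> g (\<lambda>s. \<gamma> (\<alpha> * s + \<beta>)) t = \<bar>\<alpha>\<bar> * speed \<A> g \<gamma> (\<alpha> * t + \<beta>)"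
proof -
  let ?f = "\<lambda>s::real. \<alpha> * s + \<beta>"
  obtain I where c: "c \<in> \<A>" and I: "open I" "?f t \<in> I" "\<gamma> ` I \<subseteq> fst c"
    and deriv: "(snd c \<circ> \<gamma> has_vector_derivative v) (at (?f t))"
    using assms by (auto simp: has_velocity_def)
  have cont: "continuous_on UNIV ?f" by (intro continuous_intros)
  have op: "open (?f -` I)"
    using continuous_on_open_vimage[of UNIV ?f] cont I(1) by simp
  have "(?f has_vector_derivative \<alpha>) (at t)"
    by (auto intro!: derivative_eq_intros simp: has_real_derivative_iff_has_vector_derivative[symmetric])
  from vector_diff_chain_at[OF this deriv]
  have "((snd c \<circ> \<gamma>) \<circ> ?f has_vector_derivative \<alpha> *\<^sub>R v) (at t)" .
  then have "has_velocity (\<lambda>s. \<gamma> (?f s)) t c (\<alpha> *\<^sub>R v)"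
    using c I op unfolding has_velocity_def o_def by (intro conjI exI[of _ "?f -` I"]) auto
  from speed_eq[OF this] speed_eq[OF assms] show ?thesis
    by (simp add: matrix_vector_mult_scaleR real_sqrt_mult mult.assoc[symmetric])
qed

lemma chart_segment_smooth_path:
  assumes "c \<in> \<A>"
  shows "smooth_path_on X \<A> ((\<lambda>s. x + s *\<^sub>R u) -` (snd c ` fst c)) (\<lambda>s. chart_inv c (x + s *\<^sub>R u))"
    and "open ((\<lambda>s::real. x + s *\<^sub>R u) -` (snd c ` fst c))"
proof -
  let ?f = "\<lambda>s::real. x + s *\<^sub>R u" and ?J = "(\<lambda>s::real. x + s *\<^sub>R u) -` (snd c ` fst c)"
  have cont: "continuous_on UNIV ?f" by (intro continuous_intros)
  show op: "open ?J"
    using continuous_on_open_vimage[of UNIV ?f] cont chart_open[OF assms] by simp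
  have "smooth_on ?J ?f"
    by (intro smooth_on_add smooth_on_const smooth_on_scaleR smooth_on_ident op)
  then have "smooth_on ?J (snd c \<circ> (\<lambda>s. chart_inv c (?f s)))"
    by (rule smooth_on_cong[OF _ _ op]) (auto simp: f_inv_into_f)
  moreover have "(\<lambda>s. chart_inv c (?f s)) ` ?J \<subseteq> fst c"
    by (auto intro: inv_into_into)
  ultimately show "smooth_path_on X \<A> ?J (\<lambda>s. chart_inv c (?f s))"
    unfolding smooth_path_on_iff[OF op] using assms op by blast
qed

end

context metric_mfd
begin

section \<open>Piecewise smooth paths\<close>

definition smooth_piece :: "(real \<Rightarrow> 'a) \<Rightarrow> real \<Rightarrow> real \<Rightarrow> bool" where
  "smooth_piece \<gamma> a b \<longleftrightarrow> a < b \<and>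
     (\<exists>J \<delta>. open J \<and> {a..b} \<subseteq> J \<and> smooth_path_on X \<A> J \<delta> \<and> (\<forall>s\<in>{a..b}. \<gamma> s = \<delta> s))"

text \<open>\<open>piecewise_smooth_path\<close> lists the break points of a subdivision of
  \<open>{0..1}\<close>. The inductive form works on any interval and makes cutting and joining
  paths a matter of structural induction.\<close>

inductive pw_smooth :: "(real \<Rightarrow> 'a) \<Rightarrow> real \<Rightarrow> real \<Rightarrow> bool" for \<gamma> where
  piece: "smooth_piece \<gamma> a b \<Longrightarrow> pw_smooth \<gamma> a b"
| append: "smooth_piece \<gamma> a b \<Longrightarrow> pw_smooth \<gamma> b c \<Longrightarrow> pw_smooth \<gamma> a c"

lemma smooth_piece_less: "smooth_piece \<gamma> a b \<Longrightarrow> a < b"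
  by (simp add: smooth_piece_def)

lemma smooth_piece_cong:
  "smooth_piece \<gamma> a b \<Longrightarrow> (\<And>s. s \<in> {a..b} \<Longrightarrow> \<gamma> s = \<gamma>' s) \<Longrightarrow> smooth_piece \<gamma>' a b"
  unfolding smooth_piece_def by metis

lemma smooth_piece_subinterval:
  assumes "smooth_piece \<gamma> a b" "a \<le> s" "s < t" "t \<le> b"
  shows "smooth_piece \<gamma> s t"
proof -
  obtain J \<delta> where "open J" "{a..b} \<subseteq> J" "smooth_path_on X \<A> J \<delta>" "\<forall>s\<in>{a..b}. \<gamma> s = \<delta> s"
    using assms(1) by (auto simp: smooth_piece_def)
  then show ?thesis
    using assms(2-4) unfolding smooth_piece_def by (intro conjI exI[of _ J] exI[of _ \<delta>]) auto
qed

lemma smooth_piece_affine: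
  assumes "smooth_piece \<gamma> a b" "a' < b'" "(\<lambda>s. \<alpha> * s + \<beta>) ` {a'..b'} \<subseteq> {a..b}"
  shows "smooth_piece (\<lambda>s. \<gamma> (\<alpha> * s + \<beta>)) a' b'"
proof -
  obtain J \<delta> where J: "open J" "{a..b} \<subseteq> J" "smooth_path_on X \<A> J \<delta>" "\<forall>s\<in>{a..b}. \<gamma> s = \<delta> s"
    using assms(1) by (auto simp: smooth_piece_def)
  let ?f = "\<lambda>s::real. \<alpha> * s + \<beta>"
  have "continuous_on UNIV ?f" by (intro continuous_intros)
  then have "open (?f -` J)"
    using continuous_on_open_vimage[of UNIV ?f] J(1) by simp
  moreover have "smooth_path_on X \<A> (?f -` J) (\<lambda>s. \<delta> (?f s))"
    by (rule smooth_path_affine[OF J(1,3)])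
  moreover have "{a'..b'} \<subseteq> ?f -` J" using assms(3) J(2) by auto
  moreover have "\<forall>s\<in>{a'..b'}. \<gamma> (?f s) = \<delta> (?f s)" using assms(3) J(4) by auto
  ultimately show ?thesis
    unfolding smooth_piece_def using assms(2) by blast
qed

text \<open>Restricted to the open interval, since at its ends \<open>\<gamma>\<close> agrees with
  the smooth extension \<open>\<delta>\<close> on one side only.\<close>

lemma smooth_piece_velocity:
  assumes "smooth_piece \<gamma> a b" "t \<in> {a<..<b}"
  obtains c v where "has_velocity \<gamma> t c v"
proof -
  obtain J \<delta> where J: "open J" "{a..b} \<subseteq> J" "smooth_path_on X \<A> J \<delta>" "\<forall>s\<in>{a..b}. \<gamma> s = \<delta> s"
    using assms(1) by (auto simp: smooth_piece_def)
  have "t \<in> J" using assms(2) J(2) by auto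
  then obtain c v where "has_velocity \<delta> t c v" by (rule smooth_path_velocity[OF J(1,3)])
  then have "has_velocity \<gamma> t c v"
    by (rule has_velocity_cong[of _ _ _ _ "{a<..<b}"]) (use assms(2) J in auto)
  then show thesis by (rule that)
qed

text \<open>Continuity is expressed through closed sets because they survive the finite unions that
  arise when pieces are joined.\<close>

lemma smooth_piece_closed:
  assumes "smooth_piece \<gamma> a b" "closedin X K"
  shows "\<gamma> ` {a..b} \<subseteq> topspace X" "closed {s\<in>{a..b}. \<gamma> s \<in> K}"
proof -
  obtain J \<delta> where J: "open J" "{a..b} \<subseteq> J" "smooth_path_on X \<A> J \<delta>" "\<forall>s\<in>{a..b}. \<gamma> s = \<delta> s"
    using assms(1) by (auto simp: smooth_piece_def)
  then have cont: "continuous_map (top_of_set J) X \<delta>"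
    by (simp add: smooth_path_on_def smooth_map_def)
  then show "\<gamma> ` {a..b} \<subseteq> topspace X"
    using J(2,4) by (fastforce simp: continuous_map_def)
  have "closedin (top_of_set J) {s\<in>topspace (top_of_set J). \<delta> s \<in> K}"
    by (rule closedin_continuous_map_preimage[OF cont assms(2)])
  then obtain C where C: "closed C" "{s\<in>J. \<delta> s \<in> K} = J \<inter> C"
    unfolding closedin_closed by auto
  have "{s\<in>{a..b}. \<gamma> s \<in> K} = {a..b} \<inter> {s\<in>J. \<delta> s \<in> K}"
    using J(2,4) by auto
  also have "\<dots> = {a..b} \<inter> C" using J(2) C(2) by auto
  finally have "{s\<in>{a..b}. \<gamma> s \<in> K} = {a..b} \<inter> C" .
  then show "closed {s\<in>{a..b}. \<gamma> s \<in> K}" using C(1) by (simp add: closed_Int)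
qed

lemma speed_cong:
  assumes "has_velocity \<gamma> t c v" "open I" "t \<in> I" "\<And>s. s \<in> I \<Longrightarrow> \<gamma> s = \<delta> s"
  shows "speed \<A> g \<gamma> t = speed \<A> g \<delta> t"
  using speed_eq[OF assms(1)] speed_eq[OF has_velocity_cong[OF assms]] assms(4)[OF assms(3)] by simp

lemma smooth_piece_integrable:
  assumes "smooth_piece \<gamma> a b"
  shows "speed \<A> g \<gamma> integrable_on {a..b}"
proof -
  obtain J \<delta> where J: "open J" "{a..b} \<subseteq> J" "smooth_path_on X \<A> J \<delta>" "\<forall>s\<in>{a..b}. \<gamma> s = \<delta> s"
    using assms(1) by (auto simp: smooth_piece_def)
  have "speed \<A> g \<delta> integrable_on cbox a b"
    using continuous_on_subset[OF smooth_path_speed_continuous[OF J(1,3)] J(2)]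
    by (intro integrable_continuous) simp
  then have "speed \<A> g \<gamma> integrable_on cbox a b"
  proof (rule integrable_spike_interior[rotated])
    fix t assume "t \<in> box a b"
    then have t: "t \<in> {a<..<b}" by (simp add: box_real)
    obtain c v where "has_velocity \<gamma> t c v" using smooth_piece_velocity[OF assms t] .
    then show "speed \<A> g \<gamma> t = speed \<A> g \<delta> t"
      by (rule speed_cong[of _ _ _ _ "{a<..<b}"]) (use t J(4) in auto)
  qed
  then show ?thesis by simp
qed

lemma pw_smooth_less: "pw_smooth \<gamma> a b \<Longrightarrow> a < b"
  by (induction rule: pw_smooth.induct) (auto dest: smooth_piece_less)

lemma pw_smooth_trans: "pw_smooth \<gamma> a b \<Longrightarrow> pw_smooth \<gamma> b c \<Longrightarrow> pw_smooth \<gamma> a c"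
  by (induction rule: pw_smooth.induct) (auto intro: pw_smooth.intros)

lemma pw_smooth_cong:
  "pw_smooth \<gamma> a b \<Longrightarrow> (\<And>s. s \<in> {a..b} \<Longrightarrow> \<gamma> s = \<gamma>' s) \<Longrightarrow> pw_smooth \<gamma>' a b"
proof (induction rule: pw_smooth.induct)
  case (piece a b)
  then show ?case by (auto intro!: pw_smooth.piece smooth_piece_cong[of \<gamma>])
next
  case (append a b c)
  note less = smooth_piece_less[OF append.hyps(1)] pw_smooth_less[OF append.hyps(2)]
  have "smooth_piece \<gamma>' a b"
    by (rule smooth_piece_cong[OF append.hyps(1)]) (use append.prems less in auto)
  moreover have "pw_smooth \<gamma>' b c"
    by (rule append.IH) (use append.prems less in auto)
  ultimately show ?case by (rule pw_smooth.append)
qed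

lemma pw_smooth_affine_pos:
  assumes "pw_smooth \<gamma> a b" "\<alpha> > 0"
  shows "pw_smooth (\<lambda>s. \<gamma> (\<alpha> * s + \<beta>)) ((a - \<beta>) / \<alpha>) ((b - \<beta>) / \<alpha>)"
proof -
  have "smooth_piece (\<lambda>s. \<gamma> (\<alpha> * s + \<beta>)) ((a - \<beta>) / \<alpha>) ((b - \<beta>) / \<alpha>)"
    if "smooth_piece \<gamma> a b" for a b
    by (rule smooth_piece_affine[OF that])
      (use assms(2) smooth_piece_less[OF that] in \<open>auto simp: field_simps\<close>)
  with assms(1) show ?thesis
    by (induction rule: pw_smooth.induct) (auto intro: pw_smooth.intros)
qed

lemma pw_smooth_reverse:
  assumes "pw_smooth \<gamma> a b"
  shows "pw_smooth (\<lambda>s. \<gamma> (- s)) (- b) (- a)"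
proof -
  have *: "smooth_piece (\<lambda>s. \<gamma> (- s)) (- b) (- a)" if "smooth_piece \<gamma> a b" for a b
    using smooth_piece_affine[OF that, of "- b" "- a" "- 1" 0] smooth_piece_less[OF that] by auto
  from assms show ?thesis
  proof (induction rule: pw_smooth.induct)
    case (append a b c)
    show ?case
      by (rule pw_smooth_trans[OF append.IH pw_smooth.piece[OF *[OF append.hyps(1)]]])
  qed (auto intro: * pw_smooth.intros)
qed

lemma pw_smooth_split:
  "pw_smooth \<gamma> a b \<Longrightarrow> a < s \<Longrightarrow> s < b \<Longrightarrow> pw_smooth \<gamma> a s \<and> pw_smooth \<gamma> s b"
proof (induction rule: pw_smooth.induct)
  case (piece a b)
  then show ?case by (auto intro!: pw_smooth.piece elim: smooth_piece_subinterval)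
next
  case (append a b c)
  consider "s < b" | "s = b" | "b < s" by linarith
  then show ?case
  proof cases
    case 1
    then have "smooth_piece \<gamma> a s" "smooth_piece \<gamma> s b"
      using append.prems smooth_piece_subinterval[OF append.hyps(1)] by auto
    then show ?thesis using append.hyps by (auto intro: pw_smooth.intros)
  next
    case 2
    then show ?thesis using append.hyps by (auto intro: pw_smooth.intros)
  next
    case 3
    then show ?thesis using append by (auto intro: pw_smooth.intros)
  qed
qed

lemma piecewise_smooth_path_iff: "piecewise_smooth_path X \<A> \<gamma> \<longleftrightarrow> pw_smooth \<gamma> 0 1"
proof
  assume "piecewise_smooth_path X \<A> \<gamma>"
  then obtain m and t :: "nat \<Rightarrow> real" where t: "t 0 = 0" "t m = 1" "\<forall>i<m. smooth_piece \<gamma> (t i) (t (Suc i))"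
    unfolding piecewise_smooth_path_def smooth_piece_def by blast
  have "pw_smooth \<gamma> (t 0) (t (Suc k))" if "Suc k \<le> m" for k
    using that
  proof (induction k)
    case 0
    then show ?case using t(3) by (auto intro: pw_smooth.piece)
  next
    case (Suc k)
    then have "pw_smooth \<gamma> (t (Suc k)) (t (Suc (Suc k)))"
      using t(3) by (auto intro: pw_smooth.piece)
    then show ?case using Suc by (auto intro: pw_smooth_trans)
  qed
  moreover have "m > 0" using t by (cases m) auto
  ultimately have "pw_smooth \<gamma> (t 0) (t m)" by (metis Suc_pred order_refl)
  then show "pw_smooth \<gamma> 0 1" using t by simp
next
  have "\<exists>m t. t 0 = a \<and> t m = b \<and> (\<forall>i<m. smooth_piece \<gamma> (t i) (t (Suc i)))"
    if "pw_smooth \<gamma> a b" for a b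
    using that
  proof (induction rule: pw_smooth.induct)
    case (piece a b)
    then show ?case
      by (intro exI[of _ 1] exI[of _ "\<lambda>i. if i = 0 then a else b"]) auto
  next
    case (append a b c)
    then obtain m t where t: "t 0 = b" "t m = c" "\<forall>i<m. smooth_piece \<gamma> (t i) (t (Suc i))" by blast
    show ?case
    proof (intro exI conjI allI impI)
      \<comment> \<open>Puts \<open>a\<close> in front of the break points and shifts the others by
        one.\<close>
      let ?t = "case_nat a t"
      show "smooth_piece \<gamma> (?t i) (?t (Suc i))" if "i < Suc m" for i
        using t append.hyps(1) that by (cases i) auto
      show "?t (Suc m) = c" using t by simp
    qed simp
  qed
  moreover assume "pw_smooth \<gamma> 0 1"
  ultimately obtain m and t :: "nat \<Rightarrow> real" where "t 0 = 0" "t m = 1" "\<forall>i<m. smooth_piece \<gamma> (t i) (t (Suc i))"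
    by blast
  then show "piecewise_smooth_path X \<A> \<gamma>"
    unfolding piecewise_smooth_path_def smooth_piece_def by blast
qed

lemma pw_smooth_closed:
  assumes "pw_smooth \<gamma> a b" "closedin X K"
  shows "\<gamma> ` {a..b} \<subseteq> topspace X \<and> closed {s\<in>{a..b}. \<gamma> s \<in> K}"
  using assms(1)
proof (induction rule: pw_smooth.induct)
  case (piece a b)
  then show ?case using smooth_piece_closed[OF _ assms(2)] by blast
next
  case (append a b c)
  have "{a..c} = {a..b} \<union> {b..c}"
    using smooth_piece_less[OF append.hyps(1)] pw_smooth_less[OF append.hyps(2)] by auto
  moreover from this have "{s\<in>{a..c}. \<gamma> s \<in> K} = {s\<in>{a..b}. \<gamma> s \<in> K} \<union> {s\<in>{b..c}. \<gamma> s \<in> K}"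
    by auto
  ultimately show ?case
    using append.IH smooth_piece_closed[OF append.hyps(1) assms(2)] by (simp add: image_Un closed_Un)
qed

lemma pw_smooth_continuous:
  assumes "pw_smooth \<gamma> a b"
  shows "continuous_map (top_of_set {a..b}) X \<gamma>"
  unfolding continuous_map_closedin
proof (intro conjI allI impI)
  show "\<gamma> \<in> topspace (top_of_set {a..b}) \<rightarrow> topspace X"
    using pw_smooth_closed[OF assms closedin_empty] by auto
  fix K assume "closedin X K"
  then have "closed {s\<in>{a..b}. \<gamma> s \<in> K}" using pw_smooth_closed[OF assms] by blast
  then show "closedin (top_of_set {a..b}) {s\<in>topspace (top_of_set {a..b}). \<gamma> s \<in> K}"
    by (intro closed_subset) auto
qed

lemma pw_smooth_velocity:
  assumes "pw_smooth \<gamma> a b"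
  obtains S where "finite S" "\<And>t. t \<in> {a<..<b} - S \<Longrightarrow> \<exists>c v. has_velocity \<gamma> t c v"
proof -
  from assms have "\<exists>S. finite S \<and> (\<forall>t\<in>{a<..<b} - S. \<exists>c v. has_velocity \<gamma> t c v)"
  proof (induction rule: pw_smooth.induct)
    case (piece a b)
    then show ?case using smooth_piece_velocity by (intro exI[of _ "{}"]) blast
  next
    case (append a b c)
    then obtain S where S: "finite S" "\<forall>t\<in>{b<..<c} - S. \<exists>c v. has_velocity \<gamma> t c v" by blast
    have "\<exists>c v. has_velocity \<gamma> t c v" if "t \<in> {a<..<c} - insert b S" for t
    proof (cases "t < b")
      case True
      then have "t \<in> {a<..<b}" using that by auto
      then show ?thesis using smooth_piece_velocity[OF append.hyps(1)] by metis
    next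
      case False
      then show ?thesis using S(2) that by auto
    qed
    then show ?case using S(1) by (intro exI[of _ "insert b S"]) auto
  qed
  then show thesis using that by blast
qed

lemma pw_smooth_integrable:
  "pw_smooth \<gamma> a b \<Longrightarrow> speed \<A> g \<gamma> integrable_on {a..b}"
proof (induction rule: pw_smooth.induct)
  case (piece a b)
  then show ?case by (rule smooth_piece_integrable)
next
  case (append a b c)
  show ?case
    by (rule Henstock_Kurzweil_Integration.integrable_combine[of a b c])
      (use append smooth_piece_integrable smooth_piece_less pw_smooth_less in \<open>auto intro: less_imp_le\<close>)
qed

text \<open>Only finitely many times lack a velocity, so an identity at the remaining times
  determines the integral.\<close>

lemma pw_smooth_speed_integral:
  assumes "pw_smooth \<gamma> a b" "(f has_integral L) {a..b}"
    and "\<And>t c v. t \<in> {a<..<b} \<Longrightarrow> has_velocity \<gamma> t c v \<Longrightarrow> h t = f t"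
  shows "(h has_integral L) {a..b}"
proof -
  obtain S where S: "finite S" "\<And>t. t \<in> {a<..<b} - S \<Longrightarrow> \<exists>c v. has_velocity \<gamma> t c v"
    using pw_smooth_velocity[OF assms(1)] by blast
  show ?thesis
  proof (rule has_integral_spike_finite[OF _ _ assms(2)])
    show "finite (S \<union> {a, b})" using S by simp
    fix t assume "t \<in> {a..b} - (S \<union> {a, b})"
    then have t: "t \<in> {a<..<b} - S" by auto
    then show "h t = f t" using S(2)[OF t] assms(3)[of t] by blast
  qed
qed

section \<open>Lengths of connecting paths\<close>

text \<open>Length as a relation, with any parameter interval, so that joining and reversing paths
  need no rescaling to \<open>{0..1}\<close>.\<close>

definition connects :: "'a \<Rightarrow> 'a \<Rightarrow> real \<Rightarrow> bool" where
  "connects P Q L \<longleftrightarrow>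
     (\<exists>\<gamma> a b. pw_smooth \<gamma> a b \<and> \<gamma> a = P \<and> \<gamma> b = Q \<and> (speed \<A> g \<gamma> has_integral L) {a..b})"

lemma connects_on_interval:
  assumes "connects P Q L" "a' < b'"
  obtains \<gamma> where "pw_smooth \<gamma> a' b'" "\<gamma> a' = P" "\<gamma> b' = Q" "(speed \<A> g \<gamma> has_integral L) {a'..b'}"
proof -
  obtain \<gamma> a b where \<gamma>: "pw_smooth \<gamma> a b" "\<gamma> a = P" "\<gamma> b = Q" "(speed \<A> g \<gamma> has_integral L) {a..b}"
    using assms(1) by (auto simp: connects_def)
  \<comment> \<open>\<open>\<alpha>\<close> and \<open>\<beta>\<close> describe the increasing
    affine map that takes \<open>a'\<close> to \<open>a\<close> and \<open>b'\<close> to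
    \<open>b\<close>.\<close>
  define \<alpha> where "\<alpha> = (b - a) / (b' - a')"
  define \<beta> where "\<beta> = a - \<alpha> * a'"
  have ab: "a < b" by (rule pw_smooth_less[OF \<gamma>(1)])
  have \<alpha>: "\<alpha> > 0" using ab assms(2) by (simp add: \<alpha>_def)
  have "\<alpha> * (b' - a') = b - a" using assms(2) by (simp add: \<alpha>_def)
  then have ends: "\<alpha> * a' + \<beta> = a" "\<alpha> * b' + \<beta> = b" by (simp_all add: \<beta>_def algebra_simps)
  then have ends': "(a - \<beta>) / \<alpha> = a'" "(b - \<beta>) / \<alpha> = b'"
    using \<alpha> by (auto simp: field_simps)
  let ?\<gamma> = "\<lambda>s. \<gamma> (\<alpha> * s + \<beta>)"
  have pw: "pw_smooth ?\<gamma> a' b'"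
    using pw_smooth_affine_pos[OF \<gamma>(1) \<alpha>, of \<beta>] by (simp add: ends')
  have "((\<lambda>s. speed \<A> g \<gamma> (\<alpha> *\<^sub>R s + \<beta>)) has_integral (L /\<^sub>R \<alpha> ^ DIM(real))) (cbox ((a - \<beta>) /\<^sub>R \<alpha>) ((b - \<beta>) /\<^sub>R \<alpha>))"
    using has_integral_affinity'[of "speed \<A> g \<gamma>" L a b \<alpha> \<beta>] \<gamma>(4) \<alpha> by simp
  then have "((\<lambda>s. speed \<A> g \<gamma> (\<alpha> * s + \<beta>)) has_integral (L / \<alpha>)) {a'..b'}"
    using ends' by (simp add: divide_inverse mult.commute)
  from has_integral_mult_right[OF this, of \<alpha>]
  have int: "((\<lambda>s. \<alpha> * speed \<A> g \<gamma> (\<alpha> * s + \<beta>)) has_integral L) {a'..b'}"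
    using \<alpha> by simp
  obtain S where S: "finite S" "\<And>t. t \<in> {a<..<b} - S \<Longrightarrow> \<exists>c v. has_velocity \<gamma> t c v"
    using pw_smooth_velocity[OF \<gamma>(1)] by blast
  have "(speed \<A> g ?\<gamma> has_integral L) {a'..b'}"
  proof (rule has_integral_spike_finite[OF _ _ int])
    have "finite ((\<lambda>t. (t - \<beta>) / \<alpha>) ` S)" using S by simp
    then show "finite ((\<lambda>t. (t - \<beta>) / \<alpha>) ` S \<union> {a', b'})" by simp
    fix s assume s: "s \<in> {a'..b'} - ((\<lambda>t. (t - \<beta>) / \<alpha>) ` S \<union> {a', b'})"
    have "\<alpha> * s + \<beta> \<notin> S"
    proof
      assume "\<alpha> * s + \<beta> \<in> S"
      moreover have "s = ((\<alpha> * s + \<beta>) - \<beta>) / \<alpha>" using \<alpha> by simp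
      ultimately show False using s by blast
    qed
    moreover have "\<alpha> * s + \<beta> \<in> {a<..<b}" using s \<alpha> by (auto simp flip: ends)
    ultimately obtain c v where "has_velocity \<gamma> (\<alpha> * s + \<beta>) c v" using S(2) by blast
    then show "speed \<A> g ?\<gamma> s = \<alpha> * speed \<A> g \<gamma> (\<alpha> * s + \<beta>)"
      using affine_speed \<alpha> by simp
  qed
  then show thesis using that[OF pw] ends \<gamma> by simp
qed

lemma path_lengths_eq:
  "{path_length \<A> g \<gamma> |\<gamma>. piecewise_smooth_path X \<A> \<gamma> \<and> \<gamma> 0 = P \<and> \<gamma> 1 = Q} = {L. connects P Q L}"
proof (intro subset_antisym subsetI)
  fix L assume "L \<in> {path_length \<A> g \<gamma> |\<gamma>. piecewise_smooth_path X \<A> \<gamma> \<and> \<gamma> 0 = P \<and> \<gamma> 1 = Q}"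
  then obtain \<gamma> where \<gamma>: "L = path_length \<A> g \<gamma>" "pw_smooth \<gamma> 0 1" "\<gamma> 0 = P" "\<gamma> 1 = Q"
    by (auto simp: piecewise_smooth_path_iff)
  then have "(speed \<A> g \<gamma> has_integral L) {0..1}"
    using pw_smooth_integrable[of \<gamma> 0 1] by (simp add: path_length_def integrable_integral)
  then show "L \<in> {L. connects P Q L}" using \<gamma> by (auto simp: connects_def)
next
  fix L assume "L \<in> {L. connects P Q L}"
  then obtain \<gamma> where \<gamma>: "pw_smooth \<gamma> 0 1" "\<gamma> 0 = P" "\<gamma> 1 = Q" "(speed \<A> g \<gamma> has_integral L) {0..1}"
    using connects_on_interval[of P Q L 0 1] by auto
  then show "L \<in> {path_length \<A> g \<gamma> |\<gamma>. piecewise_smooth_path X \<A> \<gamma> \<and> \<gamma> 0 = P \<and> \<gamma> 1 = Q}"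
    using integral_unique[OF \<gamma>(4)] by (auto simp: piecewise_smooth_path_iff path_length_def)
qed

lemma connects_trans:
  assumes "connects P Q L" "connects Q S L'"
  shows "connects P S (L + L')"
proof -
  obtain \<gamma> where \<gamma>: "pw_smooth \<gamma> 0 1" "\<gamma> 0 = P" "\<gamma> 1 = Q" "(speed \<A> g \<gamma> has_integral L) {0..1}"
    using connects_on_interval[OF assms(1), of 0 1] by auto
  obtain \<delta> where \<delta>: "pw_smooth \<delta> 1 2" "\<delta> 1 = Q" "\<delta> 2 = S" "(speed \<A> g \<delta> has_integral L') {1..2}"
    using connects_on_interval[OF assms(2), of 1 2] by auto
  define \<eta> where "\<eta> s = (if s \<le> 1 then \<gamma> s else \<delta> s)" for s
  have eq: "\<gamma> s = \<eta> s" if "s \<in> {0..1}" for s using that by (simp add: \<eta>_def)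
  \<comment> \<open>At the joint \<open>s = 1\<close> the value of \<open>\<eta>\<close> comes from
    \<open>\<gamma>\<close>; both paths are at \<open>Q\<close> there.\<close>
  have eq': "\<delta> s = \<eta> s" if "s \<in> {1..2}" for s
    using that \<gamma>(3) \<delta>(2) by (cases "s = 1") (auto simp: \<eta>_def)
  have "(speed \<A> g \<eta> has_integral L) {0..1}"
    by (rule pw_smooth_speed_integral[OF \<gamma>(1,4)], rule speed_cong[symmetric, where I = "{0<..<1}"])
      (auto simp: eq)
  moreover have "(speed \<A> g \<eta> has_integral L') {1..2}"
    by (rule pw_smooth_speed_integral[OF \<delta>(1,4)], rule speed_cong[symmetric, where I = "{1<..<2}"])
      (auto simp: eq')
  ultimately have "(speed \<A> g \<eta> has_integral (L + L')) {0..2}"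
    by (rule has_integral_combine[rotated 2]) auto
  moreover have "pw_smooth \<eta> 0 2"
    using pw_smooth_trans pw_smooth_cong[OF \<gamma>(1) eq] pw_smooth_cong[OF \<delta>(1) eq'] by blast
  moreover have "\<eta> 0 = P" "\<eta> 2 = S" using \<gamma> \<delta> by (auto simp: \<eta>_def)
  ultimately show ?thesis unfolding connects_def by blast
qed

lemma connects_sym:
  assumes "connects P Q L"
  shows "connects Q P L"
proof -
  obtain \<gamma> a b where \<gamma>: "pw_smooth \<gamma> a b" "\<gamma> a = P" "\<gamma> b = Q" "(speed \<A> g \<gamma> has_integral L) {a..b}"
    using assms(1) by (auto simp: connects_def)
  have pw: "pw_smooth (\<lambda>s. \<gamma> (- s)) (- b) (- a)" by (rule pw_smooth_reverse[OF \<gamma>(1)])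
  obtain S where S: "finite S" "\<And>t. t \<in> {a<..<b} - S \<Longrightarrow> \<exists>c v. has_velocity \<gamma> t c v"
    using pw_smooth_velocity[OF \<gamma>(1)] by blast
  have int: "((\<lambda>s. speed \<A> g \<gamma> (- s)) has_integral L) {- b..- a}"
    using \<gamma>(4) by (simp add: has_integral_reflect_real pw_smooth_less[OF \<gamma>(1)] less_imp_le)
  have "(speed \<A> g (\<lambda>s. \<gamma> (- s)) has_integral L) {- b..- a}"
  proof (rule has_integral_spike_finite[OF _ _ int])
    show "finite (uminus ` S \<union> {- a, - b})" using S by simp
    fix s assume s: "s \<in> {- b..- a} - (uminus ` S \<union> {- a, - b})"
    then have "- s \<notin> S" by (metis DiffD2 UnCI image_eqI minus_minus)
    moreover have "- s \<in> {a<..<b}" using s by auto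
    ultimately obtain c v where "has_velocity \<gamma> (- s) c v" using S(2) by blast
    then show "speed \<A> g (\<lambda>s. \<gamma> (- s)) s = speed \<A> g \<gamma> (- s)"
      using affine_speed[of \<gamma> "-1" s 0] by simp
  qed
  then show ?thesis using pw \<gamma> unfolding connects_def by fastforce
qed

lemma connects_homothety:
  assumes "homothety_with_factor X \<A> g \<Phi> r" "connects P Q L"
  shows "connects (\<Phi> P) (\<Phi> Q) (r * L)"
proof -
  obtain \<gamma> a b where \<gamma>: "pw_smooth \<gamma> a b" "\<gamma> a = P" "\<gamma> b = Q" "(speed \<A> g \<gamma> has_integral L) {a..b}"
    using assms(2) by (auto simp: connects_def)
  have "smooth_piece (\<Phi> \<circ> \<gamma>) a b" if piece: "smooth_piece \<gamma> a b" for a b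
  proof -
    obtain J \<delta> where J: "open J" "{a..b} \<subseteq> J" "smooth_path_on X \<A> J \<delta>" "\<forall>s\<in>{a..b}. \<gamma> s = \<delta> s"
      using piece by (auto simp: smooth_piece_def)
    then show ?thesis
      using piece homothety_smooth_path[OF assms(1) J(1,3)] unfolding smooth_piece_def
      by (intro conjI exI[of _ J] exI[of _ "\<Phi> \<circ> \<delta>"]) auto
  qed
  with \<gamma>(1) have "pw_smooth (\<Phi> \<circ> \<gamma>) a b"
    by (induction rule: pw_smooth.induct) (auto intro: pw_smooth.intros)
  moreover have "(speed \<A> g (\<Phi> \<circ> \<gamma>) has_integral (r * L)) {a..b}"
    by (rule pw_smooth_speed_integral[OF \<gamma>(1) has_integral_mult_right[OF \<gamma>(4)] homothety_speed[OF assms(1)]])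
  ultimately show ?thesis
    unfolding connects_def using \<gamma>(2,3) by (intro exI[of _ "\<Phi> \<circ> \<gamma>"] exI[of _ a] exI[of _ b]) auto
qed

text \<open>The intermediate value theorem along the path. Strict inequalities put the crossing time
  in the interior, so both parts live on nondegenerate intervals, as \<open>pw_smooth\<close>
  demands.\<close>

lemma connects_split:
  assumes "connects P Q L" "continuous_map X euclideanreal f" "f P < y" "y < f Q"
  obtains S L1 L2 where "S \<in> topspace X" "f S = y" "connects P S L1" "connects S Q L2" "L = L1 + L2"
proof -
  obtain \<gamma> a b where \<gamma>: "pw_smooth \<gamma> a b" "\<gamma> a = P" "\<gamma> b = Q" "(speed \<A> g \<gamma> has_integral L) {a..b}"
    using assms(1) by (auto simp: connects_def)
  have "continuous_map (top_of_set {a..b}) euclideanreal (f \<circ> \<gamma>)"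
    by (rule continuous_map_compose[OF pw_smooth_continuous[OF \<gamma>(1)] assms(2)])
  then have "continuous_on {a..b} (f \<circ> \<gamma>)" by simp
  moreover have "(f \<circ> \<gamma>) a \<le> y" "y \<le> (f \<circ> \<gamma>) b" using assms \<gamma> by auto
  ultimately obtain s where s: "a \<le> s" "s \<le> b" "f (\<gamma> s) = y"
    using IVT'[of "f \<circ> \<gamma>" a y b] pw_smooth_less[OF \<gamma>(1)] by auto
  then have "a < s" "s < b" using assms(3,4) \<gamma> by (metis order_le_less order_less_irrefl)+
  then have pw: "pw_smooth \<gamma> a s" "pw_smooth \<gamma> s b" using pw_smooth_split[OF \<gamma>(1)] by auto
  note int = pw[THEN pw_smooth_integrable, THEN integrable_integral]
  have "connects P (\<gamma> s) (integral {a..s} (speed \<A> g \<gamma>))" "connects (\<gamma> s) Q (integral {s..b} (speed \<A> g \<gamma>))"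
    using pw int \<gamma> unfolding connects_def by blast+
  moreover have "L = integral {a..s} (speed \<A> g \<gamma>) + integral {s..b} (speed \<A> g \<gamma>)"
    using has_integral_combine[OF s(1,2) int] \<gamma>(4) has_integral_unique by blast
  moreover have "\<gamma> s \<in> topspace X"
    using pw_smooth_closed[OF \<gamma>(1) closedin_empty] s by auto
  ultimately show thesis using that s by blast
qed

text \<open>The case \<open>u = 0\<close> supplies the constant path of length \<open>0\<close>,
  which joins a point to itself over a nondegenerate interval.\<close>

lemma chart_segment_connects:
  assumes "c \<in> \<A>" "\<And>s. s \<in> {0..1} \<Longrightarrow> x + s *\<^sub>R u \<in> snd c ` fst c"
  obtains L where "connects (chart_inv c x) (chart_inv c (x + u)) L" "u = 0 \<Longrightarrow> L = 0"
proof -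
  let ?\<gamma> = "\<lambda>s. chart_inv c (x + s *\<^sub>R u)"
  have "smooth_piece ?\<gamma> 0 1"
    unfolding smooth_piece_def
  proof (intro conjI exI)
    show "{0..1} \<subseteq> (\<lambda>s. x + s *\<^sub>R u) -` (snd c ` fst c)" using assms(2) by auto
  qed (use chart_segment_smooth_path[OF assms(1), of x u] in auto)
  then have pw: "pw_smooth ?\<gamma> 0 1" by (rule pw_smooth.piece)
  have int: "(speed \<A> g ?\<gamma> has_integral integral {0..1} (speed \<A> g ?\<gamma>)) {0..1}"
    using pw_smooth_integrable[OF pw] by (rule integrable_integral)
  then have "connects (chart_inv c x) (chart_inv c (x + u)) (integral {0..1} (speed \<A> g ?\<gamma>))"
    unfolding connects_def using pw by (intro exI[of _ ?\<gamma>] exI[of _ 0] exI[of _ 1]) auto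
  moreover have "integral {0..1} (speed \<A> g ?\<gamma>) = 0" if "u = 0"
  proof -
    have "chart_inv c x \<in> fst c" using assms(2)[of 0] by (auto intro: inv_into_into)
    then have "has_velocity ?\<gamma> t c 0" for t
      using assms(1) that unfolding has_velocity_def by (auto intro!: exI[of _ UNIV] simp: o_def)
    from speed_eq[OF this] have "speed \<A> g ?\<gamma> = (\<lambda>t. 0)" by (auto simp: fun_eq_iff)
    then show ?thesis by simp
  qed
  ultimately show thesis using that by blast
qed

lemma connects_refl:
  assumes "P \<in> topspace X"
  shows "connects P P 0"
proof -
  obtain c where c: "c \<in> \<A>" "P \<in> fst c" using chart_at[OF assms] .
  then obtain L where "connects P P L" "L = 0"
    using chart_segment_connects[of c "snd c P" 0] by auto
  then show ?thesis by simp
qed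

text \<open>Each point can be joined to all points of a coordinate ball around it, so the set of
  points reachable from \<open>P\<close> and its complement are both open. This keeps the infimum in
  the distance from being taken over the empty set.\<close>

lemma connects_exists:
  assumes "connected_space X" "P \<in> topspace X" "Q \<in> topspace X"
  obtains L where "connects P Q L"
proof -
  have near: "\<exists>T. openin X T \<and> P \<in> T \<and> (\<forall>Q\<in>T. \<exists>L. connects P Q L)" if P: "P \<in> topspace X" for P
  proof -
    obtain c where c: "c \<in> \<A>" "P \<in> fst c" using chart_at[OF P] .
    then obtain e where e: "e > 0" "ball (snd c P) e \<subseteq> snd c ` fst c"
      using chart_open[OF c(1)] open_contains_ball by blast
    let ?T = "{Q\<in>fst c. snd c Q \<in> ball (snd c P) e}"
    have "\<exists>L. connects P Q L" if Q: "Q \<in> ?T" for Q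
    proof -
      have "snd c P + s *\<^sub>R (snd c Q - snd c P) \<in> snd c ` fst c" if s: "s \<in> {0..1}" for s
      proof -
        have "(1 - s) *\<^sub>R snd c P + s *\<^sub>R snd c Q \<in> ball (snd c P) e"
          using s Q e by (intro convexD_alt[OF convex_ball]) auto
        moreover have "(1 - s) *\<^sub>R snd c P + s *\<^sub>R snd c Q = snd c P + s *\<^sub>R (snd c Q - snd c P)"
          by (simp add: algebra_simps)
        ultimately show ?thesis using e by auto
      qed
      then obtain L where "connects (chart_inv c (snd c P)) (chart_inv c (snd c P + (snd c Q - snd c P))) L"
        using chart_segment_connects[OF c(1), of "snd c P" "snd c Q - snd c P"] by blast
      moreover have "chart_inv c (snd c Q) = Q" "chart_inv c (snd c P) = P" using c Q by auto
      ultimately show ?thesis by auto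
    qed
    moreover have "openin X ?T" by (rule chart_vimage[OF c(1)]) simp
    ultimately show ?thesis using c e by (intro exI[of _ ?T]) auto
  qed
  let ?Z = "{S\<in>topspace X. \<exists>L. connects P S L}"
  have "openin X ?Z"
    unfolding openin_subopen[of X ?Z]
  proof
    fix S assume S: "S \<in> ?Z"
    then obtain T where "openin X T" "S \<in> T" "\<forall>Q\<in>T. \<exists>L. connects S Q L" using near by blast
    then show "\<exists>T. openin X T \<and> S \<in> T \<and> T \<subseteq> ?Z"
      using S connects_trans openin_subset by (intro exI[of _ T]) blast
  qed
  moreover have "openin X (topspace X - ?Z)"
    unfolding openin_subopen[of X "topspace X - ?Z"]
  proof
    fix S assume S: "S \<in> topspace X - ?Z"
    then obtain T where T: "openin X T" "S \<in> T" "\<forall>Q\<in>T. \<exists>L. connects S Q L" using near by blast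
    have "\<not> connects P Q L" if "Q \<in> T" for Q L
    proof
      assume "connects P Q L"
      moreover obtain L' where "connects S Q L'" using T(3) \<open>Q \<in> T\<close> by blast
      then have "connects Q S L'" by (rule connects_sym)
      ultimately show False using S connects_trans by blast
    qed
    then show "\<exists>U. openin X U \<and> S \<in> U \<and> U \<subseteq> topspace X - ?Z"
      using T openin_subset by (intro exI[of _ T]) blast
  qed
  ultimately have "?Z = {} \<or> ?Z = topspace X"
    using assms(1)[unfolded connected_space_clopen_in, rule_format, of ?Z]
    unfolding closedin_def by blast
  then show thesis using connects_refl[OF assms(2)] assms that by blast
qed

end

section \<open>The Riemannian distance\<close>

locale riemannian_mfd = metric_mfd X \<A> g
  for X :: "'a topology" and \<A> :: "('a, real^'n::finite) chart set" and g +
  assumes riem: "riemannian \<A> g" and conn: "connected_space X"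
begin

section \<open>Length compared with coordinate distance\<close>

lemma quadratic_form_nonneg: "c \<in> \<A> \<Longrightarrow> P \<in> fst c \<Longrightarrow> v \<bullet> (g c P *v v) \<ge> 0"
  using riem unfolding riemannian_def by (cases "v = 0") (auto intro: less_imp_le)

lemma speed_nonneg:
  assumes "\<gamma> t \<in> topspace X"
  shows "speed \<A> g \<gamma> t \<ge> 0"
proof -
  have "\<exists>c. c \<in> \<A> \<and> \<gamma> t \<in> fst c" using chart_at[OF assms] by blast
  from someI_ex[OF this] show ?thesis
    by (simp add: speed_def Let_def quadratic_form_nonneg)
qed

lemma pw_smooth_in_space: "pw_smooth \<gamma> a b \<Longrightarrow> t \<in> {a..b} \<Longrightarrow> \<gamma> t \<in> topspace X"
  using pw_smooth_closed[OF _ closedin_empty] by blast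

lemma connects_nonneg: "connects P Q L \<Longrightarrow> L \<ge> 0"
  unfolding connects_def
  using has_integral_nonneg speed_nonneg pw_smooth_in_space by blast

lemma connects_in_space: "connects P Q L \<Longrightarrow> P \<in> topspace X \<and> Q \<in> topspace X"
  unfolding connects_def using pw_smooth_in_space pw_smooth_less
  by (metis atLeastAtMost_iff less_imp_le order_refl)

text \<open>The quadratic form attains a positive minimum over points of the closed ball and unit
  vectors, a compact set. By homogeneity \<open>m\<close> is the square root of this
  minimum.\<close>

lemma metric_lower_bound:
  assumes "c \<in> \<A>" "cball x0 e \<subseteq> snd c ` fst c" "e > 0"
  obtains m where "m > 0" "\<And>x v. x \<in> cball x0 e \<Longrightarrow> m * norm v \<le> sqrt (v \<bullet> (g c (chart_inv c x) *v v))"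
proof -
  interpret metric_coordinates "snd c ` fst c" "g c \<circ> chart_inv c"
    by (rule metric_coordinates_chart[OF assms(1)])
  define h where "h = (\<lambda>(x, v). v \<bullet> (g c (chart_inv c x) *v v))"
  let ?K = "cball x0 e \<times> sphere (0::real^'n) 1"
  have "continuous_on (cball x0 e) (g c \<circ> chart_inv c)"
    using smooth_on_continuous[OF smooth_G] assms(2) by (rule continuous_on_subset)
  then have "continuous_on ?K (\<lambda>p. (g c \<circ> chart_inv c) (fst p))"
    by (rule continuous_on_compose2) (auto intro!: continuous_intros)
  then have "continuous_on ?K (\<lambda>p. snd p \<bullet> ((g c \<circ> chart_inv c) (fst p) *v snd p))"
    unfolding matrix_vector_mult_def by (intro continuous_intros continuous_on_vec_lambda)
  then have cont: "continuous_on ?K h" by (simp add: h_def case_prod_unfold)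
  have "(x0, axis undefined 1) \<in> ?K" using assms(3) by simp
  then have "?K \<noteq> {}" by blast
  moreover have "compact ?K" by (intro compact_Times compact_cball compact_sphere)
  ultimately obtain p where p: "p \<in> ?K" "\<And>q. q \<in> ?K \<Longrightarrow> h p \<le> h q"
    using continuous_attains_inf[OF _ _ cont] by blast
  obtain x1 v1 where p_eq: "p = (x1, v1)" by (cases p)
  have "chart_inv c x1 \<in> fst c" "v1 \<noteq> 0"
    using p(1) assms(2) p_eq by (auto intro!: inv_into_into)
  then have "h p > 0" using riem assms(1) by (auto simp: h_def p_eq riemannian_def)
  moreover have "sqrt (h p) * norm v \<le> sqrt (v \<bullet> (g c (chart_inv c x) *v v))"
    if x: "x \<in> cball x0 e" for x v
  proof (cases "v = 0")
    case False
    let ?u = "v /\<^sub>R norm v"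
    have "h p \<le> h (x, ?u)" using p(2)[of "(x, ?u)"] x False by auto
    also have "h (x, ?u) = (v \<bullet> (g c (chart_inv c x) *v v)) / (norm v)\<^sup>2"
      by (simp add: h_def matrix_vector_mult_scaleR power2_eq_square divide_inverse mult_ac)
    finally have "h p * (norm v)\<^sup>2 \<le> v \<bullet> (g c (chart_inv c x) *v v)"
      using False by (simp add: field_simps)
    then have "sqrt (h p * (norm v)\<^sup>2) \<le> sqrt (v \<bullet> (g c (chart_inv c x) *v v))"
      by (rule real_sqrt_le_mono)
    then show ?thesis by (simp add: real_sqrt_mult)
  qed simp
  ultimately show thesis using that[of "sqrt (h p)"] by simp
qed

text \<open>The image of a compact ball is compact, hence closed in a Hausdorff space. Thus a path
  leaving the ball is still in the chart when it reaches the bounding sphere.\<close>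

lemma chart_cball_closedin:
  assumes "c \<in> \<A>" "cball x0 e \<subseteq> snd c ` fst c"
  shows "closedin X {Q\<in>fst c. snd c Q \<in> cball x0 e}"
proof -
  have eq: "{Q\<in>fst c. snd c Q \<in> cball x0 e} = chart_inv c ` cball x0 e"
  proof (intro subset_antisym subsetI)
    fix Q assume "Q \<in> chart_inv c ` cball x0 e"
    then obtain x where x: "x \<in> cball x0 e" "Q = chart_inv c x" by blast
    then have "x \<in> snd c ` fst c" using assms(2) by blast
    then show "Q \<in> {Q\<in>fst c. snd c Q \<in> cball x0 e}"
      using x by (auto simp: f_inv_into_f intro: inv_into_into)
  qed (use assms(1) in \<open>auto simp: image_iff\<close>, metis assms(1) chart_inv_left mem_cball)
  have "continuous_map (top_of_set (cball x0 e)) X (chart_inv c)"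
    unfolding continuous_map_def
  proof (intro conjI allI impI)
    show "chart_inv c \<in> topspace (top_of_set (cball x0 e)) \<rightarrow> topspace X"
    proof
      fix x assume "x \<in> topspace (top_of_set (cball x0 e))"
      then have "x \<in> snd c ` fst c" using assms(2) by auto
      then show "chart_inv c x \<in> topspace X"
        by (intro chart_subset[OF assms(1)] inv_into_into)
    qed
    fix V assume V: "openin X V"
    have "open (snd c ` (V \<inter> fst c))"
      using openin_Int[OF V chart_openin[OF assms(1)]] by (intro chart_image[OF assms(1)]) auto
    moreover have "{x\<in>topspace (top_of_set (cball x0 e)). chart_inv c x \<in> V} = cball x0 e \<inter> snd c ` (V \<inter> fst c)"
    proof (intro subset_antisym subsetI)
      fix x assume x: "x \<in> {x\<in>topspace (top_of_set (cball x0 e)). chart_inv c x \<in> V}"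
      then have "x \<in> snd c ` fst c" using assms(2) by auto
      then have "chart_inv c x \<in> fst c" "snd c (chart_inv c x) = x"
        by (auto simp: f_inv_into_f intro: inv_into_into)
      then show "x \<in> cball x0 e \<inter> snd c ` (V \<inter> fst c)"
        using x by (auto intro!: image_eqI[of _ _ "chart_inv c x"])
    qed (use assms(1) in auto)
    ultimately show "openin (top_of_set (cball x0 e)) {x\<in>topspace (top_of_set (cball x0 e)). chart_inv c x \<in> V}"
      by (simp add: openin_open_Int)
  qed
  then have "compactin X (chart_inv c ` cball x0 e)"
    by (rule image_compactin[rotated]) (simp add: compactin_subtopology)
  moreover have "Hausdorff_space X" using mfd by (simp add: smooth_manifold_def)
  ultimately show ?thesis unfolding eq by (rule compactin_imp_closedin[rotated])
qed

text \<open>Until its first exit the path stays in the closed ball, where its speed is at least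
  \<open>m\<close> times the norm of the coordinate velocity, and the coordinates are displaced by
  \<open>e\<close> in total.\<close>

lemma chart_ball_escape:
  assumes "c \<in> \<A>" "P \<in> fst c" "cball (snd c P) e \<subseteq> snd c ` fst c" "e > 0"
  obtains m where "m > 0"
    "\<And>Q L. connects P Q L \<Longrightarrow> \<not> (Q \<in> fst c \<and> snd c Q \<in> ball (snd c P) e) \<Longrightarrow> m * e \<le> L"
proof -
  let ?x0 = "snd c P"
  obtain m where m: "m > 0"
    "\<And>x v. x \<in> cball ?x0 e \<Longrightarrow> m * norm v \<le> sqrt (v \<bullet> (g c (chart_inv c x) *v v))"
    using metric_lower_bound[OF assms(1,3,4)] by blast
  have "m * e \<le> L" if PQ: "connects P Q L" and esc: "\<not> (Q \<in> fst c \<and> snd c Q \<in> ball ?x0 e)" for Q L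
  proof -
    obtain \<gamma> a b where \<gamma>: "pw_smooth \<gamma> a b" "\<gamma> a = P" "\<gamma> b = Q" "(speed \<A> g \<gamma> has_integral L) {a..b}"
      using PQ by (auto simp: connects_def)
    have ab: "a < b" by (rule pw_smooth_less[OF \<gamma>(1)])
    let ?B = "{Q\<in>fst c. snd c Q \<in> ball ?x0 e}" and ?K = "{Q\<in>fst c. snd c Q \<in> cball ?x0 e}"
    \<comment> \<open>The times spent outside the open ball; the least of them is the first exit
      time \<open>s\<close>.\<close>
    define Z where "Z = {t\<in>{a..b}. \<gamma> t \<in> topspace X - ?B}"
    have "closedin X (topspace X - ?B)"
      using chart_vimage[OF assms(1), of "ball ?x0 e"] by blast
    then have clZ: "closed Z" unfolding Z_def using pw_smooth_closed[OF \<gamma>(1)] by blast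
    have bZ: "b \<in> Z" using esc \<gamma> ab pw_smooth_in_space[OF \<gamma>(1), of b] by (auto simp: Z_def)
    have bdd: "bdd_below Z" by (rule bdd_belowI[of _ a]) (auto simp: Z_def)
    define s where "s = Inf Z"
    have sZ: "s \<in> Z" unfolding s_def using closed_contains_Inf[OF _ bdd clZ] bZ by blast
    have "\<gamma> a \<in> ?B" using assms \<gamma>(2) by simp
    then have "a \<notin> Z" by (simp add: Z_def)
    with sZ have s: "a < s" "s \<le> b" by (auto simp: Z_def order_le_less)
    have before: "\<gamma> t \<in> ?B" if t: "a \<le> t" "t < s" for t
    proof (rule ccontr)
      assume "\<gamma> t \<notin> ?B"
      then have "t \<in> Z" using t s pw_smooth_in_space[OF \<gamma>(1), of t] by (auto simp: Z_def)
      then show False using cInf_lower[OF _ bdd, of t] t by (simp add: s_def)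
    qed
    have pw: "pw_smooth \<gamma> a s"
      using pw_smooth_split[OF \<gamma>(1), of s] s \<gamma>(1) by (cases "s = b") auto
    \<comment> \<open>Before \<open>s\<close> the path is in the open ball; closedness extends
      membership in the closed ball to the exit time itself.\<close>
    have "closed {t\<in>{a..s}. \<gamma> t \<in> ?K}"
      using pw_smooth_closed[OF pw chart_cball_closedin[OF assms(1,3)]] by blast
    moreover have "{a..<s} \<subseteq> {t\<in>{a..s}. \<gamma> t \<in> ?K}" using before by fastforce
    ultimately have "closure {a..<s} \<subseteq> {t\<in>{a..s}. \<gamma> t \<in> ?K}" by (rule closure_minimal[rotated])
    then have inK: "\<gamma> t \<in> ?K" if "t \<in> {a..s}" for t
      using that s(1) by (auto simp: closure_atLeastLessThan)
    have "dist ?x0 (snd c (\<gamma> s)) = e"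
      using inK[of s] sZ s by (auto simp: Z_def)
    define w where "w = snd c \<circ> \<gamma>"
    have "continuous_map (top_of_set {a..s}) euclidean w"
      unfolding continuous_map_def
    proof (intro conjI allI impI)
      fix V :: "(real^'n) set" assume "openin euclidean V"
      then have "openin X {Q\<in>fst c. snd c Q \<in> V}" by (intro chart_vimage[OF assms(1)]) simp
      then have "openin (top_of_set {a..s}) {t\<in>topspace (top_of_set {a..s}). \<gamma> t \<in> {Q\<in>fst c. snd c Q \<in> V}}"
        using pw_smooth_continuous[OF pw] unfolding continuous_map_def by blast
      moreover have "{t\<in>topspace (top_of_set {a..s}). \<gamma> t \<in> {Q\<in>fst c. snd c Q \<in> V}} =
          {t\<in>topspace (top_of_set {a..s}). w t \<in> V}"
        using inK by (auto simp: w_def)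
      ultimately show "openin (top_of_set {a..s}) {t\<in>topspace (top_of_set {a..s}). w t \<in> V}" by simp
    qed simp
    then have contw: "continuous_on {a..s} w" by simp
    obtain S where S: "finite S" "\<And>t. t \<in> {a<..<s} - S \<Longrightarrow> \<exists>c v. has_velocity \<gamma> t c v"
      using pw_smooth_velocity[OF pw] by blast
    \<comment> \<open>The coordinate velocity, set to \<open>0\<close> at the exceptional times so
      that the norm estimate holds at every \<open>t\<close>.\<close>
    define v where "v t = (if t \<in> S \<union> {a, s} then 0 else vector_derivative w (at t))" for t
    have vel: "has_velocity \<gamma> t c (v t)" if t: "t \<in> {a<..<s} - S" for t
    proof -
      obtain d u where "has_velocity \<gamma> t d u" using S(2)[OF t] by blast
      moreover have "\<gamma> t \<in> fst c" using inK[of t] t by auto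
      ultimately obtain u' where "has_velocity \<gamma> t c u'"
        using has_velocity_change_chart assms(1) by blast
      moreover from this have "v t = u'"
        using t by (auto simp: v_def has_velocity_def w_def intro!: vector_derivative_at)
      ultimately show ?thesis by simp
    qed
    have int_v: "(v has_integral (w s - w a)) {a..s}"
    proof (rule fundamental_theorem_of_calculus_interior_strong[OF S(1)])
      show "(w has_vector_derivative v t) (at t)" if "t \<in> {a<..<s} - S" for t
        using vel[OF that] by (simp add: has_velocity_def w_def)
    qed (use s contw in auto)
    note int_speed = pw_smooth_integrable[OF pw]
    have "norm (integral {a..s} v) \<le> integral {a..s} (\<lambda>t. speed \<A> g \<gamma> t / m)"
    proof (rule integral_norm_bound_integral)
      show "v integrable_on {a..s}" using int_v by blast
      show "(\<lambda>t. speed \<A> g \<gamma> t / m) integrable_on {a..s}"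
        by (rule integrable_on_divide[OF int_speed])
      fix t assume t: "t \<in> {a..s}"
      show "norm (v t) \<le> speed \<A> g \<gamma> t / m"
      proof (cases "t \<in> S \<union> {a, s}")
        case True
        then show ?thesis
          using m(1) speed_nonneg[of \<gamma> t] pw_smooth_in_space[OF pw t] by (auto simp: v_def)
      next
        case False
        then have t': "t \<in> {a<..<s} - S" using t by auto
        have "\<gamma> t \<in> fst c" "snd c (\<gamma> t) \<in> cball ?x0 e" using inK[OF t] by auto
        then have "m * norm (v t) \<le> speed \<A> g \<gamma> t"
          using m(2)[of "snd c (\<gamma> t)" "v t"] speed_eq[OF vel[OF t']] assms(1) by simp
        then show ?thesis using m(1) by (simp add: field_simps)
      qed
    qed
    also have "\<dots> = integral {a..s} (speed \<A> g \<gamma>) / m" by simp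
    also have "norm (integral {a..s} v) = e"
      using integral_unique[OF int_v] \<open>dist ?x0 (snd c (\<gamma> s)) = e\<close> \<gamma>(2)
      by (simp add: w_def dist_norm norm_minus_commute)
    finally have "m * e \<le> integral {a..s} (speed \<A> g \<gamma>)"
      using m(1) by (simp add: field_simps)
    also have "\<dots> \<le> integral {a..b} (speed \<A> g \<gamma>)"
      using s pw_smooth_in_space[OF \<gamma>(1)] speed_nonneg
      by (intro integral_subset_le int_speed pw_smooth_integrable[OF \<gamma>(1)]) auto
    also have "\<dots> = L" using \<gamma>(4) by (rule integral_unique)
    finally show ?thesis .
  qed
  with m(1) show thesis using that by blast
qed

section \<open>The distance function\<close>

abbreviation "d \<equiv> riemannian_dist X \<A> g"

lemma dist_eq: "P \<in> topspace X \<Longrightarrow> Q \<in> topspace X \<Longrightarrow> d P Q = Inf {L. connects P Q L}"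
  unfolding riemannian_dist_def path_lengths_eq by simp

lemma connects_bdd_below: "bdd_below {L. connects P Q L}"
  using connects_nonneg by (intro bdd_belowI[of _ 0]) auto

lemma dist_le: "connects P Q L \<Longrightarrow> d P Q \<le> L"
  using dist_eq connects_in_space cInf_lower[OF _ connects_bdd_below] by simp

lemma dist_ge:
  assumes "P \<in> topspace X" "Q \<in> topspace X" "\<And>L. connects P Q L \<Longrightarrow> b \<le> L"
  shows "b \<le> d P Q"
  unfolding dist_eq[OF assms(1,2)]
  using assms(3) connects_exists[OF conn assms(1,2)] by (intro cInf_greatest) auto

lemma dist_approx:
  assumes "P \<in> topspace X" "Q \<in> topspace X" "d P Q < b"
  obtains L where "connects P Q L" "L < b"
  using dist_ge[OF assms(1,2), of b] assms(3) by fastforce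

lemma dist_nonneg: "d P Q \<ge> 0"
  using dist_ge connects_nonneg by (cases "P \<in> topspace X \<and> Q \<in> topspace X")
    (auto simp: riemannian_dist_def)

lemma dist_commute: "d P Q = d Q P"
proof -
  have "{L. connects P Q L} = {L. connects Q P L}" using connects_sym by blast
  then show ?thesis
    using dist_eq by (cases "P \<in> topspace X \<and> Q \<in> topspace X") (auto simp: riemannian_dist_def)
qed

lemma dist_triangle:
  assumes "P \<in> topspace X" "Q \<in> topspace X" "S \<in> topspace X"
  shows "d P S \<le> d P Q + d Q S"
proof (rule field_le_epsilon)
  fix e :: real assume "e > 0"
  obtain L where L: "connects P Q L" "L < d P Q + e / 2"
    using dist_approx[OF assms(1,2), of "d P Q + e / 2"] \<open>e > 0\<close> by auto
  obtain L' where L': "connects Q S L'" "L' < d Q S + e / 2"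
    using dist_approx[OF assms(2,3), of "d Q S + e / 2"] \<open>e > 0\<close> by auto
  have "d P S \<le> L + L'" by (rule dist_le[OF connects_trans[OF L(1) L'(1)]])
  then show "d P S \<le> d P Q + d Q S + e" using L(2) L'(2) by simp
qed

text \<open>A closed coordinate ball inside \<open>V\<close> has to be left on the way to
  \<open>Q\<close>. Both the separation of points and the positivity of \<open>D 1 2\<close> come
  from this bound.\<close>

lemma dist_pos_outside:
  assumes "P \<in> topspace X" "openin X V" "P \<in> V"
  obtains b where "b > 0" "\<And>Q. Q \<in> topspace X - V \<Longrightarrow> b \<le> d P Q"
proof -
  obtain c where c: "c \<in> \<A>" "P \<in> fst c" using chart_at[OF assms(1)] .
  have "open (snd c ` (V \<inter> fst c))"
    using openin_Int[OF assms(2) chart_openin[OF c(1)]] by (intro chart_image[OF c(1)]) auto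
  moreover have "snd c P \<in> snd c ` (V \<inter> fst c)" using c assms(3) by auto
  ultimately obtain e where e: "e > 0" "cball (snd c P) e \<subseteq> snd c ` (V \<inter> fst c)"
    using open_contains_cball by blast
  then have "cball (snd c P) e \<subseteq> snd c ` fst c" by blast
  then obtain m where m: "m > 0"
    "\<And>Q L. connects P Q L \<Longrightarrow> \<not> (Q \<in> fst c \<and> snd c Q \<in> ball (snd c P) e) \<Longrightarrow> m * e \<le> L"
    using chart_ball_escape[OF c _ e(1)] by blast
  have "m * e \<le> d P Q" if Q: "Q \<in> topspace X - V" for Q
  proof (rule dist_ge[OF assms(1)])
    fix L assume "connects P Q L"
    moreover have "\<not> (Q \<in> fst c \<and> snd c Q \<in> ball (snd c P) e)"
    proof
      assume *: "Q \<in> fst c \<and> snd c Q \<in> ball (snd c P) e"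
      then have "snd c Q \<in> snd c ` (V \<inter> fst c)" using e(2) by auto
      then show False using * Q chart_inj[OF c(1)] by (auto dest: inj_onD)
    qed
    ultimately show "m * e \<le> L" by (rule m(2))
  qed (use Q in auto)
  then show thesis using that[of "m * e"] m(1) e(1) by simp
qed

lemma dist_self: "P \<in> topspace X \<Longrightarrow> d P P = 0"
  using dist_le[OF connects_refl, of P] dist_nonneg[of P P] by simp

text \<open>Symmetry and triangle inequality reflect reversing and joining paths; the Hausdorff
  property is used to separate distinct points.\<close>

sublocale Metric_space "topspace X" d
proof
  show "d P Q = 0 \<longleftrightarrow> P = Q" if PQ: "P \<in> topspace X" "Q \<in> topspace X" for P Q
  proof
    assume 0: "d P Q = 0"
    show "P = Q"
    proof (rule ccontr)
      assume "P \<noteq> Q"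
      moreover have "Hausdorff_space X" using mfd by (simp add: smooth_manifold_def)
      ultimately obtain U V where "openin X U" "P \<in> U" "Q \<notin> U"
        using PQ unfolding Hausdorff_space_def disjnt_def by blast
      then obtain b where "b > 0" "\<And>Q. Q \<in> topspace X - U \<Longrightarrow> b \<le> d P Q"
        using dist_pos_outside[OF PQ(1)] by blast
      then show False using \<open>Q \<notin> U\<close> PQ 0 by force
    qed
  qed (use dist_self PQ in auto)
qed (auto intro: dist_nonneg dist_commute dist_triangle)

text \<open>The images of nearly minimal paths are \<open>r\<close> times as long. One inequality is
  enough, since for \<open>D\<close> the other one is obtained by rescaling with
  \<open>1 / k\<close>.\<close>

lemma dist_homothety:
  assumes "homothety_with_factor X \<A> g \<Phi> r" "P \<in> topspace X" "Q \<in> topspace X"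
  shows "d (\<Phi> P) (\<Phi> Q) \<le> r * d P Q"
proof (rule field_le_epsilon)
  fix e :: real assume "e > 0"
  have r: "r > 0" using assms(1) by (simp add: homothety_with_factor_def)
  obtain L where L: "connects P Q L" "L < d P Q + e / r"
    using dist_approx[OF assms(2,3), of "d P Q + e / r"] \<open>e > 0\<close> r by auto
  have "d (\<Phi> P) (\<Phi> Q) \<le> r * L" by (rule dist_le[OF connects_homothety[OF assms(1) L(1)]])
  also have "\<dots> \<le> r * (d P Q + e / r)" using L(2) r by simp
  finally show "d (\<Phi> P) (\<Phi> Q) \<le> r * d P Q + e" using r by (simp add: distrib_left)
qed

text \<open>Every path from \<open>P\<close> to \<open>Q\<close> meets the set \<open>f = y\<close>,
  so lower bounds for the two parts add up.\<close>

lemma dist_split: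
  assumes "P \<in> topspace X" "Q \<in> topspace X" "continuous_map X euclideanreal f" "f P < y" "y < f Q"
    and lower: "\<And>S. S \<in> topspace X \<Longrightarrow> f S = y \<Longrightarrow> A \<le> d P S \<and> B \<le> d S Q"
  shows "A + B \<le> d P Q"
proof (rule dist_ge[OF assms(1,2)])
  fix L assume "connects P Q L"
  then obtain S L1 L2 where S: "S \<in> topspace X" "f S = y" "connects P S L1" "connects S Q L2" "L = L1 + L2"
    using connects_split[OF _ assms(3-5)] by metis
  then show "A + B \<le> L"
    using lower[OF S(1,2)] dist_le[OF S(3)] dist_le[OF S(4)] by linarith
qed

end

section \<open>Homothety homogeneous manifolds\<close>

locale homothety_homogeneous = metric_mfd X \<A> g
  for X :: "'a topology" and \<A> :: "('a, real^'n::finite) chart set" and g +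
  fixes H :: "('a \<Rightarrow> 'a) set" and T :: "('a \<Rightarrow> 'a) topology"
    and \<B> :: "('a \<Rightarrow> 'a, 'e::euclidean_space) chart set"
    and P0 :: 'a and l :: nat and R :: "'a \<Rightarrow> real"
  assumes conn: "connected_space X"
    and lie: "connected_lie_group_of_homotheties X \<A> g H T \<B>"
    and trans: "acts_transitively X H (topspace X)"
    and nontrivial: "\<exists>\<Phi>\<in>H. homothety_character X \<A> g \<Phi> \<noteq> 1"
    and P0: "P0 \<in> topspace X"
    and weyl: "scalar_weyl_invariant \<A> g l R" and R_nonzero: "P \<in> topspace X \<Longrightarrow> R P \<noteq> 0"
begin

abbreviation "M \<equiv> topspace X"
abbreviation "lam \<equiv> homothety_character X \<A> g"
abbreviation "mu \<equiv> weyl_mu P0 l R"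
abbreviation "level \<equiv> level_set X P0 l R"

section \<open>The group and its homothety character\<close>

lemma l_pos: "l > 0"
  by (rule weyl_invariant_order_pos[OF weyl P0 R_nonzero[OF P0]])

text \<open>The character is defined by \<open>THE\<close>, so uniqueness of the factor is required:
  two factors of \<open>\<Phi>\<close> have the same \<open>l\<close>-th power because
  \<open>R (\<Phi> P0)\<close> is determined and \<open>R P0\<close> is nonzero.\<close>

lemma H_homothety:
  assumes "\<Phi> \<in> H"
  shows "homothety_with_factor X \<A> g \<Phi> (lam \<Phi>)"
proof -
  obtain r where r: "homothety_with_factor X \<A> g \<Phi> r"
    using assms lie by (auto simp: connected_lie_group_of_homotheties_def homotheties_def)
  have "s = r" if s: "homothety_with_factor X \<A> g \<Phi> s" for s
  proof -
    have "R P0 / s ^ l = R P0 / r ^ l"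
      using weyl_invariant_homothety[OF weyl s P0] weyl_invariant_homothety[OF weyl r P0] by metis
    then have "s ^ l = r ^ l" using R_nonzero[OF P0] by (metis divide_cancel_left)
    moreover have "s > 0" "r > 0" using s r by (auto simp: homothety_with_factor_def)
    ultimately show ?thesis using l_pos by (metis less_imp_le power_eq_imp_eq_base)
  qed
  then show ?thesis unfolding homothety_character_def using r by (metis theI)
qed

lemma lam_pos: "\<Phi> \<in> H \<Longrightarrow> lam \<Phi> > 0"
  using H_homothety by (auto simp: homothety_with_factor_def)

lemma H_Bij: "\<Phi> \<in> H \<Longrightarrow> \<Phi> \<in> Bij M"
  using H_homothety by (auto simp: homothety_with_factor_def diffeomorphism_def)

lemma H_in: "\<Phi> \<in> H \<Longrightarrow> P \<in> M \<Longrightarrow> \<Phi> P \<in> M"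
  using H_Bij by (auto simp: Bij_def bij_betw_def)

lemma H_subgroup: "subgroup H (BijGroup M)"
  using lie by (simp add: connected_lie_group_of_homotheties_def)

lemma H_compose: "\<Phi> \<in> H \<Longrightarrow> \<Psi> \<in> H \<Longrightarrow> compose M \<Phi> \<Psi> \<in> H"
  using subgroup.m_closed[OF H_subgroup, of \<Phi> \<Psi>] H_Bij by (simp add: BijGroup_def)

lemma H_inv:
  assumes "\<Phi> \<in> H"
  obtains \<Psi> where "\<Psi> \<in> H" "\<And>P. P \<in> M \<Longrightarrow> \<Psi> (\<Phi> P) = P" "\<And>P. P \<in> M \<Longrightarrow> \<Phi> (\<Psi> P) = P"
proof
  let ?\<Psi> = "restrict (inv_into M \<Phi>) M"
  show "?\<Psi> \<in> H"
    using subgroup.m_inv_closed[OF H_subgroup assms] inv_BijGroup[OF H_Bij[OF assms]] by simp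
  have "bij_betw \<Phi> M M" using H_Bij[OF assms] by (simp add: Bij_def)
  then show "?\<Psi> (\<Phi> P) = P" "\<Phi> (?\<Psi> P) = P" if "P \<in> M" for P
    using that H_in[OF assms that] by (auto simp: bij_betw_def f_inv_into_f)
qed

lemma H_transitive:
  assumes "P \<in> M" "Q \<in> M"
  obtains \<Phi> where "\<Phi> \<in> H" "\<Phi> P = Q"
  using transitive_action.unique_orbit[OF trans[unfolded acts_transitively_def] assms] assms by auto

lemma R_homothety: "\<Phi> \<in> H \<Longrightarrow> P \<in> M \<Longrightarrow> R (\<Phi> P) = R P / lam \<Phi> ^ l"
  by (rule weyl_invariant_homothety[OF weyl H_homothety])

lemma mu_pos: "P \<in> M \<Longrightarrow> mu P > 0"
  using R_nonzero P0 by (simp add: weyl_mu_def)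

lemma mu_homothety:
  assumes "\<Phi> \<in> H" "P \<in> M"
  shows "mu (\<Phi> P) = lam \<Phi> * mu P"
proof -
  have "\<bar>R P0 / R (\<Phi> P)\<bar> = lam \<Phi> ^ l * \<bar>R P0 / R P\<bar>"
    using lam_pos[OF assms(1)] by (simp add: R_homothety[OF assms] abs_mult)
  moreover have "(lam \<Phi> ^ l) powr (1 / real l) = lam \<Phi>"
    using lam_pos[OF assms(1)] l_pos by (simp add: powr_powr flip: powr_realpow)
  ultimately show ?thesis
    using lam_pos[OF assms(1)] by (simp only: weyl_mu_def powr_mult)
qed

lemma mu_P0: "mu P0 = 1"
  using R_nonzero[OF P0] by (simp add: weyl_mu_def)

text \<open>Expresses a function on the group through one on the manifold, in order to transfer
  continuity to \<open>lam\<close> and to compare different invariants.\<close>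

lemma lam_eq_mu: "\<Phi> \<in> H \<Longrightarrow> lam \<Phi> = mu (\<Phi> P0)"
  using mu_homothety[OF _ P0] mu_P0 by simp

lemma mu_continuous: "continuous_map X euclideanreal mu"
proof -
  have "continuous_map X (top_of_set (- {0})) R"
    using smooth_fun_continuous[OF weyl_invariant_smooth[OF weyl]] R_nonzero
    by (auto simp: continuous_map_in_subtopology)
  moreover have "continuous_on (- {0}) (\<lambda>x. \<bar>R P0 / x\<bar> powr (1 / real l))"
    using R_nonzero[OF P0] by (intro continuous_intros) auto
  ultimately have "continuous_map X euclideanreal ((\<lambda>x. \<bar>R P0 / x\<bar> powr (1 / real l)) \<circ> R)"
    by (intro continuous_map_compose) auto
  then show ?thesis by (simp add: o_def weyl_mu_def[abs_def])
qed

lemma lam_compose: "\<Phi> \<in> H \<Longrightarrow> \<Psi> \<in> H \<Longrightarrow> lam (compose M \<Phi> \<Psi>) = lam \<Phi> * lam \<Psi>"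
  using lam_eq_mu[OF H_compose] mu_homothety[OF _ H_in[OF _ P0]] lam_eq_mu[of \<Psi>] P0
  by (simp add: compose_def)

lemma lam_inverse:
  assumes "\<Phi> \<in> H" "\<Psi> \<in> H" "\<Phi> (\<Psi> P0) = P0"
  shows "lam \<Phi> * lam \<Psi> = 1"
  using mu_homothety[OF assms(1) H_in[OF assms(2) P0]] lam_eq_mu[OF assms(2)] assms(3) mu_P0 by simp

lemma lam_surj:
  assumes "c > 0"
  obtains \<Phi> where "\<Phi> \<in> H" "lam \<Phi> = c"
proof -
  have topT: "topspace T = H" and cT: "connected_space T"
    and act: "continuous_map (prod_topology T X) X (\<lambda>(\<Phi>, P). \<Phi> P)"
    using lie by (auto simp: connected_lie_group_of_homotheties_def smooth_map_def)
  have "continuous_map T (prod_topology T X) (\<lambda>\<Phi>. (\<Phi>, P0))"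
    using P0 by (simp add: continuous_map_paired)
  from continuous_map_compose[OF continuous_map_compose[OF this act] mu_continuous]
  have "continuous_map T euclideanreal (\<lambda>\<Phi>. mu (\<Phi> P0))" by (simp add: o_def)
  then have "connectedin euclideanreal ((\<lambda>\<Phi>. mu (\<Phi> P0)) ` topspace T)"
    by (rule connectedin_continuous_map_image) (use cT in \<open>simp add: connectedin_def\<close>)
  moreover have "(\<lambda>\<Phi>. mu (\<Phi> P0)) ` topspace T = lam ` H"
    using lam_eq_mu topT by auto
  ultimately have conn_lam: "connected (lam ` H)" by simp
  obtain \<Phi>0 where \<Phi>0: "\<Phi>0 \<in> H" "lam \<Phi>0 \<noteq> 1" using nontrivial by blast
  obtain \<Psi>0 where \<Psi>0: "\<Psi>0 \<in> H" "\<And>P. P \<in> M \<Longrightarrow> \<Psi>0 (\<Phi>0 P) = P" "\<And>P. P \<in> M \<Longrightarrow> \<Phi>0 (\<Psi>0 P) = P"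
    using H_inv[OF \<Phi>0(1)] by blast
  have inv0: "lam \<Phi>0 * lam \<Psi>0 = 1"
    using lam_inverse[OF \<Phi>0(1) \<Psi>0(1)] \<Psi>0(3) P0 by simp
  have one: "1 \<in> lam ` H"
    using lam_compose[OF \<Phi>0(1) \<Psi>0(1)] inv0 H_compose[OF \<Phi>0(1) \<Psi>0(1)] by (metis imageI)
  have pow: "x ^ n \<in> lam ` H" if "x \<in> lam ` H" for x n
  proof (induction n)
    case (Suc n)
    then show ?case using that lam_compose H_compose by (auto simp: image_iff) metis
  qed (use one in simp)
  \<comment> \<open>\<open>p\<close> is whichever of the nontrivial value \<open>lam \<Phi>0\<close>
    and its inverse exceeds \<open>1\<close>, and \<open>q\<close> is the other.\<close>
  define p where "p = (if lam \<Phi>0 > 1 then lam \<Phi>0 else lam \<Psi>0)"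
  define q where "q = (if lam \<Phi>0 > 1 then lam \<Psi>0 else lam \<Phi>0)"
  have p: "p \<in> lam ` H" "q \<in> lam ` H" "p * q = 1" "p > 0" "q > 0"
    using \<Phi>0 \<Psi>0 inv0 lam_pos by (auto simp: p_def q_def mult.commute)
  have "p > 1"
  proof (cases "lam \<Phi>0 > 1")
    case False
    then have "q < 1" using \<Phi>0 by (simp add: q_def)
    then show ?thesis using p(3,4) by (smt (verit) mult_less_cancel_left2)
  qed (simp add: p_def)
  have q_eq: "q = 1 / p" using p(3,4) by (simp add: field_simps)
  \<comment> \<open>\<open>n\<close> is so large that \<open>c\<close> lies between
    \<open>q ^ n\<close>, which is \<open>1 / p ^ n\<close>, and \<open>p ^ n\<close>.\<close>
  obtain n where n: "max c (1 / c) < p ^ n" using real_arch_pow[OF \<open>p > 1\<close>] by blast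
  have "q ^ n \<le> c"
    using n assms p(4) by (simp add: q_eq power_divide field_simps)
  moreover have "c \<le> p ^ n" using n by simp
  ultimately have "c \<in> lam ` H"
    using conn_lam pow[OF p(1)] pow[OF p(2)] unfolding connected_iff_interval by blast
  then show thesis using that by blast
qed

section \<open>Level sets of the normalised invariant\<close>

lemma in_levelD: "P \<in> level c \<Longrightarrow> P \<in> M" "P \<in> level c \<Longrightarrow> mu P = c"
  by (auto simp: level_set_def)

lemma in_levelI: "P \<in> M \<Longrightarrow> mu P = c \<Longrightarrow> P \<in> level c"
  by (simp add: level_set_def)

lemma level_homothety: "\<Phi> \<in> H \<Longrightarrow> P \<in> level c \<Longrightarrow> \<Phi> P \<in> level (lam \<Phi> * c)"
  using mu_homothety H_in by (auto simp: level_set_def)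

lemma level_nonempty:
  assumes "c > 0"
  shows "level c \<noteq> {}"
proof -
  obtain \<Phi> where "\<Phi> \<in> H" "lam \<Phi> = c" using lam_surj[OF assms] .
  then have "\<Phi> P0 \<in> level c" using H_in P0 lam_eq_mu by (auto simp: level_set_def)
  then show ?thesis by blast
qed

text \<open>The character of any group element taking \<open>P\<close> to \<open>Q\<close> is the
  quotient of their \<open>mu\<close> values, here \<open>1\<close>.\<close>

lemma level_isometry:
  assumes "P \<in> level c" "Q \<in> level c"
  obtains \<Phi> where "\<Phi> \<in> H" "lam \<Phi> = 1" "\<Phi> P = Q"
proof -
  obtain \<Phi> where \<Phi>: "\<Phi> \<in> H" "\<Phi> P = Q"
    using H_transitive[of P Q] assms in_levelD by blast
  then have "lam \<Phi> * mu P = mu P" using mu_homothety[of \<Phi> P] assms in_levelD by metis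
  then have "lam \<Phi> = 1" using mu_pos[of P] assms in_levelD by force
  with \<Phi> show thesis using that by blast
qed

text \<open>\<open>mu\<close> sees only \<open>\<bar>R\<bar>\<close>, but \<open>M\<close> is a
  single orbit and \<open>R\<close> keeps its sign along it. Hence \<open>regular_level_set\<close>
  can be applied to the smooth function \<open>R\<close>.\<close>

lemma level_eq_R:
  assumes "c > 0"
  shows "level c = {P\<in>M. R P = R P0 / c ^ l}"
proof -
  have "mu P = c \<longleftrightarrow> R P = R P0 / c ^ l" if P: "P \<in> M" for P
  proof -
    obtain \<Phi> where \<Phi>: "\<Phi> \<in> H" "\<Phi> P0 = P" using H_transitive[OF P0 P] .
    have pos: "lam \<Phi> > 0" by (rule lam_pos[OF \<Phi>(1)])
    have "R P = R P0 / c ^ l \<longleftrightarrow> lam \<Phi> ^ l = c ^ l"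
      using R_homothety[OF \<Phi>(1) P0] \<Phi>(2) R_nonzero[OF P0] pos assms by auto
    also have "\<dots> \<longleftrightarrow> lam \<Phi> = c"
      using pos assms l_pos by (metis less_imp_le power_eq_imp_eq_base)
    finally show ?thesis using lam_eq_mu[OF \<Phi>(1)] \<Phi>(2) by simp
  qed
  then show ?thesis by (auto simp: level_set_def)
qed

lemma level_submanifold:
  assumes "c > 0"
  shows "smooth_submanifold_codim \<A> 1 (level c)"
  unfolding level_eq_R[OF assms]
proof (rule regular_level_set[OF mfd weyl_invariant_smooth[OF weyl]])
  fix P assume P: "P \<in> M"
  have sm: "smooth_fun R" by (rule weyl_invariant_smooth[OF weyl])
  show "\<exists>c\<in>\<A>. P \<in> fst c \<and> (\<exists>v. frechet_derivative (R \<circ> chart_inv c) (at (snd c P)) v \<noteq> 0)"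
  proof (rule ccontr)
    assume "\<not> ?thesis"
    then have crit: "frechet_derivative (R \<circ> chart_inv d) (at (snd d P)) v = 0"
      if "d \<in> \<A>" "P \<in> fst d" for d v
      using that by blast
    have "frechet_derivative (R \<circ> chart_inv c) (at (snd c Q)) v = 0"
      if c: "c \<in> \<A>" "Q \<in> fst c" for c Q v
    proof -
      obtain \<Phi> where \<Phi>: "\<Phi> \<in> H" "\<Phi> Q = P" using H_transitive[OF chart_subset[OF c] P] .
      have "R (\<Phi> S) = (1 / lam \<Phi> ^ l) * R S" if "S \<in> M" for S
        using R_homothety[OF \<Phi>(1) that] by simp
      then obtain d where d: "d \<in> \<A>" "\<Phi> Q \<in> fst d"
        "frechet_derivative (R \<circ> chart_inv d) (at (snd d (\<Phi> Q))) v =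
          (1 / lam \<Phi> ^ l) * frechet_derivative (R \<circ> chart_inv c) (at (snd c Q)) v"
        using homothety_frechet_derivative[OF H_homothety[OF \<Phi>(1)] c sm] by metis
      then show ?thesis using crit[of d v] lam_pos[OF \<Phi>(1)] \<Phi>(2) by simp
    qed
    then have const: "R Q = R P0" if "Q \<in> M" for Q
      using smooth_fun_constant[OF conn sm _ P0 that] by blast
    \<comment> \<open>A homothety of factor \<open>2\<close> divides \<open>R\<close> by
      \<open>2 ^ l\<close>, which contradicts constancy.\<close>
    obtain \<Phi> where \<Phi>: "\<Phi> \<in> H" "lam \<Phi> = 2" using lam_surj[of 2] by auto
    have "R P0 / 2 ^ l = R P0"
      using R_homothety[OF \<Phi>(1) P0] const[OF H_in[OF \<Phi>(1) P0]] \<Phi>(2) by simp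
    then have "(2::real) ^ l = 1" using R_nonzero[OF P0] by (simp add: field_simps)
    moreover have "(1::real) < 2 ^ l" using l_pos by (intro one_less_power) auto
    ultimately show False by simp
  qed
qed

text \<open>Transitivity is \<open>level_isometry\<close>; the remainder verifies that restriction
  to the level set is a homomorphism into its group of bijections.\<close>

lemma isometries_act_transitively: "acts_transitively X (isometries_in X \<A> g H) (level c)"
proof -
  let ?I = "isometries_in X \<A> g H" and ?S = "level c" and ?B = "BijGroup M"
  have S: "?S \<subseteq> M" by (auto simp: level_set_def)
  have I: "\<Phi> \<in> ?I \<longleftrightarrow> \<Phi> \<in> H \<and> lam \<Phi> = 1" for \<Phi> by (simp add: isometries_in_def)
  interpret B: group ?B by (rule group_BijGroup)
  have I_inv: "\<exists>\<Psi>\<in>?I. (\<forall>P\<in>M. \<Psi> (\<Phi> P) = P \<and> \<Phi> (\<Psi> P) = P)" if \<Phi>: "\<Phi> \<in> ?I" for \<Phi>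
  proof -
    obtain \<Psi> where \<Psi>: "\<Psi> \<in> H" "\<And>P. P \<in> M \<Longrightarrow> \<Psi> (\<Phi> P) = P" "\<And>P. P \<in> M \<Longrightarrow> \<Phi> (\<Psi> P) = P"
      using H_inv[of \<Phi>] \<Phi> I by metis
    then have "lam \<Psi> = 1" using lam_inverse[of \<Phi> \<Psi>] \<Phi> I P0 by simp
    then show ?thesis using \<Psi> I by blast
  qed
  have sub: "subgroup ?I ?B"
  proof (rule B.subgroupI)
    show "?I \<subseteq> carrier ?B" using H_Bij I by (auto simp: BijGroup_def)
    obtain \<Phi> where "\<Phi> \<in> H" "lam \<Phi> = 1" using lam_surj[of 1] by auto
    then show "?I \<noteq> {}" using I by blast
    show "\<Phi> \<otimes>\<^bsub>?B\<^esub> \<Psi> \<in> ?I" if "\<Phi> \<in> ?I" "\<Psi> \<in> ?I" for \<Phi> \<Psi>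
      using that H_compose[of \<Phi> \<Psi>] lam_compose[of \<Phi> \<Psi>] I H_Bij by (simp add: BijGroup_def)
    show "inv\<^bsub>?B\<^esub> \<Phi> \<in> ?I" if \<Phi>: "\<Phi> \<in> ?I" for \<Phi>
    proof -
      have mem: "inv\<^bsub>?B\<^esub> \<Phi> \<in> H" using subgroup.m_inv_closed[OF H_subgroup] \<Phi> I by blast
      have "bij_betw \<Phi> M M" using H_Bij[of \<Phi>] \<Phi> I by (simp add: Bij_def)
      then have "\<Phi> ((inv\<^bsub>?B\<^esub> \<Phi>) P0) = P0"
        using inv_BijGroup[OF H_Bij, of \<Phi>] \<Phi> I P0 by (simp add: f_inv_into_f bij_betw_def)
      then have "lam \<Phi> * lam (inv\<^bsub>?B\<^esub> \<Phi>) = 1" using lam_inverse[OF _ mem] \<Phi> I by blast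
      then show ?thesis using \<Phi> I mem by simp
    qed
  qed
  have into: "\<Phi> P \<in> ?S" if "\<Phi> \<in> ?I" "P \<in> ?S" for \<Phi> P
    using level_homothety[of \<Phi> P c] that I by simp
  have bij: "restrict \<Phi> ?S \<in> Bij ?S" if \<Phi>: "\<Phi> \<in> ?I" for \<Phi>
  proof -
    obtain \<Psi> where \<Psi>: "\<Psi> \<in> ?I" "\<forall>P\<in>M. \<Psi> (\<Phi> P) = P \<and> \<Phi> (\<Psi> P) = P"
      using I_inv[OF \<Phi>] by blast
    have "bij_betw (restrict \<Phi> ?S) ?S ?S"
      by (rule bij_betw_byWitness[where f' = \<Psi>]) (use \<Psi> into[OF \<Phi>] into[OF \<Psi>(1)] S in auto)
    then show ?thesis by (simp add: Bij_def)
  qed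
  have "group_hom (?B\<lparr>carrier := ?I\<rparr>) (BijGroup ?S) (\<lambda>\<Phi>. restrict \<Phi> ?S)"
  proof (intro group_hom.intro group_hom_axioms.intro subgroup.subgroup_is_group[OF sub B.is_group] group_BijGroup homI)
    show "restrict \<Phi> ?S \<in> carrier (BijGroup ?S)" if "\<Phi> \<in> carrier (?B\<lparr>carrier := ?I\<rparr>)" for \<Phi>
      using bij that by (simp add: BijGroup_def)
    fix \<Phi> \<Psi> assume "\<Phi> \<in> carrier (?B\<lparr>carrier := ?I\<rparr>)" "\<Psi> \<in> carrier (?B\<lparr>carrier := ?I\<rparr>)"
    then have *: "\<Phi> \<in> ?I" "\<Psi> \<in> ?I" by auto
    then have "restrict (compose M \<Phi> \<Psi>) ?S = compose ?S (restrict \<Phi> ?S) (restrict \<Psi> ?S)"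
      using S into[OF *(2)] by (auto simp: compose_def fun_eq_iff)
    then show "restrict (\<Phi> \<otimes>\<^bsub>?B\<lparr>carrier := ?I\<rparr>\<^esub> \<Psi>) ?S =
        restrict \<Phi> ?S \<otimes>\<^bsub>BijGroup ?S\<^esub> restrict \<Psi> ?S"
      using * bij H_Bij I by (simp add: BijGroup_def)
  qed
  then show ?thesis
    unfolding acts_transitively_def
  proof (intro transitive_action.intro group_action.intro transitive_action_axioms.intro)
    fix P Q assume PQ: "P \<in> ?S" "Q \<in> ?S"
    then obtain \<Phi> where "\<Phi> \<in> H" "lam \<Phi> = 1" "\<Phi> P = Q" using level_isometry by metis
    then show "\<exists>\<Phi>\<in>carrier (?B\<lparr>carrier := ?I\<rparr>). restrict \<Phi> ?S P = Q"
      using I PQ(1) by (intro bexI[of _ \<Phi>]) auto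
  qed
qed

text \<open>If \<open>P = \<Phi> P0\<close>, both normalised invariants have at \<open>P\<close> the
  value \<open>lam \<Phi>\<close>, which does not refer to any invariant.\<close>

lemma level_independent:
  assumes "scalar_weyl_invariant \<A> g l' R'" "\<And>P. P \<in> M \<Longrightarrow> R' P \<noteq> 0"
  shows "level_set X P0 l' R' c = level c"
proof -
  interpret other: homothety_homogeneous X \<A> g H T \<B> P0 l' R'
    using assms conn lie trans nontrivial P0 by unfold_locales
  have "weyl_mu P0 l' R' P = mu P" if P: "P \<in> M" for P
  proof -
    obtain \<Phi> where "\<Phi> \<in> H" "\<Phi> P0 = P" using H_transitive[OF P0 P] .
    then show ?thesis using lam_eq_mu other.lam_eq_mu by metis
  qed
  then show ?thesis by (auto simp: level_set_def)
qed

end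

section \<open>Distances between level sets\<close>

locale riemannian_homothety_homogeneous =
  homothety_homogeneous X \<A> g H T \<B> P0 l R + riemannian_mfd X \<A> g
  for X :: "'a topology" and \<A> :: "('a, real^'n::finite) chart set" and g
    and H and T and \<B> :: "('a \<Rightarrow> 'a, 'e::euclidean_space) chart set" and P0 l R
begin

definition D :: "real \<Rightarrow> real \<Rightarrow> real" where
  "D a b = riemannian_set_dist X \<A> g (level a) (level b)"

lemma D_le: "P \<in> level a \<Longrightarrow> Q \<in> level b \<Longrightarrow> D a b \<le> d P Q"
  unfolding D_def riemannian_set_dist_def
  by (rule cInf_lower) (auto intro!: bdd_belowI[of _ 0] dist_nonneg)

lemma D_ge:
  assumes "a > 0" "b > 0" "\<And>P Q. P \<in> level a \<Longrightarrow> Q \<in> level b \<Longrightarrow> x \<le> d P Q"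
  shows "x \<le> D a b"
  unfolding D_def riemannian_set_dist_def
  using level_nonempty[OF assms(1)] level_nonempty[OF assms(2)] assms(3)
  by (intro cInf_greatest) auto

text \<open>An isometry moves a nearly minimal pair so that it starts at the prescribed
  \<open>P\<close>. This is what makes nearly minimal pairs composable.\<close>

lemma D_approx:
  assumes "P \<in> level a" "a > 0" "b > 0" "D a b < x"
  obtains Q where "Q \<in> level b" "d P Q < x"
proof -
  obtain P' Q' where PQ: "P' \<in> level a" "Q' \<in> level b" "d P' Q' < x"
    using D_ge[OF assms(2,3), of x] assms(4) by fastforce
  obtain \<Phi> where \<Phi>: "\<Phi> \<in> H" "lam \<Phi> = 1" "\<Phi> P' = P"
    using level_isometry[OF PQ(1) assms(1)] .
  have "d P (\<Phi> Q') \<le> d P' Q'"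
    using dist_homothety[OF H_homothety[OF \<Phi>(1)], of P' Q'] PQ in_levelD \<Phi> by simp
  moreover have "\<Phi> Q' \<in> level b" using level_homothety[OF \<Phi>(1) PQ(2)] \<Phi>(2) by simp
  ultimately show thesis using that PQ(3) by (metis order_le_less_trans)
qed

lemma D_commute: "D a b = D b a"
proof -
  have "{d P Q |P Q. P \<in> level a \<and> Q \<in> level b} = {d P Q |P Q. P \<in> level b \<and> Q \<in> level a}"
    by (intro Collect_cong) (metis dist_commute)
  then show ?thesis by (simp add: D_def riemannian_set_dist_def)
qed

lemma D_nonneg: "a > 0 \<Longrightarrow> b > 0 \<Longrightarrow> D a b \<ge> 0"
  by (rule D_ge) (auto intro: dist_nonneg)

lemma D_self:
  assumes "a > 0"
  shows "D a a = 0"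
proof -
  obtain P where P: "P \<in> level a" using level_nonempty[OF assms] by blast
  then have "D a a \<le> d P P" by (intro D_le)
  then show ?thesis using D_nonneg[OF assms assms] dist_self in_levelD(1)[OF P] by simp
qed

lemma D_scale_le:
  assumes "k > 0" "a > 0" "b > 0"
  shows "D (k * a) (k * b) \<le> k * D a b"
proof -
  obtain \<Phi> where \<Phi>: "\<Phi> \<in> H" "lam \<Phi> = k" using lam_surj[OF assms(1)] .
  have "D (k * a) (k * b) / k \<le> D a b"
  proof (rule D_ge[OF assms(2,3)])
    fix P Q assume PQ: "P \<in> level a" "Q \<in> level b"
    then have "D (k * a) (k * b) \<le> d (\<Phi> P) (\<Phi> Q)"
      using level_homothety[OF \<Phi>(1)] \<Phi>(2) by (auto intro: D_le)
    also have "\<dots> \<le> k * d P Q"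
      using dist_homothety[OF H_homothety[OF \<Phi>(1)], of P Q] PQ in_levelD \<Phi> by simp
    finally show "D (k * a) (k * b) / k \<le> d P Q" using assms(1) by (simp add: field_simps)
  qed
  then show ?thesis using assms(1) by (simp add: field_simps)
qed

lemma D_scale:
  assumes "k > 0" "a > 0" "b > 0"
  shows "D (k * a) (k * b) = k * D a b"
proof -
  have "D a b \<le> (1 / k) * D (k * a) (k * b)"
    using D_scale_le[of "1 / k" "k * a" "k * b"] assms by simp
  then show ?thesis using D_scale_le[OF assms] assms(1) by (simp add: field_simps)
qed

lemma D_additive:
  assumes "0 < a" "a < b" "b < c"
  shows "D a c = D a b + D b c"
proof (rule antisym)
  have pos: "b > 0" "c > 0" using assms by auto
  show "D a c \<le> D a b + D b c"
  proof (rule field_le_epsilon)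
    fix e :: real assume e: "e > 0"
    obtain P where P: "P \<in> level a" using level_nonempty[OF assms(1)] by blast
    obtain Q where Q: "Q \<in> level b" "d P Q < D a b + e / 2"
      using D_approx[OF P assms(1) pos(1), of "D a b + e / 2"] e by auto
    \<comment> \<open>Starting from the \<open>Q\<close> just found, so that the two estimates share
      this point.\<close>
    obtain S where S: "S \<in> level c" "d Q S < D b c + e / 2"
      using D_approx[OF Q(1) pos, of "D b c + e / 2"] e by auto
    have "D a c \<le> d P S" by (rule D_le[OF P S(1)])
    also have "\<dots> \<le> d P Q + d Q S" using P Q(1) S(1) in_levelD by (intro dist_triangle) auto
    finally show "D a c \<le> D a b + D b c + e" using Q(2) S(2) by simp
  qed
  show "D a b + D b c \<le> D a c"
  proof (rule D_ge[OF assms(1) pos(2)])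
    fix P Q assume PQ: "P \<in> level a" "Q \<in> level c"
    show "D a b + D b c \<le> d P Q"
    proof (rule dist_split[OF _ _ mu_continuous])
      show "mu P < b" "b < mu Q" using in_levelD(2)[OF PQ(1)] in_levelD(2)[OF PQ(2)] assms by auto
      show "D a b \<le> d P S \<and> D b c \<le> d S Q" if "S \<in> M" "mu S = b" for S
        using D_le[OF PQ(1) in_levelI[OF that]] D_le[OF in_levelI[OF that] PQ(2)] by simp
    qed (use PQ in_levelD in auto)
  qed
qed

text \<open>The set \<open>mu < 2\<close> is a neighbourhood of \<open>P0\<close> disjoint from
  \<open>level 2\<close>, and by \<open>D_approx\<close> only distances from \<open>P0\<close> have
  to be considered.\<close>

lemma D_pos: "D 1 2 > 0"
proof -
  have "openin X {P\<in>topspace X. mu P \<in> {..<2}}"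
    by (rule openin_continuous_map_preimage[OF mu_continuous]) simp
  then obtain b where b: "b > 0" "\<And>Q. Q \<in> M - {P\<in>M. mu P \<in> {..<2}} \<Longrightarrow> b \<le> d P0 Q"
    by (rule dist_pos_outside[OF P0]) (use P0 mu_P0 in auto)
  have "b \<le> D 1 2"
  proof (rule ccontr)
    assume "\<not> b \<le> D 1 2"
    moreover have "P0 \<in> level 1" using P0 mu_P0 by (rule in_levelI)
    ultimately obtain Q where Q: "Q \<in> level 2" "d P0 Q < b"
      using D_approx[of P0 1 2 b] by auto
    then show False using b(2)[of Q] in_levelD[of Q 2] by auto
  qed
  then show ?thesis using b(1) by simp
qed

text \<open>By additivity and homogeneity \<open>F c = D 1 c\<close> satisfies \<open>F (c b) = F c + c F b\<close>, and the
  left-hand side is symmetric in \<open>b\<close> and \<open>c\<close>.\<close>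

lemma D_from_one:
  assumes "c > 1"
  shows "D 1 c = D 1 2 * (c - 1)"
proof -
  have F: "D 1 (c * b) = D 1 c + c * D 1 b" if "c > 1" "b > 1" for b c
  proof -
    have "c < c * b" using that by simp
    then have "D 1 (c * b) = D 1 c + D c (c * b)" using that by (intro D_additive) auto
    also have "D c (c * b) = c * D 1 b" using D_scale[of c 1 b] that by simp
    finally show ?thesis .
  qed
  \<comment> \<open>Taking \<open>b = 2\<close> in the symmetric identity leaves a linear equation
    for \<open>D 1 c\<close>.\<close>
  have "D 1 c + c * D 1 2 = D 1 2 + 2 * D 1 c"
    using F[of c 2] F[of 2 c] assms by (simp add: mult.commute)
  then show ?thesis by (simp add: algebra_simps)
qed

lemma D_eq:
  assumes "a > 0" "b > 0"
  shows "D a b = D 1 2 * \<bar>a - b\<bar>"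
proof -
  have less: "D a b = D 1 2 * (b - a)" if "0 < a" "a < b" for a b
  proof -
    have "D a b = a * D 1 (b / a)" using D_scale[of a 1 "b / a"] that by simp
    also have "\<dots> = a * (D 1 2 * (b / a - 1))" using D_from_one[of "b / a"] that by simp
    also have "\<dots> = D 1 2 * (b - a)" using that by (simp add: field_simps)
    finally show ?thesis .
  qed
  consider "a < b" | "a = b" | "b < a" by linarith
  then show ?thesis
    using less[of a b] less[of b a] D_self[of a] D_commute[of a b] assms by cases auto
qed

text \<open>The distance of two points is at least that of the level sets through them.\<close>

lemma mu_dist:
  assumes "P \<in> M" "Q \<in> M"
  shows "D 1 2 * \<bar>mu P - mu Q\<bar> \<le> d P Q"
  using D_le[of P "mu P" Q "mu Q"] D_eq[of "mu P" "mu Q"] mu_pos assms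
  by (simp add: in_levelI)

section \<open>Incompleteness\<close>

lemma not_complete: "\<not> riemannian_complete X \<A> g"
proof
  assume "riemannian_complete X \<A> g"
  then have compl: "mcomplete" by (simp add: riemannian_complete_def)
  obtain \<Phi> where \<Phi>: "\<Phi> \<in> H" "lam \<Phi> = 1 / 2" using lam_surj[of "1 / 2"] by auto
  define \<sigma> where "\<sigma> n = (\<Phi> ^^ n) P0" for n
  have \<sigma>0: "\<sigma> 0 = P0" and \<sigma>Suc: "\<sigma> (Suc n) = \<Phi> (\<sigma> n)" for n by (auto simp: \<sigma>_def)
  have \<sigma>M: "\<sigma> n \<in> M" for n
    by (induction n) (auto simp: \<sigma>0 \<sigma>Suc P0 H_in[OF \<Phi>(1)])
  have mu\<sigma>: "mu (\<sigma> n) = (1 / 2) ^ n" for n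
    by (induction n) (auto simp: \<sigma>0 \<sigma>Suc mu_P0 mu_homothety[OF \<Phi>(1) \<sigma>M] \<Phi>(2))
  have step: "d (\<Phi> P) (\<Phi> Q) \<le> d P Q / 2" if "P \<in> M" "Q \<in> M" for P Q
    using dist_homothety[OF H_homothety[OF \<Phi>(1)] that] \<Phi>(2) by simp
  \<comment> \<open>Twice the first step: the bound for the next point is the first step,
    \<open>K / 2\<close>, plus half of the previous bound, at most \<open>K / 2\<close>.\<close>
  define K where "K = 2 * d (\<sigma> 0) (\<sigma> 1)"
  have K: "K \<ge> 0" by (simp add: K_def dist_nonneg)
  have from0: "d (\<sigma> 0) (\<sigma> k) \<le> K" for k
  proof (induction k)
    case 0
    then show ?case using K dist_self[OF \<sigma>M] by simp
  next
    case (Suc k)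
    have "d (\<sigma> 0) (\<sigma> (Suc k)) \<le> d (\<sigma> 0) (\<sigma> 1) + d (\<sigma> 1) (\<sigma> (Suc k))"
      by (rule dist_triangle[OF \<sigma>M \<sigma>M \<sigma>M])
    also have "d (\<sigma> 1) (\<sigma> (Suc k)) \<le> d (\<sigma> 0) (\<sigma> k) / 2"
      using step[OF \<sigma>M \<sigma>M, of 0 k] by (simp add: \<sigma>Suc)
    finally show ?case using Suc by (simp add: K_def)
  qed
  have shift: "d (\<sigma> n) (\<sigma> (n + k)) \<le> K * (1 / 2) ^ n" for n k
  proof (induction n)
    case (Suc n)
    then show ?case using step[OF \<sigma>M \<sigma>M, of n "n + k"] by (simp add: \<sigma>Suc)
  qed (use from0 in simp)
  have lim: "(\<lambda>n. K * (1 / 2) ^ n) \<longlonglongrightarrow> 0"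
    by (intro tendsto_mult_right_zero LIMSEQ_power_zero) simp
  have "MCauchy \<sigma>"
    unfolding MCauchy_def
  proof (intro conjI allI impI)
    show "range \<sigma> \<subseteq> M" using \<sigma>M by auto
    fix e :: real assume "e > 0"
    then obtain N where N: "K * (1 / 2) ^ n < e" if "n \<ge> N" for n
      using order_tendstoD(2)[OF lim] unfolding eventually_sequentially by blast
    show "\<exists>N. \<forall>n n'. N \<le> n \<longrightarrow> N \<le> n' \<longrightarrow> d (\<sigma> n) (\<sigma> n') < e"
    proof (intro exI allI impI)
      fix n n' assume n: "N \<le> n" "N \<le> n'"
      show "d (\<sigma> n) (\<sigma> n') < e"
        using shift[of n "n' - n"] shift[of n' "n - n'"] N[OF n(1)] N[OF n(2)] dist_commute[of "\<sigma> n" "\<sigma> n'"]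
        by (cases "n \<le> n'") auto
    qed
  qed
  then obtain Q where "limitin mtopology \<sigma> Q sequentially"
    using compl unfolding mcomplete_def by blast
  then have Q: "Q \<in> M" and lim': "\<And>e. e > 0 \<Longrightarrow> \<forall>\<^sub>F n in sequentially. d (\<sigma> n) Q < e"
    unfolding limitin_metric by (auto elim: eventually_mono)
  \<comment> \<open>Once \<open>mu (\<sigma> n)\<close> has dropped below \<open>mu Q / 2\<close>,
    \<open>mu_dist\<close> keeps \<open>\<sigma> n\<close> at distance at least
    \<open>D 1 2 * (mu Q / 2)\<close> from \<open>Q\<close>.\<close>
  have muQ: "mu Q > 0" by (rule mu_pos[OF Q])
  have "\<forall>\<^sub>F n in sequentially. (1 / 2 :: real) ^ n < mu Q / 2"
    by (rule order_tendstoD(2)[OF LIMSEQ_power_zero]) (use muQ in auto)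
  moreover have "\<forall>\<^sub>F n in sequentially. d (\<sigma> n) Q < D 1 2 * (mu Q / 2)"
    by (rule lim') (use D_pos muQ in simp)
  ultimately have "\<forall>\<^sub>F n in sequentially. False"
  proof eventually_elim
    case (elim n)
    have "mu Q / 2 \<le> \<bar>mu (\<sigma> n) - mu Q\<bar>" using elim(1) unfolding mu\<sigma> by linarith
    then have "D 1 2 * (mu Q / 2) \<le> D 1 2 * \<bar>mu (\<sigma> n) - mu Q\<bar>"
      using D_pos by simp
    also have "\<dots> \<le> d (\<sigma> n) Q" by (rule mu_dist[OF \<sigma>M Q])
    finally show False using elim(2) by simp
  qed
  then show False by simp
qed

end

theorem theorem1p6:
  fixes X :: "'a topology"
    and \<A> :: "('a, real^'n) chart set"
    and g :: "('a, 'n) metric_components"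
    and H :: "('a \<Rightarrow> 'a) set"
    and T :: "('a \<Rightarrow> 'a) topology"
    and \<B> :: "('a \<Rightarrow> 'a, 'e::euclidean_space) chart set"
    and P0 :: 'a and l :: nat and R :: "'a \<Rightarrow> real"
  assumes "smooth_manifold X \<A>" and "connected_space X"
    and "pseudo_riemannian_metric \<A> g"
    and "connected_lie_group_of_homotheties X \<A> g H T \<B>"
    and "acts_transitively X H (topspace X)"
    and "\<exists>\<Phi>\<in>H. homothety_character X \<A> g \<Phi> \<noteq> 1"
    and "\<not> VSI X \<A> g"
    and "P0 \<in> topspace X"
    and "scalar_weyl_invariant \<A> g l R" and "\<forall>P\<in>topspace X. R P \<noteq> 0"
  shows
    "(\<forall>c>0.
        level_set X P0 l R c \<noteq> {} \<and>
        smooth_submanifold_codim \<A> 1 (level_set X P0 l R c) \<and>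
        (\<forall>l' R'. scalar_weyl_invariant \<A> g l' R' \<and> (\<forall>P\<in>topspace X. R' P \<noteq> 0) \<longrightarrow>
           level_set X P0 l' R' c = level_set X P0 l R c) \<and>
        acts_transitively X (isometries_in X \<A> g H) (level_set X P0 l R c)) \<and>
     (riemannian \<A> g \<longrightarrow>
        (\<exists>\<kappa>>0. \<forall>c>0. \<forall>d>0.
           riemannian_set_dist X \<A> g (level_set X P0 l R c) (level_set X P0 l R d) = \<kappa> * \<bar>c - d\<bar>) \<and>
        \<not> riemannian_complete X \<A> g)"
proof -
  interpret homothety_homogeneous X \<A> g H T \<B> P0 l R
    using assms by unfold_locales auto
  show ?thesis
  proof (intro conjI allI impI)
    assume riem: "riemannian \<A> g"
    interpret riemannian_homothety_homogeneous X \<A> g H T \<B> P0 l R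
      using riem conn by unfold_locales
    show "\<exists>\<kappa>>0. \<forall>c>0. \<forall>d>0.
        riemannian_set_dist X \<A> g (level_set X P0 l R c) (level_set X P0 l R d) = \<kappa> * \<bar>c - d\<bar>"
      using D_pos D_eq unfolding D_def by blast
    show "\<not> riemannian_complete X \<A> g" by (rule not_complete)
  qed (use level_nonempty level_submanifold level_independent isometries_act_transitively in metis)+
qed

end
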